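(* Let $n\ge 1$ and let $\lambda$ be a partition with $l(\lambda)\le 2n$, regarded as a vector $(\lambda_1,\dots,\lambda_{2n})$ with $2n$ parts (zeros allowed). Let $\alpha\in\mathbb{C}$. Then $$\frac{1}{\int_T \tilde\Delta_K^{(n)}(x;1,-1,\sqrt t,-\sqrt t;t)\,dT}\int_T P_\lambda(x_1^{\pm1},\dots,x_n^{\pm1};t)\,\tilde\Delta_K^{(n)}(x;1,-1,\sqrt t,-\sqrt t;t)\prod_{i=1}^n(1-\alpha x_i^{\pm1})\,dT$$ $$=\frac{\phi_{2n}(t)}{v_\lambda(t)(1-t)^{2n}}\Big[(-\alpha)^{\#\text{ of odd parts of }\lambda}+(-\alpha)^{\#\text{ of even parts of }\lambda}\Big]=\frac{[2n]!}{v_\lambda(t)}\Big[(-\alpha)^{\#\text{ of odd parts of }\lambda}+(-\alpha)^{\#\text{ of even parts of }\lambda}\Big].$$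
   Context: Let $t\in\mathbb{C}$ with $|t|<1$ and fix a square root $\sqrt t$. $T=\{(x_1,\dots,x_k):|x_1|=\dots=|x_k|=1\}$ is the torus in the variables of integration, $dT=\prod_j \frac{dx_j}{2\pi\sqrt{-1}\,x_j}$. $[i]=(1-t^i)/(1-t)$, $[m]!=[m][m-1]\cdots[1]$, $[0]!=1$; $\phi_r(t)=(1-t)(1-t^2)\cdots(1-t^r)$. For a partition $\lambda$ with $N$ parts (zeros included), $m_i(\lambda)$ is the number of $j\in\{1,\dots,N\}$ with $\lambda_j=i$, and $v_\lambda(t)=\prod_{i\ge0}[m_i(\lambda)]!$ (zero parts are counted). The Hall--Littlewood polynomial in $N$ variables is $P_\lambda(z_1,\dots,z_N;t)=\frac{1}{v_\lambda(t)}\sum_{w\in S_N}w\Big(z^\lambda\prod_{1\le i<j\le N}\frac{z_i-tz_j}{z_i-z_j}\Big)$, with $w$ permuting the subscripts of the variables. $P_\lambda(x_1^{\pm1},\dots,x_n^{\pm1};t)$ is its value at the $2n$ arguments $x_1,x_1^{-1},\dots,x_n,x_n^{-1}$. The symmetric Koornwinder density is $$\tilde\Delta_K^{(k)}(x;a,b,c,d;t)=\frac{1}{2^kk!}\prod_{1\le i\le k}\frac{1-x_i^{\pm2}}{(1-ax_i^{\pm1})(1-bx_i^{\pm1})(1-cx_i^{\pm1})(1-dx_i^{\pm1})}\prod_{1\le i<j\le k}\frac{1-x_i^{\pm1}x_j^{\pm1}}{1-tx_i^{\pm1}x_j^{\pm1}},$$ where an expression with $\pm$ signs denotes the product over all choices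 of signs, e.g. $1-x_i^{\pm2}$ means $(1-x_i^2)(1-x_i^{-2})$, $1-\alpha x_i^{\pm1}$ means $(1-\alpha x_i)(1-\alpha x_i^{-1})$, and $1-x_i^{\pm1}x_j^{\pm1}$ is a product of four factors. Common factors (when parameters equal $\pm1$) are cancelled. The numbers of odd and even parts of $\lambda$ are counted among all $2n$ entries, a zero entry being an even part. *)

theory Defs
  imports "HOL-Analysis.Analysis"
begin

definition qint :: "complex \<Rightarrow> nat \<Rightarrow> complex" where
  "qint t i = (1 - t ^ i) / (1 - t)"

definition qfact :: "complex \<Rightarrow> nat \<Rightarrow> complex" where
  "qfact t m = (\<Prod>i = 1..m. qint t i)"

definition qphi :: "nat \<Rightarrow> complex \<Rightarrow> complex" where
  "qphi r t = (\<Prod>i = 1..r. 1 - t ^ i)"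

(* A partition with N parts, zeros included, is a weakly decreasing list of length N. *)
definition is_partition :: "nat \<Rightarrow> nat list \<Rightarrow> bool" where
  "is_partition N lam \<longleftrightarrow> length lam = N \<and> sorted_wrt (\<ge>) lam"

(* Values i that are not parts of lam have multiplicity 0 and contribute the factor [0]! = 1,
   so the product over all i \<ge> 0 is the finite product over the entries of lam. *)
definition hl_v :: "nat list \<Rightarrow> complex \<Rightarrow> complex" where
  "hl_v lam t = (\<Prod>i\<in>set lam. qfact t (count_list lam i))"

(* The variables z_1, ..., z_N are z 0, ..., z (N - 1). *)
definition hl_term :: "nat list \<Rightarrow> complex \<Rightarrow> (nat \<Rightarrow> complex) \<Rightarrow> complex" where
  "hl_term lam t z =
     (\<Prod>i<length lam. z i ^ (lam ! i)) *
     (\<Prod>j<length lam. \<Prod>i<j. (z i - t * z j) / (z i - z j))"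

definition hl_rational :: "nat list \<Rightarrow> complex \<Rightarrow> (nat \<Rightarrow> complex) \<Rightarrow> complex" where
  "hl_rational lam t z =
     (\<Sum>w | w permutes {..<length lam}. hl_term lam t (z \<circ> w)) / hl_v lam t"

definition is_polynomial_fun :: "nat \<Rightarrow> ((nat \<Rightarrow> complex) \<Rightarrow> complex) \<Rightarrow> bool" where
  "is_polynomial_fun N f \<longleftrightarrow>
     (\<exists>(M :: (nat \<Rightarrow> nat) set) c. finite M \<and>
        f = (\<lambda>z. \<Sum>m\<in>M. c m * (\<Prod>i<N. z i ^ m i)))"

(* The symmetrized sum is a polynomial, although its summands have poles where two variables
   coincide.  Division by 0 makes hl_rational meaningless at such points, so the polynomial is
   characterized by its values at points with distinct coordinates; these are dense, hence
   determine it. *)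
definition hall_littlewood :: "nat list \<Rightarrow> complex \<Rightarrow> (nat \<Rightarrow> complex) \<Rightarrow> complex" where
  "hall_littlewood lam t =
     (THE f. is_polynomial_fun (length lam) f \<and>
             (\<forall>z. inj_on z {..<length lam} \<longrightarrow> f z = hl_rational lam t z))"

(* The sequence x_1, 1/x_1, x_2, 1/x_2, ... *)
definition pm_args :: "(nat \<Rightarrow> complex) \<Rightarrow> nat \<Rightarrow> complex" where
  "pm_args x i = (if even i then x (i div 2) else inverse (x (i div 2)))"

definition pm_factor :: "complex \<Rightarrow> complex \<Rightarrow> complex" where
  "pm_factor a x = (1 - a * x) * (1 - a * inverse x)"

definition pm_pair_factor :: "complex \<Rightarrow> complex \<Rightarrow> complex \<Rightarrow> complex" where
  "pm_pair_factor a x y =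
     (1 - a * x * y) * (1 - a * x * inverse y) *
     (1 - a * inverse x * y) * (1 - a * inverse x * inverse y)"

(* Taking the limit cancels the common factors of numerator and denominator, which occur when
   a parameter is 1 or -1; where the denominator is nonzero the limit is the plain value (x \<noteq> 0). *)
definition koornwinder_univ ::
    "complex \<Rightarrow> complex \<Rightarrow> complex \<Rightarrow> complex \<Rightarrow> complex \<Rightarrow> complex" where
  "koornwinder_univ a b c d x =
     Lim (at x) (\<lambda>y. pm_factor 1 (y\<^sup>2) /
       (pm_factor a y * pm_factor b y * pm_factor c y * pm_factor d y))"

definition koornwinder_density ::
    "nat \<Rightarrow> complex \<Rightarrow> complex \<Rightarrow> complex \<Rightarrow> complex \<Rightarrow> complex \<Rightarrow>
     (nat \<Rightarrow> complex) \<Rightarrow> complex" where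
  "koornwinder_density k a b c d t x =
     1 / (2 ^ k * fact k) *
     (\<Prod>i<k. koornwinder_univ a b c d (x i)) *
     (\<Prod>j<k. \<Prod>i<j. pm_pair_factor 1 (x i) (x j) / pm_pair_factor t (x i) (x j))"

(* For x = exp (2 pi i theta) one has dx / (2 pi i x) = d theta, so this is the measure
   dx / (2 pi i x) on the unit circle, and torus k carries the measure dT. *)
definition circle_measure :: "complex measure" where
  "circle_measure = distr (uniform_measure lborel {0..1}) borel (\<lambda>\<theta>::real. cis (2 * pi * \<theta>))"

definition torus :: "nat \<Rightarrow> (nat \<Rightarrow> complex) measure" where
  "torus k = PiM {..<k} (\<lambda>_. circle_measure)"

end

theory Submission
  imports Defs "HOL-Complex_Analysis.Cauchy_Integral_Formula" "HOL-Combinatorics.Multiset_Permutations"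
    "HOL-Probability.Infinite_Product_Measure"
begin

text \<open>
For a finite set A of complex numbers and a list of exponents, the Hall--Littlewood sum over the
orderings of A can be organized by the element a that receives the first exponent l: it
contributes a^l times the product of (a - t b) / (a - b) over the other b in A times the sum for
the remaining exponents and elements. Here A consists of the points x_i, 1/x_i and a set E of
signs (a subset of {1, -1}), empty in the theorem. A sign e in A goes together with the
additional factor (1 - e x)(1 - e/x) / ((1 - t e x)(1 - t e/x)) for each variable x in the
density.

When a = x_k, the kernel cancels half of every density factor that involves x_k. What is left of
the integrand is G(x_k) / (x_k - 1/x_k) times the density of the other variables, where G is
holomorphic on a disc of radius larger than 1 around 0; there is no pole at 0 as long as no
later exponent exceeds l + 1 (inverting all points turns the remaining sum into a polynomial).
The term a = 1/x_k is the same with x_k inverted, and the integral over the circle of (G(y) -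
G(1/y)) / (y - 1/y) is (G(1) - G(-1)) / 2. So x_k disappears and is replaced by a sign \<delta>
= 1 or -1, which joins E; if \<delta> already belongs to E, then G(\<delta>) = 0. When a is a
sign e, the kernel cancels the density factor of e up to a constant, so e leaves E. This gives
the recursion \<open>hl_integral_Cons\<close>, in which one exponent is removed and the only
traces of it are powers of signs. The recursion is solved in closed form by
\<open>hl_integral_value\<close>: for a nonempty list of exponents and up to a constant
independent of them, the integral is 1 if all exponents are even, the product of E if all are
odd, and 0 if both parities occur.

For the theorem, the product of 1 - \<alpha> a over A times the sum for \<lambda> is the sum
over 0-1 vectors b of (-\<alpha>)^|b| times the sum for \<lambda> + b. The vector \<lambda> + b
need not be weakly decreasing, but a later entry exceeds an earlier one by at most 1, which is
exactly what the recursion tolerates. Only two vectors give entries of a single parity: the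
indicator of the odd parts and that of the even parts of \<lambda>. The normalization follows
from the same evaluation at \<lambda> = 0, where the Hall--Littlewood sum is the constant [2n]!.
\<close>

section \<open>Polynomial functions of several variables\<close>

text \<open>The variables are indexed by an arbitrary set: which of them occur later depends on the points
and signs that are still present.\<close>

definition polyfun :: "nat set \<Rightarrow> ((nat \<Rightarrow> complex) \<Rightarrow> complex) \<Rightarrow> bool" where
  "polyfun J f \<longleftrightarrow> (\<exists>(M :: (nat \<Rightarrow> nat) set) c. finite M \<and>
     f = (\<lambda>z. \<Sum>m\<in>M. c m * (\<Prod>i\<in>J. z i ^ m i)))"

lemma is_polynomial_fun_iff: "is_polynomial_fun N f \<longleftrightarrow> polyfun {..<N} f"
  by (simp add: is_polynomial_fun_def polyfun_def)

lemma polyfun_monom: "polyfun J (\<lambda>z. c * (\<Prod>i\<in>J. z i ^ m i))"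
  unfolding polyfun_def by (rule exI[of _ "{m}"], rule exI[of _ "\<lambda>_. c"]) simp

lemma polyfun_add:
  assumes "polyfun J f" "polyfun J g"
  shows "polyfun J (\<lambda>z. f z + g z)"
proof -
  obtain M c where f: "finite M" "f = (\<lambda>z. \<Sum>m\<in>M. c m * (\<Prod>i\<in>J. z i ^ m i))"
    using assms(1) unfolding polyfun_def by blast
  obtain L d where g: "finite L" "g = (\<lambda>z. \<Sum>m\<in>L. d m * (\<Prod>i\<in>J. z i ^ m i))"
    using assms(2) unfolding polyfun_def by blast
  define e where "e m = (if m \<in> M then c m else 0) + (if m \<in> L then d m else 0)" for m
  have "f z + g z = (\<Sum>m\<in>M \<union> L. e m * (\<Prod>i\<in>J. z i ^ m i))" for z
  proof -
    have "f z = (\<Sum>m\<in>M \<union> L. (if m \<in> M then c m else 0) * (\<Prod>i\<in>J. z i ^ m i))"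
      unfolding f(2) using f(1) g(1) by (intro sum.mono_neutral_cong_left) auto
    moreover have "g z = (\<Sum>m\<in>M \<union> L. (if m \<in> L then d m else 0) * (\<Prod>i\<in>J. z i ^ m i))"
      unfolding g(2) using f(1) g(1) by (intro sum.mono_neutral_cong_left) auto
    ultimately show ?thesis
      by (simp only: e_def distrib_right sum.distrib)
  qed
  then show ?thesis
    unfolding polyfun_def using f(1) g(1) by (intro exI[of _ "M \<union> L"] exI[of _ e]) auto
qed

lemma polyfun_const: "polyfun J (\<lambda>z. c)"
  using polyfun_monom[of J c "\<lambda>_. 0"] by simp

lemma polyfun_sum: "(\<And>s. s \<in> S \<Longrightarrow> polyfun J (f s)) \<Longrightarrow> polyfun J (\<lambda>z. \<Sum>s\<in>S. f s z)"
  by (induction S rule: infinite_finite_induct) (auto intro: polyfun_add polyfun_const)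

lemma polyfun_mult:
  assumes "polyfun J f" "polyfun J g"
  shows "polyfun J (\<lambda>z. f z * g z)"
proof -
  obtain M c where f: "finite M" "f = (\<lambda>z. \<Sum>m\<in>M. c m * (\<Prod>i\<in>J. z i ^ m i))"
    using assms(1) unfolding polyfun_def by blast
  obtain L d where g: "finite L" "g = (\<lambda>z. \<Sum>m\<in>L. d m * (\<Prod>i\<in>J. z i ^ m i))"
    using assms(2) unfolding polyfun_def by blast
  have "f z * g z = (\<Sum>m\<in>M. \<Sum>k\<in>L. (c m * d k) * (\<Prod>i\<in>J. z i ^ (m i + k i)))" for z
    by (simp add: f(2) g(2) sum_product power_add prod.distrib mult_ac)
  moreover have "polyfun J (\<lambda>z. \<Sum>m\<in>M. \<Sum>k\<in>L. (c m * d k) * (\<Prod>i\<in>J. z i ^ (m i + k i)))"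
    by (intro polyfun_sum polyfun_monom)
  ultimately show ?thesis by simp
qed

lemma polyfun_var:
  assumes "finite J" "k \<in> J"
  shows "polyfun J (\<lambda>z. z k)"
proof -
  have "(\<Prod>i\<in>J. z i ^ (if i = k then 1 else 0)) = z k" for z :: "nat \<Rightarrow> complex"
    using assms by (subst prod.remove[of _ k]) auto
  then show ?thesis using polyfun_monom[of J 1 "\<lambda>i. if i = k then 1 else 0"] by simp
qed

lemma polyfun_power: "polyfun J f \<Longrightarrow> polyfun J (\<lambda>z. f z ^ k)"
  by (induction k) (auto intro: polyfun_mult polyfun_const)

lemma polyfun_prod: "(\<And>s. s \<in> S \<Longrightarrow> polyfun J (f s)) \<Longrightarrow> polyfun J (\<lambda>z. \<Prod>s\<in>S. f s z)"
  by (induction S rule: infinite_finite_induct) (auto intro: polyfun_mult polyfun_const)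

lemma polyfun_diff:
  assumes "polyfun J f" "polyfun J g"
  shows "polyfun J (\<lambda>z. f z - g z)"
  using polyfun_add[OF assms(1) polyfun_mult[OF polyfun_const[of J "-1"] assms(2)]] by simp

lemma polyfun_tendsto:
  assumes "polyfun J f" "\<And>i. i \<in> J \<Longrightarrow> ((\<lambda>e. g e i) \<longlongrightarrow> z i) F"
  shows "((\<lambda>e. f (g e)) \<longlongrightarrow> f z) F"
proof -
  obtain M c where f: "finite M" "f = (\<lambda>z. \<Sum>m\<in>M. c m * (\<Prod>i\<in>J. z i ^ m i))"
    using assms(1) unfolding polyfun_def by blast
  show ?thesis unfolding f(2)
    by (intro tendsto_sum tendsto_mult tendsto_const tendsto_prod tendsto_power assms(2))
qed

lemma eventually_line_neq:
  fixes a b c d :: complex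
  assumes "c \<noteq> d"
  shows "eventually (\<lambda>e. a + e * c \<noteq> b + e * d) (at 0)"
proof -
  have "eventually (\<lambda>e. e \<noteq> (b - a) / (c - d)) (at (0::complex))"
    by (rule eventually_neq_at_within)
  then show ?thesis
    by eventually_elim (use assms in \<open>auto simp: field_simps\<close>)
qed

lemma polyfun_along_line:
  assumes "polyfun J f"
  shows "((\<lambda>e. f (\<lambda>i. z i + e * d i)) \<longlongrightarrow> f z) (at 0)"
proof (rule polyfun_tendsto[OF assms])
  fix i
  have "((\<lambda>e. z i + e * d i) \<longlongrightarrow> z i + 0 * d i) (at 0)" by (intro tendsto_intros)
  then show "((\<lambda>e. z i + e * d i) \<longlongrightarrow> z i) (at 0)" by simp
qed

text \<open>Points with distinct coordinates are dense: moving along the direction (0, 1, 2, ...) separates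
any two coordinates for all small nonzero times.\<close>

lemma polyfun_unique:
  assumes "polyfun J f" "polyfun J g" "finite J"
    and eq: "\<And>z. inj_on z J \<Longrightarrow> f z = g z"
  shows "f = g"
proof
  fix z
  define y where "y e i = z i + e * complex_of_real (real i)" for e i
  have "eventually (\<lambda>e. \<forall>i\<in>J. \<forall>k\<in>J. i \<noteq> k \<longrightarrow> y e i \<noteq> y e k) (at 0)"
  proof (intro eventually_ball_finite ballI assms)
    fix i k
    show "eventually (\<lambda>e. i \<noteq> k \<longrightarrow> y e i \<noteq> y e k) (at 0)"
      by (cases "i = k") (auto simp: y_def intro: eventually_line_neq)
  qed
  then have "eventually (\<lambda>e. f (y e) = g (y e)) (at 0)"
    by eventually_elim (rule eq, unfold inj_on_def, blast)
  moreover have "((\<lambda>e. f (y e)) \<longlongrightarrow> f z) (at 0)"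
    unfolding y_def by (rule polyfun_along_line[OF assms(1)])
  ultimately have "((\<lambda>e. g (y e)) \<longlongrightarrow> f z) (at 0)"
    by (rule Lim_transform_eventually[rotated])
  moreover have "((\<lambda>e. g (y e)) \<longlongrightarrow> g z) (at 0)"
    unfolding y_def by (rule polyfun_along_line[OF assms(2)])
  ultimately show "f z = g z"
    by (rule tendsto_unique[OF at_neq_bot])
qed

lemma polyfun_compose:
  assumes "polyfun J f" "\<And>i. i \<in> J \<Longrightarrow> polyfun I (h i)"
  shows "polyfun I (\<lambda>z. f (\<lambda>i. h i z))"
proof -
  obtain M c where f: "finite M" "f = (\<lambda>z. \<Sum>m\<in>M. c m * (\<Prod>i\<in>J. z i ^ m i))"
    using assms(1) unfolding polyfun_def by blast
  show ?thesis unfolding f(2)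
    by (intro polyfun_sum polyfun_mult polyfun_const polyfun_prod polyfun_power assms(2))
qed

text \<open>Monomial by monomial, this is the factorization of a^m - b^m.\<close>

lemma polyfun_diff_quotient:
  assumes "polyfun J f" "finite J" "i \<in> J" "k \<in> J"
  shows "\<exists>g. polyfun J g \<and> (\<forall>z. f z - f (z(i := z k)) = (z i - z k) * g z)"
proof -
  obtain M c where f: "finite M" "f = (\<lambda>z. \<Sum>m\<in>M. c m * (\<Prod>i\<in>J. z i ^ m i))"
    using assms(1) unfolding polyfun_def by blast
  define g where "g z = (\<Sum>m\<in>M. c m * (\<Prod>l\<in>J-{i}. z l ^ m l) *
      (\<Sum>j<m i. z k ^ (m i - Suc j) * z i ^ j))" for z :: "nat \<Rightarrow> complex"
  have "polyfun J g" unfolding g_def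
    by (intro polyfun_sum polyfun_mult polyfun_const polyfun_prod polyfun_power polyfun_var assms) auto
  moreover have "f z - f (z(i := z k)) = (z i - z k) * g z" for z
  proof -
    have *: "(\<Prod>l\<in>J. z' l ^ m l) = z' i ^ m i * (\<Prod>l\<in>J-{i}. z' l ^ m l)" for z' :: "nat \<Rightarrow> complex" and m
      using assms by (subst prod.remove[of _ i]) auto
    have **: "(\<Prod>l\<in>J-{i}. (z(i := z k)) l ^ m l) = (\<Prod>l\<in>J-{i}. z l ^ m l)" for m
      by (intro prod.cong) auto
    have "c m * (\<Prod>l\<in>J. z l ^ m l) - c m * (\<Prod>l\<in>J. (z(i := z k)) l ^ m l) =
       (z i - z k) * (c m * (\<Prod>l\<in>J-{i}. z l ^ m l) *
      (\<Sum>j<m i. z k ^ (m i - Suc j) * z i ^ j))" for m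
    proof -
      have "c m * (\<Prod>l\<in>J. z l ^ m l) - c m * (\<Prod>l\<in>J. (z(i := z k)) l ^ m l) =
         c m * (\<Prod>l\<in>J-{i}. z l ^ m l) * (z i ^ m i - z k ^ m i)"
        by (simp add: * ** algebra_simps)
      also have "\<dots> = c m * (\<Prod>l\<in>J-{i}. z l ^ m l) * ((z i - z k) * (\<Sum>j<m i. z k ^ (m i - Suc j) * z i ^ j))"
        by (simp only: power_diff_sumr2 mult_ac)
      finally show ?thesis by (simp only: mult_ac)
    qed
    then show ?thesis
      by (simp only: f(2) g_def sum_subtractf[symmetric] sum_distrib_left)
  qed
  ultimately show ?thesis by (intro exI[of _ g] conjI allI)
qed

text \<open>A polynomial that vanishes on the hyperplane where z_i = z_k is divisible by z_i - z_k. The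
quotient still vanishes on every other hyperplane of the family, because the points of such a
hyperplane outside the first one are dense in it; so the divisions can be repeated.\<close>

lemma polyfun_divide_pairs:
  assumes f: "polyfun J f" and J: "finite J"
    and P: "finite P" "\<And>i k. (i, k) \<in> P \<Longrightarrow> i \<in> J \<and> k \<in> J \<and> i < k"
    and van: "\<And>i k z. (i, k) \<in> P \<Longrightarrow> z i = z k \<Longrightarrow> f z = 0"
  shows "\<exists>g. polyfun J g \<and> (\<forall>z. f z = (\<Prod>(i,k)\<in>P. z i - z k) * g z)"
  using P van
proof (induction P rule: finite_induct)
  case empty
  show ?case by (rule exI[of _ f]) (simp add: f)
next
  case (insert p P)
  obtain i k where p: "p = (i, k)" by force
  have ik: "i \<in> J" "k \<in> J" "i < k" using insert.prems(1)[of i k] p by auto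
  have "\<exists>g. polyfun J g \<and> (\<forall>z. f z = (\<Prod>(i,k)\<in>P. z i - z k) * g z)"
  proof (rule insert.IH)
    show "i \<in> J \<and> k \<in> J \<and> i < k" if "(i, k) \<in> P" for i k
      using insert.prems(1)[of i k] that by simp
    show "f z = 0" if "(i, k) \<in> P" "z i = z k" for i k z
      using insert.prems(2)[of i k z] that by simp
  qed
  then obtain g where g: "polyfun J g" "\<And>z. f z = (\<Prod>(i,k)\<in>P. z i - z k) * g z"
    by (elim exE conjE) (rule that, assumption, drule spec)
  have g0: "g z = 0" if z: "z i = z k" for z
  proof -
    \<comment> \<open>This direction stays inside the hyperplane where the coordinates i and k agree and leaves all other
hyperplanes of the family.\<close>
    define d where "d j = complex_of_real (real (if j = k then i else j))" for j
    have "eventually (\<lambda>e. \<forall>(a,b)\<in>P. z a + e * d a \<noteq> z b + e * d b) (at 0)"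
    proof (intro eventually_ball_finite insert.hyps ballI, clarify)
      fix a b assume ab: "(a, b) \<in> P"
      then have "a < b" using insert.prems(1)[of a b] by auto
      moreover have "(a, b) \<noteq> (i, k)" using ab insert.hyps p by auto
      ultimately have "d a \<noteq> d b" unfolding d_def using ik by auto
      then show "eventually (\<lambda>e. z a + e * d a \<noteq> z b + e * d b) (at 0)"
        by (rule eventually_line_neq)
    qed
    then have "eventually (\<lambda>e. g (\<lambda>i. z i + e * d i) = 0) (at 0)"
    proof eventually_elim
      case (elim e)
      have "f (\<lambda>i. z i + e * d i) = 0"
        by (rule insert.prems(2)[of i k]) (use ik p z in \<open>auto simp: d_def\<close>)
      moreover have "(\<Prod>(a,b)\<in>P. (z a + e * d a) - (z b + e * d b)) \<noteq> 0"
        using elim insert.hyps by (auto simp: prod_zero_iff case_prod_unfold)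
      ultimately show ?case using g(2)[of "\<lambda>i. z i + e * d i"] by simp
    qed
    then have "((\<lambda>e. g (\<lambda>i. z i + e * d i)) \<longlongrightarrow> 0) (at 0)"
      by (rule tendsto_eventually)
    then show "g z = 0"
      by (rule tendsto_unique[OF at_neq_bot polyfun_along_line[OF g(1), of z d]])
  qed
  obtain h where h: "polyfun J h" "\<And>z. g z - g (z(i := z k)) = (z i - z k) * h z"
    using polyfun_diff_quotient[OF g(1) J ik(1,2)] by blast
  have "g z = (z i - z k) * h z" for z
    using h(2)[of z] g0[of "z(i := z k)"] ik by simp
  then have "f z = (\<Prod>(i,k)\<in>insert p P. z i - z k) * h z" for z
    using insert.hyps p g(2)[of z] by (simp add: mult_ac)
  then show ?case using h(1) by (intro exI[of _ h] conjI allI)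
qed

section \<open>Hall--Littlewood sums over a finite set\<close>

text \<open>The kernel has two parameters because inverting all elements of A exchanges p and q (see
\<open>hls_inverse\<close> below). Working with a set of values rather than a sequence makes the symmetry in the
variables automatic.\<close>

fun hls :: "complex \<Rightarrow> complex \<Rightarrow> nat list \<Rightarrow> complex set \<Rightarrow> complex" where
  "hls p q [] A = 1"
| "hls p q (l # ls) A =
     (\<Sum>a\<in>A. a ^ l * (\<Prod>b\<in>A - {a}. (p * a - q * b) / (a - b)) * hls p q ls (A - {a}))"

lemma hl_term_Cons:
  "hl_term (l # ls) t z = z 0 ^ l * (\<Prod>j<length ls. (z 0 - t * z (Suc j)) / (z 0 - z (Suc j))) *
     hl_term ls t (\<lambda>i. z (Suc i))"
proof -
  have "(\<Prod>j<Suc (length ls). \<Prod>i<j. (z i - t * z j) / (z i - z j)) =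
     (\<Prod>j<length ls. (z 0 - t * z (Suc j)) / (z 0 - z (Suc j)) *
        (\<Prod>i<j. (z (Suc i) - t * z (Suc j)) / (z (Suc i) - z (Suc j))))"
    by (simp only: prod.lessThan_Suc_shift lessThan_0 prod.empty mult_1_left)
  also have "\<dots> = (\<Prod>j<length ls. (z 0 - t * z (Suc j)) / (z 0 - z (Suc j))) *
     (\<Prod>j<length ls. \<Prod>i<j. (z (Suc i) - t * z (Suc j)) / (z (Suc i) - z (Suc j)))"
    by (rule prod.distrib)
  finally have *: "(\<Prod>j<Suc (length ls). \<Prod>i<j. (z i - t * z j) / (z i - z j)) = \<dots>" .
  show ?thesis
    unfolding hl_term_def list.size add_0_right add_Suc_right *
    by (simp only: prod.lessThan_Suc_shift nth_Cons_0 nth_Cons_Suc mult_ac)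
qed

text \<open>An ordering of A is its first element followed by an ordering of the rest, and the
kernel splits accordingly.\<close>

lemma sum_hl_term_permutations:
  assumes "finite A" "card A = length lam"
  shows "(\<Sum>xs\<in>permutations_of_set A. hl_term lam t (nth xs)) = hls 1 t lam A"
  using assms
proof (induction lam arbitrary: A)
  case Nil
  then show ?case by (simp add: hl_term_def)
next
  case (Cons l ls)
  have "A \<noteq> {}" using Cons.prems by auto
  have "(\<Sum>xs\<in>permutations_of_set A. hl_term (l # ls) t (nth xs)) =
     (\<Sum>a\<in>A. \<Sum>xs\<in>(#) a ` permutations_of_set (A - {a}). hl_term (l # ls) t (nth xs))"
    unfolding permutations_of_set_nonempty[OF \<open>A \<noteq> {}\<close>]
    using Cons.prems(1) by (subst sum.UNION_disjoint) auto
  also have "\<dots> = (\<Sum>a\<in>A. \<Sum>ys\<in>permutations_of_set (A - {a}). hl_term (l # ls) t (nth (a # ys)))"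
    by (rule sum.cong[OF refl], subst sum.reindex) (auto simp: inj_on_def)
  also have "\<dots> = (\<Sum>a\<in>A. \<Sum>ys\<in>permutations_of_set (A - {a}).
       a ^ l * (\<Prod>b\<in>A - {a}. (a - t * b) / (a - b)) * hl_term ls t (nth ys))"
  proof (intro sum.cong refl)
    fix a ys assume a: "a \<in> A" and ys: "ys \<in> permutations_of_set (A - {a})"
    have ys': "set ys = A - {a}" "distinct ys" using permutations_of_setD[OF ys] by auto
    have len: "length ys = length ls"
      using distinct_card[OF ys'(2)] ys'(1) Cons.prems a by simp
    have "(\<Prod>j<length ls. (a - t * ys ! j) / (a - ys ! j)) = (\<Prod>b\<in>A - {a}. (a - t * b) / (a - b))"
      using prod.reindex_bij_betw[OF bij_betw_nth[OF ys'(2) refl ys'(1)[symmetric]],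
          of "\<lambda>b. (a - t * b) / (a - b)"] len by simp
    then show "hl_term (l # ls) t (nth (a # ys)) =
        a ^ l * (\<Prod>b\<in>A - {a}. (a - t * b) / (a - b)) * hl_term ls t (nth ys)"
      by (simp add: hl_term_Cons)
  qed
  also have "\<dots> = (\<Sum>a\<in>A. a ^ l * (\<Prod>b\<in>A - {a}. (a - t * b) / (a - b)) * hls 1 t ls (A - {a}))"
    using Cons.prems by (intro sum.cong refl) (simp add: sum_distrib_left[symmetric] Cons.IH)
  finally show ?case by simp
qed

lemma sum_hl_term_permutes:
  assumes "inj_on z {..<length lam}"
  shows "(\<Sum>w | w permutes {..<length lam}. hl_term lam t (z \<circ> w)) = hls 1 t lam (z ` {..<length lam})"
proof -
  let ?N = "length lam"
  let ?l = "\<lambda>w. map (z \<circ> w) [0..<?N]"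
  have inj: "inj_on ?l {w. w permutes {..<?N}}"
  proof (rule inj_onI, clarify)
    fix v w assume vw: "v permutes {..<?N}" "w permutes {..<?N}" "?l v = ?l w"
    show "v = w"
    proof
      fix i show "v i = w i"
      proof (cases "i < ?N")
        case True
        then have "z (v i) = z (w i)" using vw(3) by auto
        moreover have "v i \<in> {..<?N}" "w i \<in> {..<?N}"
          using True permutes_in_image[OF vw(1)] permutes_in_image[OF vw(2)] by auto
        ultimately show ?thesis using assms by (meson inj_onD)
      next
        case False
        then show ?thesis using vw by (simp add: permutes_not_in)
      qed
    qed
  qed
  have sub: "?l ` {w. w permutes {..<?N}} \<subseteq> permutations_of_set (z ` {..<?N})"
  proof (rule image_subsetI, rule permutations_of_setI)
    fix w assume "w \<in> {w. w permutes {..<?N}}"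
    then have w: "w permutes {..<?N}" by simp
    show "set (?l w) = z ` {..<?N}"
      using permutes_image[OF w] by (simp only: set_map set_upt lessThan_atLeast0 image_comp[symmetric])
    have "inj_on (z \<circ> w) {..<?N}"
      using assms permutes_image[OF w] permutes_inj_on[OF w] by (metis comp_inj_on)
    then show "distinct (?l w)"
      by (simp add: distinct_map lessThan_atLeast0)
  qed
  have "card (?l ` {w. w permutes {..<?N}}) = card (permutations_of_set (z ` {..<?N}))"
    using card_image[OF inj] card_permutations[of "{..<?N}" ?N] card_image[OF assms]
    by simp
  then have im: "?l ` {w. w permutes {..<?N}} = permutations_of_set (z ` {..<?N})"
    using sub by (intro card_subset_eq) auto
  have "(\<Sum>w | w permutes {..<?N}. hl_term lam t (z \<circ> w)) =
     (\<Sum>w | w permutes {..<?N}. hl_term lam t (nth (?l w)))"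
    by (intro sum.cong refl) (auto simp: hl_term_def intro!: arg_cong2[of _ _ _ _ "(*)"] prod.cong)
  also have "\<dots> = (\<Sum>xs\<in>permutations_of_set (z ` {..<?N}). hl_term lam t (nth xs))"
    unfolding im[symmetric] by (subst sum.reindex[OF inj]) simp
  also have "\<dots> = hls 1 t lam (z ` {..<?N})"
    using card_image[OF assms] by (intro sum_hl_term_permutations) auto
  finally show ?thesis .
qed

text \<open>Under a \<rightarrow> 1/a the kernel (p a - q b) / (a - b) becomes (q a - p b) / (a - b). This turns a polynomial
in 1/a into a polynomial in a, which is how the pole at the origin is avoided later.\<close>

lemma hls_inverse:
  assumes "finite A" "0 \<notin> A" "length lam = card A" "\<forall>l\<in>set lam. l \<le> d"
  shows "hls p q lam (inverse ` A) * (\<Prod>a\<in>A. a ^ d) = hls q p (map (\<lambda>l. d - l) lam) A"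
  using assms
proof (induction lam arbitrary: A)
  case (Cons l ls)
  have inj: "inj_on inverse B" for B :: "complex set" by (simp add: inj_on_def)
  have "hls p q (l # ls) (inverse ` A) * (\<Prod>a\<in>A. a ^ d) =
     (\<Sum>a\<in>A. inverse a ^ l * (\<Prod>b\<in>inverse ` A - {inverse a}. (p * inverse a - q * b) / (inverse a - b)) *
        hls p q ls (inverse ` A - {inverse a}) * (\<Prod>a\<in>A. a ^ d))"
    by (simp add: sum.reindex[OF inj] sum_distrib_right)
  also have "\<dots> = (\<Sum>a\<in>A. a ^ (d - l) * (\<Prod>b\<in>A - {a}. (q * a - p * b) / (a - b)) *
        hls q p (map (\<lambda>l. d - l) ls) (A - {a}))"
  proof (intro sum.cong refl)
    fix a assume a: "a \<in> A"
    have a0: "a \<noteq> 0" using a Cons.prems by auto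
    have im: "inverse ` A - {inverse a} = inverse ` (A - {a})" by auto
    have "(p * inverse a - q * inverse b) / (inverse a - inverse b) = (q * a - p * b) / (a - b)"
      if "b \<in> A - {a}" for b
    proof -
      have "b \<noteq> 0" "b \<noteq> a" using that Cons.prems by auto
      moreover from this a0 have "inverse a - inverse b \<noteq> 0" "a - b \<noteq> 0" by auto
      ultimately show ?thesis using a0
        by (simp add: frac_eq_eq) (simp add: field_simps)
    qed
    then have pr: "(\<Prod>b\<in>inverse ` (A - {a}). (p * inverse a - q * b) / (inverse a - b)) =
        (\<Prod>b\<in>A - {a}. (q * a - p * b) / (a - b))"
      by (subst prod.reindex[OF inj]) (simp add: o_def)
    have e1: "(\<Prod>a\<in>A. a ^ d) = a ^ d * (\<Prod>a\<in>A - {a}. a ^ d)"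
      using a Cons.prems by (simp add: prod.remove)
    have e2: "inverse a ^ l * a ^ d = a ^ (d - l)"
      using a0 Cons.prems(4) by (simp add: power_diff field_simps)
    have e3: "hls p q ls (inverse ` (A - {a})) * (\<Prod>a\<in>A - {a}. a ^ d) = hls q p (map (\<lambda>l. d - l) ls) (A - {a})"
      using Cons.prems a by (intro Cons.IH) auto
    have rearrange: "x * y * h * P = z * y * h'" if "P = u * P'" "x * u = z" "h * P' = h'"
      for x y z h P u P' h' :: complex
      using that by (auto simp: mult_ac)
    show "inverse a ^ l * (\<Prod>b\<in>inverse ` A - {inverse a}. (p * inverse a - q * b) / (inverse a - b)) *
        hls p q ls (inverse ` A - {inverse a}) * (\<Prod>a\<in>A. a ^ d) =
        a ^ (d - l) * (\<Prod>b\<in>A - {a}. (q * a - p * b) / (a - b)) *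
        hls q p (map (\<lambda>l. d - l) ls) (A - {a})"
      unfolding im pr by (rule rearrange[OF e1 e2 e3])
  qed
  finally show ?case by simp
qed simp

definition zero_one_lists :: "nat \<Rightarrow> nat list set" where
  "zero_one_lists n = {bs. set bs \<subseteq> {0, 1} \<and> length bs = n}"

lemma sum_zero_one_lists_0: "(\<Sum>bs\<in>zero_one_lists 0. f bs) = f []"
proof -
  have "zero_one_lists 0 = {[]}" by (auto simp: zero_one_lists_def)
  then show ?thesis by simp
qed

lemma sum_zero_one_lists_Suc:
  "(\<Sum>bs\<in>zero_one_lists (Suc n). f bs :: complex) = (\<Sum>bs\<in>zero_one_lists n. f (0 # bs) + f (1 # bs))"
proof -
  have fin: "finite (zero_one_lists n)"
    unfolding zero_one_lists_def by (rule finite_lists_length_eq) simp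
  have "zero_one_lists (Suc n) = (#) 0 ` zero_one_lists n \<union> (#) 1 ` zero_one_lists n"
    by (auto simp: zero_one_lists_def length_Suc_conv image_iff)
  moreover have "(#) (0::nat) ` zero_one_lists n \<inter> (#) 1 ` zero_one_lists n = {}" by auto
  ultimately show ?thesis
    using fin by (simp add: sum.union_disjoint sum.reindex inj_on_def sum.distrib)
qed

text \<open>Distribute the factor 1 + \<beta> a over the place at which a is used in the sum: it either leaves
the exponent there unchanged or raises it by one at the price of \<beta>.\<close>

lemma hls_linear_factors:
  assumes "finite A" "length lam = card A"
  shows "hls p q lam A * (\<Prod>a\<in>A. 1 + \<beta> * a) =
     (\<Sum>bs\<in>zero_one_lists (length lam). \<beta> ^ sum_list bs * hls p q (map2 (+) lam bs) A)"
  using assms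
proof (induction lam arbitrary: A)
  case Nil
  then show ?case by (simp add: sum_zero_one_lists_0)
next
  case (Cons l ls)
  let ?k = "\<lambda>a. \<Prod>b\<in>A - {a}. (p * a - q * b) / (a - b)"
  have "hls p q (l # ls) A * (\<Prod>a\<in>A. 1 + \<beta> * a) =
      (\<Sum>a\<in>A. a ^ l * ?k a * hls p q ls (A - {a}) * (\<Prod>a\<in>A. 1 + \<beta> * a))"
    by (simp add: sum_distrib_right)
  also have "\<dots> = (\<Sum>a\<in>A. a ^ l * (1 + \<beta> * a) * ?k a *
       (\<Sum>bs\<in>zero_one_lists (length ls). \<beta> ^ sum_list bs * hls p q (map2 (+) ls bs) (A - {a})))"
  proof (intro sum.cong refl)
    fix a assume a: "a \<in> A"
    have e1: "(\<Prod>a\<in>A. 1 + \<beta> * a) = (1 + \<beta> * a) * (\<Prod>a\<in>A - {a}. 1 + \<beta> * a)"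
      using a Cons.prems by (simp add: prod.remove)
    have e2: "hls p q ls (A - {a}) * (\<Prod>a\<in>A - {a}. 1 + \<beta> * a) =
      (\<Sum>bs\<in>zero_one_lists (length ls). \<beta> ^ sum_list bs * hls p q (map2 (+) ls bs) (A - {a}))"
      using a Cons.prems by (intro Cons.IH) auto
    have rearrange: "x * y * h * P = x * u * y * h'" if "P = u * P'" "h * P' = h'"
      for x y h P u P' h' :: complex
      using that by (auto simp: mult_ac)
    show "a ^ l * ?k a * hls p q ls (A - {a}) * (\<Prod>a\<in>A. 1 + \<beta> * a) =
      a ^ l * (1 + \<beta> * a) * ?k a *
       (\<Sum>bs\<in>zero_one_lists (length ls). \<beta> ^ sum_list bs * hls p q (map2 (+) ls bs) (A - {a}))"
      by (rule rearrange[OF e1 e2])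
  qed
  also have "\<dots> = (\<Sum>bs\<in>zero_one_lists (length ls). \<Sum>a\<in>A. a ^ l * (1 + \<beta> * a) * ?k a *
        (\<beta> ^ sum_list bs * hls p q (map2 (+) ls bs) (A - {a})))"
    by (subst sum.swap) (simp add: sum_distrib_left)
  also have "\<dots> = (\<Sum>bs\<in>zero_one_lists (length ls).
        \<beta> ^ sum_list (0 # bs) * hls p q (map2 (+) (l # ls) (0 # bs)) A
      + \<beta> ^ sum_list (1 # bs) * hls p q (map2 (+) (l # ls) (1 # bs)) A)"
    by (intro sum.cong refl) (simp add: sum_distrib_left sum.distrib[symmetric] algebra_simps)
  also have "\<dots> = (\<Sum>bs\<in>zero_one_lists (length (l # ls)). \<beta> ^ sum_list bs * hls p q (map2 (+) (l # ls) bs) A)"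
    by (simp only: sum_zero_one_lists_Suc list.size add_0_right add_Suc_right)
  finally show ?case .
qed

text \<open>Compare leading coefficients in the Lagrange interpolation formula for Q.\<close>

lemma lagrange_leading_coeff:
  fixes Q :: "complex poly"
  assumes "finite A" "degree Q \<le> card A - 1" "A \<noteq> {}"
  shows "coeff Q (card A - 1) = (\<Sum>a\<in>A. poly Q a / (\<Prod>b\<in>A - {a}. a - b))"
proof -
  define L where "L a = (\<Prod>b\<in>A - {a}. [:- b, 1:])" for a
  define R where "R = (\<Sum>a\<in>A. smult (poly Q a / (\<Prod>b\<in>A - {a}. a - b)) (L a))"
  have cpos: "card A > 0" using assms by (simp add: card_gt_0_iff)
  have degL: "degree (L a) = card A - 1" if "a \<in> A" for a
    unfolding L_def using that assms by (subst degree_prod_eq_sum_degree) auto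
  have lead: "coeff (L a) (card A - 1) = 1" if "a \<in> A" for a
  proof -
    have "lead_coeff (L a) = 1" unfolding L_def by (simp add: lead_coeff_prod)
    then show ?thesis by (simp add: degL[OF that])
  qed
  have "Q = R"
  proof (rule poly_eqI_degree)
    show "poly Q x = poly R x" if x: "x \<in> A" for x
    proof -
      have "poly (L a) x = (if a = x then (\<Prod>b\<in>A - {x}. x - b) else 0)" if "a \<in> A" for a
        unfolding L_def using x assms by (auto simp: poly_prod)
      then have "poly R x = (\<Sum>a\<in>A. if a = x then poly Q x / (\<Prod>b\<in>A - {x}. x - b) * (\<Prod>b\<in>A - {x}. x - b) else 0)"
        unfolding R_def poly_sum by (intro sum.cong) auto
      also have "\<dots> = poly Q x" using x assms by (simp add: prod_zero_iff)
      finally show ?thesis by simp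
    qed
    show "degree Q < card A" using assms cpos by linarith
    have "degree R \<le> card A - 1"
      unfolding R_def using assms degL by (intro degree_sum_le) (auto intro: order.trans[OF degree_smult_le])
    then show "degree R < card A" using cpos by linarith
  qed
  then have "coeff Q (card A - 1) = coeff R (card A - 1)" by simp
  also have "\<dots> = (\<Sum>a\<in>A. poly Q a / (\<Prod>b\<in>A - {a}. a - b))"
    unfolding R_def coeff_sum by (intro sum.cong refl) (simp only: coeff_smult lead mult_1_right)
  finally show ?thesis .
qed

text \<open>Lagrange interpolation of the product of X - t b over b in A, at the nodes A and 0; the node 0
accounts for the term t^N.\<close>

lemma sum_prod_hl_kernel:
  fixes A :: "complex set"
  assumes "finite A" "0 \<notin> A" "t \<noteq> 1"
  shows "(\<Sum>a\<in>A. \<Prod>b\<in>A - {a}. (a - t * b) / (a - b)) = qint t (card A)"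
proof -
  define Q where "Q = (\<Prod>b\<in>A. [:- (t * b), 1:])"
  have deg: "degree Q = card A" unfolding Q_def
    by (subst degree_prod_eq_sum_degree) auto
  have lead: "coeff Q (card A) = 1"
    using lead_coeff_prod[of "\<lambda>b. [:- (t * b), 1:]" A] deg by (simp add: Q_def)
  have "coeff Q (card (insert 0 A) - 1) =
     (\<Sum>a\<in>insert 0 A. poly Q a / (\<Prod>b\<in>insert 0 A - {a}. a - b))"
    using assms deg by (intro lagrange_leading_coeff) auto
  also have "\<dots> = poly Q 0 / (\<Prod>b\<in>A. - b) + (\<Sum>a\<in>A. poly Q a / (\<Prod>b\<in>insert 0 A - {a}. a - b))"
    using assms by simp
  also have "poly Q 0 = t ^ card A * (\<Prod>b\<in>A. - b)"
  proof -
    have "poly Q 0 = (\<Prod>b\<in>A. t * (- b))" by (simp add: Q_def poly_prod)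
    also have "\<dots> = t ^ card A * (\<Prod>b\<in>A. - b)" by (subst prod.distrib) simp
    finally show ?thesis .
  qed
  also have "(\<Sum>a\<in>A. poly Q a / (\<Prod>b\<in>insert 0 A - {a}. a - b)) =
     (\<Sum>a\<in>A. (1 - t) * (\<Prod>b\<in>A - {a}. (a - t * b) / (a - b)))"
  proof (intro sum.cong refl)
    fix a assume a: "a \<in> A"
    have a0: "a \<noteq> 0" using a assms by auto
    have "insert 0 A - {a} = insert 0 (A - {a})" using a0 by auto
    then have "(\<Prod>b\<in>insert 0 A - {a}. a - b) = a * (\<Prod>b\<in>A - {a}. a - b)"
      using assms by simp
    moreover have "poly Q a = (a - t * a) * (\<Prod>b\<in>A - {a}. a - t * b)"
    proof -
      have "poly Q a = (\<Prod>b\<in>A. a - t * b)" by (simp add: Q_def poly_prod)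
      also have "\<dots> = (a - t * a) * (\<Prod>b\<in>A - {a}. a - t * b)"
        using assms(1) a by (rule prod.remove)
      finally show ?thesis .
    qed
    ultimately show "poly Q a / (\<Prod>b\<in>insert 0 A - {a}. a - b) =
       (1 - t) * (\<Prod>b\<in>A - {a}. (a - t * b) / (a - b))"
    proof -
      have "Y / X = (1 - t) * (N / P)" if "X = a * P" "Y = (a - t * a) * N" for X Y N P
      proof -
        have "Y / X = (a * ((1 - t) * N)) / (a * P)" by (simp add: that algebra_simps)
        then show ?thesis using a0 by simp
      qed
      then show "poly Q a / (\<Prod>b\<in>insert 0 A - {a}. a - b) =
         (1 - t) * (\<Prod>b\<in>A - {a}. (a - t * b) / (a - b))"
        unfolding prod_dividef using \<open>(\<Prod>b\<in>insert 0 A - {a}. a - b) = a * (\<Prod>b\<in>A - {a}. a - b)\<close>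
          \<open>poly Q a = (a - t * a) * (\<Prod>b\<in>A - {a}. a - t * b)\<close> .
    qed
  qed
  finally have "coeff Q (card (insert 0 A) - 1) = t ^ card A * (\<Prod>b\<in>A. - b) / (\<Prod>b\<in>A. - b)
      + (1 - t) * (\<Sum>a\<in>A. \<Prod>b\<in>A - {a}. (a - t * b) / (a - b))"
    by (simp add: sum_distrib_left)
  moreover have "(\<Prod>b\<in>A. - b) \<noteq> 0" using assms by (auto simp: prod_zero_iff)
  moreover have "card (insert 0 A) - 1 = card A" using assms by simp
  ultimately show ?thesis using lead assms(3) by (simp add: qint_def field_simps)
qed

lemma hls_zero:
  assumes "finite A" "0 \<notin> A" "t \<noteq> 1"
  shows "hls 1 t (replicate (card A) 0) A = qfact t (card A)"
  using assms
proof (induction "card A" arbitrary: A)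
  case 0
  then show ?case by (simp add: qfact_def)
next
  case (Suc n)
  have "hls 1 t (replicate n 0) (A - {a}) = qfact t n" if "a \<in> A" for a
    using Suc.hyps(1)[of "A - {a}"] Suc.hyps(2)[symmetric] Suc.prems that by simp
  then have "hls 1 t (replicate (Suc n) 0) A = (\<Sum>a\<in>A. \<Prod>b\<in>A - {a}. (a - t * b) / (a - b)) * qfact t n"
    by (simp add: sum_distrib_right)
  also have "\<dots> = qint t (Suc n) * qfact t n"
    using Suc by (simp add: sum_prod_hl_kernel)
  finally show ?case by (simp add: qfact_def Suc.hyps(2)[symmetric] mult.commute)
qed

section \<open>Hall--Littlewood sums are polynomials\<close>

definition index_pairs :: "nat set \<Rightarrow> (nat \<times> nat) set" where
  "index_pairs I = {(i, k). i \<in> I \<and> k \<in> I \<and> i < k}"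

lemma finite_index_pairs [simp]: "finite I \<Longrightarrow> finite (index_pairs I)"
  by (rule finite_subset[of _ "I \<times> I"]) (auto simp: index_pairs_def)

text \<open>The function g need not be symmetric, hence the case distinction.\<close>

lemma prod_index_pairs_remove:
  assumes "finite I" "j \<in> I"
  shows "(\<Prod>(i,k)\<in>index_pairs I. g i k) =
     (\<Prod>i\<in>I - {j}. if i < j then g i j else g j i) * (\<Prod>(i,k)\<in>index_pairs (I - {j}). g i k :: complex)"
proof -
  let ?h = "\<lambda>i. if i < j then (i, j) else (j, i)"
  have inj: "inj_on ?h (I - {j})" by (auto simp: inj_on_def split: if_splits)
  have "index_pairs I = ?h ` (I - {j}) \<union> index_pairs (I - {j})"
    using assms(2) by (auto simp: index_pairs_def image_iff split: if_splits)
  moreover have "?h ` (I - {j}) \<inter> index_pairs (I - {j}) = {}"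
    by (auto simp: index_pairs_def)
  ultimately have "(\<Prod>(i,k)\<in>index_pairs I. g i k) =
     (\<Prod>(i,k)\<in>?h ` (I - {j}). g i k) * (\<Prod>(i,k)\<in>index_pairs (I - {j}). g i k)"
    using assms(1) by (simp add: prod.union_disjoint)
  also have "(\<Prod>(i,k)\<in>?h ` (I - {j}). g i k) = (\<Prod>i\<in>I - {j}. if i < j then g i j else g j i)"
    by (subst prod.reindex[OF inj]) (intro prod.cong refl, simp)
  finally show ?thesis .
qed

lemma prod_index_pairs_nested:
  "(\<Prod>j<n. \<Prod>i<j. g i j) = (\<Prod>(i,j)\<in>index_pairs {..<n}. g i j :: complex)"
proof -
  have "(\<Prod>j<n. \<Prod>i<j. g i j) = (\<Prod>(j,i)\<in>(SIGMA j:{..<n}. {..<j}). g i j)"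
    by (rule prod.Sigma) auto
  also have "\<dots> = (\<Prod>(i,j)\<in>index_pairs {..<n}. g i j)"
    by (rule prod.reindex_bij_witness[of _ "\<lambda>(i,j). (j,i)" "\<lambda>(i,j). (j,i)"])
       (auto simp: index_pairs_def)
  finally show ?thesis .
qed

definition vandermonde :: "nat set \<Rightarrow> (nat \<Rightarrow> complex) \<Rightarrow> complex" where
  "vandermonde I z = (\<Prod>(i,k)\<in>index_pairs I. z i - z k)"

text \<open>The constant is the sign produced by turning the factors with i < j around.\<close>

lemma vandermonde_remove:
  assumes "finite I" "j \<in> I"
  obtains s where "\<And>z. vandermonde I z = s * (\<Prod>i\<in>I - {j}. z j - z i) * vandermonde (I - {j}) z"
proof
  fix z :: "nat \<Rightarrow> complex"
  have "(\<Prod>i\<in>I - {j}. if i < j then z i - z j else z j - z i) =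
     (\<Prod>i\<in>I - {j}. (if i < j then -1 else 1) * (z j - z i))"
    by (intro prod.cong refl) (auto simp: algebra_simps)
  also have "\<dots> = (\<Prod>i\<in>I - {j}. if i < j then -1 else 1) * (\<Prod>i\<in>I - {j}. z j - z i)"
    by (rule prod.distrib)
  finally show "vandermonde I z = (\<Prod>i\<in>I - {j}. if i < j then -1 else 1) *
      (\<Prod>i\<in>I - {j}. z j - z i) * vandermonde (I - {j}) z"
    unfolding vandermonde_def by (subst prod_index_pairs_remove[OF assms]) simp
qed

lemma vandermonde_nonzero:
  assumes "finite I" "inj_on z I"
  shows "vandermonde I z \<noteq> 0"
proof -
  have "z i - z k \<noteq> 0" if "(i, k) \<in> index_pairs I" for i k
    using that inj_onD[OF assms(2), of i k] by (auto simp: index_pairs_def)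
  then show ?thesis
    unfolding vandermonde_def prod_zero_iff[OF finite_index_pairs[OF assms(1)]] by auto
qed

lemma vandermonde_cong: "(\<And>i. i \<in> I \<Longrightarrow> z i = z' i) \<Longrightarrow> vandermonde I z = vandermonde I z'"
  by (auto simp: vandermonde_def index_pairs_def intro!: prod.cong)

lemma vandermonde_swap:
  assumes "finite I" "i \<in> I" "k \<in> I" "i \<noteq> k"
  shows "vandermonde I (z \<circ> Transposition.transpose i k) = - vandermonde I z"
proof -
  let ?z = "z \<circ> Transposition.transpose i k" and ?K = "I - {k} - {i}"
  obtain s where s: "\<And>z. vandermonde I z = s * (\<Prod>l\<in>I - {k}. z k - z l) * vandermonde (I - {k}) z"
    using vandermonde_remove[OF assms(1,3)] by blast
  obtain r where r: "\<And>z. vandermonde (I - {k}) z = r * (\<Prod>l\<in>?K. z i - z l) * vandermonde ?K z"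
    using vandermonde_remove[of "I - {k}" i] assms by blast
  have *: "vandermonde I z = s * r * (z k - z i) * ((\<Prod>l\<in>?K. z k - z l) * (\<Prod>l\<in>?K. z i - z l)) * vandermonde ?K z" for z
  proof -
    have "(\<Prod>l\<in>I - {k}. z k - z l) = (z k - z i) * (\<Prod>l\<in>?K. z k - z l)"
      using assms by (intro prod.remove) auto
    then show ?thesis by (simp add: s[of z] r[of z])
  qed
  have fixed: "?z l = z l" if "l \<in> ?K" for l
    using that by (auto simp: transpose_apply_other)
  have "(\<Prod>l\<in>?K. ?z k - ?z l) = (\<Prod>l\<in>?K. z i - z l)" "(\<Prod>l\<in>?K. ?z i - ?z l) = (\<Prod>l\<in>?K. z k - z l)"
    using fixed by (auto intro!: prod.cong)
  moreover have "vandermonde ?K ?z = vandermonde ?K z"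
    by (rule vandermonde_cong) (rule fixed)
  ultimately show ?thesis
    unfolding *[of z] *[of ?z] by (simp add: algebra_simps)
qed

text \<open>The Vandermonde product clears all denominators of the kernel.\<close>

lemma hls_times_vandermonde:
  assumes "finite J" "I \<subseteq> J" "length lam = card I"
  shows "\<exists>f. polyfun J f \<and> (\<forall>z. inj_on z J \<longrightarrow> f z = hls p q lam (z ` I) * vandermonde I z)"
  using assms(2,3)
proof (induction lam arbitrary: I)
  case Nil
  then have "I = {}" using finite_subset[OF _ assms(1)] by auto
  then show ?case
    by (intro exI[of _ "\<lambda>_. 1"]) (auto simp: polyfun_const vandermonde_def index_pairs_def)
next
  case (Cons l ls)
  have fin: "finite I" using Cons.prems finite_subset[OF _ assms(1)] by auto
  have "\<forall>j\<in>I. \<exists>f. polyfun J f \<and> (\<forall>z. inj_on z J \<longrightarrow>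
      f z = hls p q ls (z ` (I - {j})) * vandermonde (I - {j}) z)"
    using Cons.prems fin by (intro ballI Cons.IH) auto
  then obtain f where f: "\<And>j. j \<in> I \<Longrightarrow> polyfun J (f j)"
    "\<And>j z. j \<in> I \<Longrightarrow> inj_on z J \<Longrightarrow> f j z = hls p q ls (z ` (I - {j})) * vandermonde (I - {j}) z"
    by metis
  have "\<forall>j\<in>I. \<exists>s. \<forall>z. vandermonde I z = s * (\<Prod>i\<in>I - {j}. z j - z i) * vandermonde (I - {j}) z"
    using vandermonde_remove[OF fin] by metis
  then obtain s where s: "\<And>j z. j \<in> I \<Longrightarrow>
      vandermonde I z = s j * (\<Prod>i\<in>I - {j}. z j - z i) * vandermonde (I - {j}) z"
    by metis
  define g where "g z = (\<Sum>j\<in>I. s j * z j ^ l * (\<Prod>i\<in>I - {j}. p * z j - q * z i) * f j z)" for z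
  have "polyfun J g" unfolding g_def
    using assms(1) Cons.prems
    by (intro polyfun_sum polyfun_mult polyfun_const polyfun_power polyfun_prod polyfun_diff polyfun_var f) auto
  moreover have "g z = hls p q (l # ls) (z ` I) * vandermonde I z" if z: "inj_on z J" for z
  proof -
    have zI: "inj_on z I" using inj_on_subset[OF z] Cons.prems by auto
    have "hls p q (l # ls) (z ` I) * vandermonde I z =
      (\<Sum>j\<in>I. z j ^ l * (\<Prod>b\<in>z ` I - {z j}. (p * z j - q * b) / (z j - b)) * hls p q ls (z ` I - {z j})
         * vandermonde I z)"
      by (simp add: sum.reindex[OF zI] sum_distrib_right)
    also have "\<dots> = g z" unfolding g_def
    proof (rule sum.cong[OF refl])
      fix j assume j: "j \<in> I"
      have im: "z ` I - {z j} = z ` (I - {j})"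
        using inj_onD[OF zI] j by auto
      have "(\<Prod>b\<in>z ` (I - {j}). (p * z j - q * b) / (z j - b)) =
         (\<Prod>i\<in>I - {j}. (p * z j - q * z i) / (z j - z i))"
        using inj_on_subset[OF zI] by (subst prod.reindex) auto
      also have "\<dots> = (\<Prod>i\<in>I - {j}. p * z j - q * z i) / (\<Prod>i\<in>I - {j}. z j - z i)"
        by (rule prod_dividef)
      finally have e1: "(\<Prod>b\<in>z ` (I - {j}). (p * z j - q * b) / (z j - b)) = \<dots>" .
      have nz: "(\<Prod>i\<in>I - {j}. z j - z i) \<noteq> 0"
        using inj_onD[OF zI] j fin by (auto simp: prod_zero_iff)
      show "z j ^ l * (\<Prod>b\<in>z ` I - {z j}. (p * z j - q * b) / (z j - b)) * hls p q ls (z ` I - {z j})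
         * vandermonde I z = s j * z j ^ l * (\<Prod>i\<in>I - {j}. p * z j - q * z i) * f j z"
        unfolding im e1 s[OF j] f(2)[OF j z] using nz by (simp add: field_simps)
    qed
    finally show ?thesis ..
  qed
  ultimately show ?case by (intro exI[of _ g] conjI allI impI)
qed

text \<open>The product of the sum with the Vandermonde product is a polynomial. Where the variables are distinct
it is antisymmetric, hence it is so everywhere, hence it vanishes wherever two variables
coincide and is divisible by the Vandermonde product.\<close>

lemma hls_polyfun:
  assumes J: "finite J" and len: "length lam = card J"
  shows "\<exists>f. polyfun J f \<and> (\<forall>z. inj_on z J \<longrightarrow> f z = hls p q lam (z ` J))"
proof -
  obtain f where f: "polyfun J f" "\<And>z. inj_on z J \<Longrightarrow> f z = hls p q lam (z ` J) * vandermonde J z"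
    using hls_times_vandermonde[OF J subset_refl len] by blast
  have anti: "f (z \<circ> Transposition.transpose i k) = - f z" if ik: "i \<in> J" "k \<in> J" "i \<noteq> k" for i k z
  proof -
    let ?T = "Transposition.transpose i k"
    have T: "?T ` J = J" using ik by (simp add: transpose_image_eq)
    have "polyfun J (\<lambda>z. f (\<lambda>i. z (?T i)))"
      by (rule polyfun_compose[OF f(1)]) (use T in \<open>auto intro: polyfun_var[OF J]\<close>)
    moreover have "polyfun J (\<lambda>z. 0 - f z)"
      by (intro polyfun_diff polyfun_const f)
    moreover have "f (\<lambda>i. z (?T i)) = 0 - f z" if z: "inj_on z J" for z
    proof -
      have "inj_on (z \<circ> ?T) J"
        using z T by (intro comp_inj_on) auto
      moreover have "(z \<circ> ?T) ` J = z ` J" using T by (metis image_comp)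
      ultimately have "f (z \<circ> ?T) = hls p q lam (z ` J) * - vandermonde J z"
        using f(2)[of "z \<circ> ?T"] vandermonde_swap[OF J ik, of z] by simp
      then show ?thesis using f(2)[OF z] by (simp add: o_def)
    qed
    ultimately have "(\<lambda>z. f (\<lambda>i. z (?T i))) = (\<lambda>z. 0 - f z)"
      by (rule polyfun_unique[OF _ _ J])
    then have "f (\<lambda>i. z (?T i)) = 0 - f z" by (rule fun_cong)
    then show ?thesis by (simp add: o_def)
  qed
  have van: "f z = 0" if ik: "(i, k) \<in> index_pairs J" and z: "z i = z k" for i k z
  proof -
    have "z \<circ> Transposition.transpose i k = z"
      using z by (auto simp: fun_eq_iff Transposition.transpose_def)
    then have "f z = - f z" using anti[of i k z] ik by (auto simp: index_pairs_def)
    then show ?thesis by simp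
  qed
  have "\<exists>g. polyfun J g \<and> (\<forall>z. f z = (\<Prod>(i,k)\<in>index_pairs J. z i - z k) * g z)"
  proof (rule polyfun_divide_pairs[OF f(1) J])
    show "finite (index_pairs J)" using J by simp
    show "i \<in> J \<and> k \<in> J \<and> i < k" if "(i, k) \<in> index_pairs J" for i k
      using that by (simp add: index_pairs_def)
  qed (rule van)
  then have "\<exists>g. polyfun J g \<and> (\<forall>z. f z = vandermonde J z * g z)"
    unfolding vandermonde_def .
  then obtain g where g: "polyfun J g" "\<And>z. f z = vandermonde J z * g z"
    by (elim exE conjE) (rule that, assumption, drule spec)
  have "g z = hls p q lam (z ` J)" if z: "inj_on z J" for z
    using f(2)[OF z] g(2)[of z] vandermonde_nonzero[OF J z] by simp
  then show ?thesis using g(1) by (intro exI[of _ g] conjI allI impI)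
qed

text \<open>The division of the previous lemma provides the polynomial whose existence the definite description
presupposes; its uniqueness is the density of points with distinct coordinates.\<close>

lemma hall_littlewood_hls:
  "polyfun {..<length lam} (hall_littlewood lam t) \<and>
   (\<forall>z. inj_on z {..<length lam} \<longrightarrow>
      hall_littlewood lam t z = hls 1 t lam (z ` {..<length lam}) / hl_v lam t)"
proof -
  let ?J = "{..<length lam}"
  let ?P = "\<lambda>f. is_polynomial_fun (length lam) f \<and> (\<forall>z. inj_on z ?J \<longrightarrow> f z = hl_rational lam t z)"
  obtain f where f: "polyfun ?J f" "\<And>z. inj_on z ?J \<Longrightarrow> f z = hls 1 t lam (z ` ?J)"
    using hls_polyfun[of ?J lam 1 t] by auto
  have rat: "hl_rational lam t z = hls 1 t lam (z ` ?J) / hl_v lam t" if "inj_on z ?J" for z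
    using sum_hl_term_permutes[OF that, of t] by (simp add: hl_rational_def)
  have "polyfun ?J (\<lambda>z. inverse (hl_v lam t) * f z)"
    by (intro polyfun_mult polyfun_const f)
  then have "?P (\<lambda>z. inverse (hl_v lam t) * f z)"
    by (simp add: is_polynomial_fun_iff rat f(2) field_simps)
  moreover have "g = h" if "?P g" "?P h" for g h
    by (rule polyfun_unique[of ?J]) (use that in \<open>auto simp: is_polynomial_fun_iff\<close>)
  ultimately have "?P (hall_littlewood lam t)"
    unfolding hall_littlewood_def by (intro theI[of ?P])
  then show ?thesis by (simp add: is_polynomial_fun_iff rat)
qed

section \<open>Integration over the unit circle\<close>

lemma measurable_cis_line [measurable]: "(\<lambda>\<theta>::real. cis (2 * pi * \<theta>)) \<in> borel_measurable borel"
  by (intro borel_measurable_continuous_onI continuous_intros)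

lemma prob_space_circle_measure: "prob_space circle_measure"
proof -
  interpret U: prob_space "uniform_measure lborel {0..1::real}"
    by (rule prob_space_uniform_measure) auto
  show ?thesis
    unfolding circle_measure_def
    by (rule U.prob_space_distr)
       (simp add: measurable_cong_sets[OF sets_uniform_measure refl])
qed

interpretation circle: prob_space circle_measure
  by (rule prob_space_circle_measure)

lemma sets_circle_measure [measurable_cong, simp]: "sets circle_measure = sets borel"
  by (simp add: circle_measure_def)

lemma space_circle_measure [simp]: "space circle_measure = UNIV"
  by (simp add: circle_measure_def)

lemma countable_cis_fibre: "countable {\<theta>::real. cis (2 * pi * \<theta>) = a}"
proof (cases "\<exists>\<theta>0. cis (2 * pi * \<theta>0) = a")
  case True
  then obtain \<theta>0 where \<theta>0: "cis (2 * pi * \<theta>0) = a" by blast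
  have "{\<theta>. cis (2 * pi * \<theta>) = a} \<subseteq> range (\<lambda>n::int. \<theta>0 + real_of_int n)"
  proof
    fix \<theta> assume "\<theta> \<in> {\<theta>. cis (2 * pi * \<theta>) = a}"
    then have "exp (\<i> * of_real (2 * pi * \<theta>)) = exp (\<i> * of_real (2 * pi * \<theta>0))"
      using \<theta>0 by (simp add: cis_conv_exp)
    then obtain n :: int where "\<i> * of_real (2 * pi * \<theta>) = \<i> * of_real (2 * pi * \<theta>0) + of_int (2 * n) * pi * \<i>"
      unfolding exp_eq by blast
    then have "\<i> * of_real (2 * pi * \<theta>) = \<i> * of_real (2 * pi * (\<theta>0 + real_of_int n))"
      by (simp add: algebra_simps)
    then have "2 * pi * \<theta> = 2 * pi * (\<theta>0 + real_of_int n)"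
      by (metis complex_i_not_zero mult_cancel_left of_real_eq_iff)
    then have "\<theta> = \<theta>0 + real_of_int n" by simp
    then show "\<theta> \<in> range (\<lambda>n::int. \<theta>0 + real_of_int n)" by blast
  qed
  then show ?thesis by (rule countable_subset) simp
next
  case False
  then have "{\<theta>::real. cis (2 * pi * \<theta>) = a} = {}" by blast
  then show ?thesis by simp
qed

lemma AE_circle_norm: "AE y in circle_measure. norm y = 1"
  unfolding circle_measure_def by (subst AE_distr_iff) (auto simp: norm_cis)

lemma AE_circle_neq: "AE y in circle_measure. y \<noteq> a"
proof -
  have "AE \<theta> in lborel. \<theta> \<notin> {\<theta>::real. cis (2 * pi * \<theta>) = a}"
    by (rule AE_not_in) (rule countable_imp_null_set_lborel[OF countable_cis_fibre])
  then have "AE \<theta> in uniform_measure lborel {0..1}. cis (2 * pi * \<theta>) \<noteq> a"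
    by (intro AE_uniform_measureI) auto
  then show ?thesis
    unfolding circle_measure_def by (subst AE_distr_iff) auto
qed

text \<open>The values of F at 1 and -1 do not matter for the integral; the integrands that arise are only
given by quotients with zero denominator there.\<close>

lemma integral_circle_measure:
  fixes F H :: "complex \<Rightarrow> complex"
  assumes F: "F \<in> borel_measurable borel" and H: "continuous_on (sphere 0 1) H"
    and eq: "\<And>y. norm y = 1 \<Longrightarrow> y \<noteq> 1 \<Longrightarrow> y \<noteq> -1 \<Longrightarrow> F y = H y"
    and I: "((\<lambda>\<theta>. H (cis (2 * pi * \<theta>))) has_integral v) {0..1}"
  shows "(LINT y|circle_measure. F y) = v"
proof -
  let ?H = "\<lambda>\<theta>::real. H (cis (2 * pi * \<theta>))"
  have cont: "continuous_on {0..1::real} ?H"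
    by (rule continuous_on_compose2[OF H]) (auto intro!: continuous_intros simp: norm_cis)
  have int: "set_integrable lborel {0..1} ?H"
    by (rule borel_integrable_atLeastAtMost'[OF cont])
  have "(LINT y|circle_measure. F y) = (LINT \<theta>|uniform_measure lborel {0..1}. F (cis (2 * pi * \<theta>)))"
    unfolding circle_measure_def by (rule integral_distr) (use F in auto)
  also have "uniform_measure lborel {0..1::real} = density lborel (\<lambda>\<theta>. ennreal (indicator {0..1} \<theta>))"
    unfolding uniform_measure_def by (intro density_cong) (auto split: split_indicator)
  also have "(LINT \<theta>|density lborel (\<lambda>\<theta>. ennreal (indicator {0..1} \<theta>)). F (cis (2 * pi * \<theta>))) =
     (LINT \<theta>|lborel. indicator {0..1} \<theta> *\<^sub>R F (cis (2 * pi * \<theta>)))"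
    using F by (intro integral_density) auto
  also have "\<dots> = (LINT \<theta>|lborel. indicator {0..1} \<theta> *\<^sub>R ?H \<theta>)"
  proof (rule integral_cong_AE)
    show "(\<lambda>\<theta>. indicator {0..1} \<theta> *\<^sub>R F (cis (2 * pi * \<theta>))) \<in> borel_measurable lborel"
      using F by simp
    show "(\<lambda>\<theta>. indicator {0..1} \<theta> *\<^sub>R ?H \<theta>) \<in> borel_measurable lborel"
      using int by (simp add: set_integrable_def)
    have "AE \<theta> in lborel. \<theta> \<notin> {\<theta>::real. cis (2 * pi * \<theta>) = 1} \<union> {\<theta>::real. cis (2 * pi * \<theta>) = -1}"
      by (intro AE_not_in countable_imp_null_set_lborel countable_Un countable_cis_fibre)
    then show "AE \<theta> in lborel. indicator {0..1} \<theta> *\<^sub>R F (cis (2 * pi * \<theta>)) = indicator {0..1} \<theta> *\<^sub>R ?H \<theta>"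
      by eventually_elim (auto simp: eq norm_cis)
  qed
  also have "\<dots> = (LINT \<theta>:{0..1}|lborel. ?H \<theta>)" by (simp add: set_lebesgue_integral_def)
  also have "\<dots> = integral {0..1} ?H" by (rule set_borel_integral_eq_integral(2)[OF int])
  also have "\<dots> = v" by (rule integral_unique[OF I])
  finally show ?thesis .
qed

lemma holomorphic_circle_mean:
  assumes "w holomorphic_on ball 0 R" "R > 1"
  shows "((\<lambda>\<theta>. w (cis (2 * pi * \<theta>))) has_integral w 0) {0..1}"
proof -
  have sub: "cball (0::complex) 1 \<subseteq> ball 0 R" using assms(2) by auto
  have "((\<lambda>u. w u / (u - 0)) has_contour_integral (2 * of_real pi * \<i> * w 0)) (circlepath 0 1)"
    by (rule Cauchy_integral_circlepath)
       (use sub in \<open>auto intro!: holomorphic_on_imp_continuous_on holomorphic_on_subset[OF assms(1)]\<close>)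
  then have "((\<lambda>\<theta>. (2 * of_real pi * \<i>) * w (cis (2 * pi * \<theta>))) has_integral (2 * of_real pi * \<i> * w 0)) {0..1}"
    unfolding has_contour_integral vector_derivative_circlepath
    by (simp add: circlepath cis_conv_exp mult_ac)
  from has_integral_mult_right[OF this, of "1 / (2 * of_real pi * \<i>)"]
  show ?thesis by simp
qed

text \<open>On the unit circle inversion is complex conjugation, so the mean value property is applied to
the conjugate function z \<rightarrow> cnj (w (cnj z)).\<close>

lemma holomorphic_circle_mean_inverse:
  assumes "w holomorphic_on ball 0 R" "R > 1"
  shows "((\<lambda>\<theta>. w (inverse (cis (2 * pi * \<theta>)))) has_integral w 0) {0..1}"
proof -
  have "cnj ` ball (0::complex) R = ball 0 R"
  proof (intro set_eqI iffI)
    fix x :: complex assume "x \<in> ball 0 R"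
    then have "cnj x \<in> ball 0 R" "x = cnj (cnj x)" by simp_all
    then show "x \<in> cnj ` ball 0 R" by (rule rev_image_eqI)
  qed auto
  then have "(cnj \<circ> w \<circ> cnj) holomorphic_on ball 0 R"
    using holomorphic_on_compose_cnj_cnj[of w "ball 0 R"] assms by simp
  from holomorphic_circle_mean[OF this assms(2)]
  have "((\<lambda>\<theta>. cnj (w (inverse (cis (2 * pi * \<theta>))))) has_integral cnj (w 0)) {0..1}"
    by (simp add: cis_cnj cis_inverse)
  then show ?thesis
    using has_integral_cnj[of "\<lambda>\<theta>. w (inverse (cis (2 * pi * \<theta>)))" "w 0" "{0..1}"] by (simp add: o_def)
qed

text \<open>Interpolating G linearly at 1 and -1 writes it as a + b y + (y^2 - 1) K(y) with K holomorphic.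
The quotient then equals b + y K(y) + K(1/y)/y, and by the mean value property the last two terms
integrate to 0.\<close>

lemma circle_integral_antisymmetrized:
  assumes hol: "G holomorphic_on ball 0 R" and R: "R > 1"
    and meas: "(\<lambda>y. (G y - G (inverse y)) / (y - inverse y)) \<in> borel_measurable borel"
  shows "(LINT y|circle_measure. (G y - G (inverse y)) / (y - inverse y)) = (G 1 - G (-1)) / 2"
proof -
  define B :: "complex set" where "B = ball 0 R"
  \<comment> \<open>The iterated difference quotients of G at 1 and -1.\<close>
  define K1 where "K1 z = (if z = 1 then deriv G 1 else (G z - G 1) / (z - 1))" for z
  define K where "K z = (if z = -1 then deriv K1 (-1) else (K1 z - K1 (-1)) / (z - (-1)))" for z
  have "K1 holomorphic_on B" unfolding K1_def B_def by (intro pole_lemma_open hol) auto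
  then have "K holomorphic_on B" unfolding K_def B_def by (intro pole_lemma_open) auto
  have G1: "G z = G 1 + (z - 1) * K1 z" for z unfolding K1_def by auto
  have K1: "K1 z = K1 (-1) + (z + 1) * K z" for z 
  proof (cases "z = -1")
    case False
    then have "z + 1 \<noteq> 0" by (simp add: eq_neg_iff_add_eq_0)
    then show ?thesis using False by (simp add: K_def)
  qed simp
  define b where "b = (G 1 - G (-1)) / 2"
  have "K1 (-1) = b" using G1[of "-1"] by (simp add: b_def)
  then have G: "G z = G 1 + (z - 1) * (b + (z + 1) * K z)" for z using G1[of z] K1[of z] by simp
  define w where "w z = z * K z" for z
  have w: "w holomorphic_on ball 0 R"
    unfolding w_def using \<open>K holomorphic_on B\<close> by (intro holomorphic_intros) (simp add: B_def)
  have contw: "continuous_on (sphere 0 1) w"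
    by (rule holomorphic_on_imp_continuous_on[OF holomorphic_on_subset[OF w]]) (use R in auto)
  show ?thesis unfolding b_def[symmetric]
  proof (rule integral_circle_measure[OF meas])
    have "continuous_on (sphere 0 1) (\<lambda>y::complex. w (inverse y))"
      by (rule continuous_on_compose2[OF contw]) (auto intro!: continuous_intros simp: norm_inverse)
    then show "continuous_on (sphere 0 1) (\<lambda>y. b + w y + w (inverse y))"
      by (intro continuous_intros contw)
    have "((\<lambda>\<theta>::real. b) has_integral b) {0..1}"
      using has_integral_const_real[of b 0 1] by simp
    from has_integral_add[OF has_integral_add[OF this holomorphic_circle_mean[OF w R]]
        holomorphic_circle_mean_inverse[OF w R]]
    show "((\<lambda>\<theta>. b + w (cis (2 * pi * \<theta>)) + w (inverse (cis (2 * pi * \<theta>)))) has_integral b) {0..1}"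
      by (simp add: w_def)
    fix y :: complex assume y: "norm y = 1" "y \<noteq> 1" "y \<noteq> -1"
    then have y0: "y \<noteq> 0" by auto
    have "y * y \<noteq> 1" using y by (simp add: square_eq_1_iff)
    then have nz: "y - inverse y \<noteq> 0" using y0 by (auto simp: field_simps)
    have "G y - G (inverse y) = (b + w y + w (inverse y)) * (y - inverse y)"
      unfolding G[of y] G[of "inverse y"] w_def using y0 by (simp add: field_simps)
    then show "(G y - G (inverse y)) / (y - inverse y) = b + w y + w (inverse y)"
      using nz by (simp add: field_simps)
  qed
qed

section \<open>Integration over the torus\<close>

interpretation circle_product: product_sigma_finite "\<lambda>_::nat. circle_measure"
  by unfold_locales

abbreviation torus_on :: "nat set \<Rightarrow> (nat \<Rightarrow> complex) measure" where
  "torus_on I \<equiv> PiM I (\<lambda>_. circle_measure)"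

interpretation torus_on: prob_space "torus_on I" for I
  by (rule prob_space_PiM) (rule prob_space_circle_measure)

lemma measurable_torus_component: "i \<in> I \<Longrightarrow> (\<lambda>x. x i) \<in> borel_measurable (torus_on I)"
  using measurable_component_singleton[of i I "\<lambda>_. circle_measure"]
  by (simp add: measurable_cong_sets[OF refl sets_circle_measure])

lemma measurable_torus_upd:
  assumes "k \<in> I" "f \<in> borel_measurable (torus_on I)"
  shows "(\<lambda>(x, y). f (x(k := y))) \<in> borel_measurable (torus_on (I - {k}) \<Otimes>\<^sub>M circle_measure)"
proof -
  have "insert k (I - {k}) = I" using assms(1) by blast
  then have "(\<lambda>(x, y). x(k := y)) \<in> measurable (torus_on (I - {k}) \<Otimes>\<^sub>M circle_measure) (torus_on I)"
    using measurable_add_dim[of k "I - {k}" "\<lambda>_. circle_measure"] by simp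
  from measurable_compose[OF this assms(2)] show ?thesis by (simp add: case_prod_unfold)
qed

lemma measurable_torus_upd_const:
  assumes "k \<in> I" "f \<in> borel_measurable (torus_on I)"
  shows "(\<lambda>x. f (x(k := c))) \<in> borel_measurable (torus_on (I - {k}))"
  using measurable_compose[OF _ measurable_torus_upd[OF assms], of "\<lambda>x. (x, c)" "torus_on (I - {k})"] by simp

lemma measurable_torus_upd_circle:
  assumes "k \<in> I" "f \<in> borel_measurable (torus_on I)" "x \<in> space (torus_on (I - {k}))"
  shows "(\<lambda>y. f (x(k := y))) \<in> borel_measurable borel"
proof -
  have "(\<lambda>y. (x, y)) \<in> measurable circle_measure (torus_on (I - {k}) \<Otimes>\<^sub>M circle_measure)"
    using assms(3) by simp
  from measurable_compose[OF this measurable_torus_upd[OF assms(1,2)]] show ?thesis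
    by (simp add: measurable_cong_sets[OF sets_circle_measure refl])
qed

lemma AE_torus_norm:
  assumes "finite I"
  shows "AE x in torus_on I. \<forall>i\<in>I. norm (x i) = 1"
  using assms
  by (intro AE_finite_allI AE_PiM_component[where M = "\<lambda>_. circle_measure"] AE_circle_norm prob_space_circle_measure)

text \<open>It suffices to look at one coordinate while all the others are fixed (Tonelli).\<close>

lemma AE_torus_insert:
  assumes "finite I" "k \<in> I" "Measurable.pred (torus_on I) P"
    and "\<And>x. AE y in circle_measure. P (x(k := y))"
  shows "AE x in torus_on I. P x"
proof -
  let ?f = "\<lambda>x. indicator {x \<in> space (torus_on I). \<not> P x} x :: ennreal"
  have I: "insert k (I - {k}) = I" using assms(2) by blast
  have meas: "{x \<in> space (torus_on I). \<not> P x} \<in> sets (torus_on I)"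
    using assms(3) by measurable
  have "(\<integral>\<^sup>+ x. ?f x \<partial>torus_on (insert k (I - {k}))) =
     (\<integral>\<^sup>+ x. (\<integral>\<^sup>+ y. ?f (x(k := y)) \<partial>circle_measure) \<partial>torus_on (I - {k}))"
    using assms(1) meas by (intro circle_product.product_nn_integral_insert) (auto simp: insert_absorb[OF assms(2)])
  also have "\<dots> = (\<integral>\<^sup>+ x. 0 \<partial>torus_on (I - {k}))"
  proof (rule nn_integral_cong)
    fix x
    have "(\<integral>\<^sup>+ y. ?f (x(k := y)) \<partial>circle_measure) = (\<integral>\<^sup>+ y. 0 \<partial>circle_measure)"
      by (rule nn_integral_cong_AE) (use assms(4)[of x] in eventually_elim, auto)
    then show "(\<integral>\<^sup>+ y. ?f (x(k := y)) \<partial>circle_measure) = 0" by simp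
  qed
  finally have "(\<integral>\<^sup>+ x. ?f x \<partial>torus_on I) = 0" unfolding I by simp
  then have "emeasure (torus_on I) {x \<in> space (torus_on I). \<not> P x} = 0"
    using meas by simp
  then show ?thesis using meas by (subst AE_iff_measurable[OF meas refl]) auto
qed

text \<open>These conditions make the points 1, -1, x_i, 1/x_i pairwise distinct.\<close>

definition generic_point :: "nat set \<Rightarrow> (nat \<Rightarrow> complex) \<Rightarrow> bool" where
  "generic_point I x \<longleftrightarrow> (\<forall>i\<in>I. norm (x i) = 1 \<and> x i \<noteq> 1 \<and> x i \<noteq> -1) \<and>
     (\<forall>i\<in>I. \<forall>j\<in>I. i \<noteq> j \<longrightarrow> x i \<noteq> x j \<and> x i \<noteq> inverse (x j))"

lemma AE_generic_point:
  assumes "finite I"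
  shows "AE x in torus_on I. generic_point I x"
proof -
  have "AE x in torus_on I. \<forall>i\<in>I. x i \<noteq> a" for a
    using assms
    by (intro AE_finite_allI AE_PiM_component[where M = "\<lambda>_. circle_measure"] AE_circle_neq prob_space_circle_measure)
  note this[of 1] this[of "-1"]
  moreover have "AE x in torus_on I. \<forall>i\<in>I. \<forall>j\<in>I. i \<noteq> j \<longrightarrow> x i \<noteq> x j \<and> x i \<noteq> inverse (x j)"
  proof (intro AE_finite_allI assms)
    fix i j assume ij: "i \<in> I" "j \<in> I"
    show "AE x in torus_on I. i \<noteq> j \<longrightarrow> x i \<noteq> x j \<and> x i \<noteq> inverse (x j)"
    proof (cases "i = j")
      case False
      note m = measurable_torus_component[OF ij(1)] measurable_torus_component[OF ij(2)]
      have neq: "{x \<in> space M. f x \<noteq> g x} \<in> sets M"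
        if "f \<in> borel_measurable M" "g \<in> borel_measurable M" for f g :: "(nat \<Rightarrow> complex) \<Rightarrow> complex" and M
      proof -
        have "{x \<in> space M. f x \<noteq> g x} = (\<lambda>x. f x - g x) -` (- {0 :: complex}) \<inter> space M" by auto
        also have "\<dots> \<in> sets M" using that by (intro measurable_sets[OF borel_measurable_diff]) auto
        finally show ?thesis .
      qed
      have "AE x in torus_on I. x i \<noteq> x j \<and> x i \<noteq> inverse (x j)"
      proof (rule AE_torus_insert[OF assms ij(1)])
        show "Measurable.pred (torus_on I) (\<lambda>x. x i \<noteq> x j \<and> x i \<noteq> inverse (x j))"
          unfolding pred_def
          by (intro sets.sets_Collect_conj neq m borel_measurable_inverse)
        show "AE y in circle_measure. (x(i := y)) i \<noteq> (x(i := y)) j \<and> (x(i := y)) i \<noteq> inverse ((x(i := y)) j)" for x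
          using AE_circle_neq[of "x j"] AE_circle_neq[of "inverse (x j)"]
          by eventually_elim (use False in auto)
      qed
      then show ?thesis by simp
    qed simp
  qed
  ultimately show ?thesis
    using AE_torus_norm[OF assms] unfolding generic_point_def by eventually_elim blast
qed

lemma generic_point_subset: "generic_point I x \<Longrightarrow> I' \<subseteq> I \<Longrightarrow> generic_point I' x"
  unfolding generic_point_def by blast

lemma generic_point_inverse:
  assumes "generic_point I x" "k \<in> I"
  shows "generic_point I (x(k := inverse (x k)))"
proof -
  have "inverse (x k) = 1 \<longleftrightarrow> x k = 1" "inverse (x k) = -1 \<longleftrightarrow> x k = -1"
    by (auto simp: inverse_eq_iff_eq[of _ "-1", simplified])
  moreover have "inverse (x i) \<noteq> x j \<longleftrightarrow> x i \<noteq> inverse (x j)" for i j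
    by (metis inverse_inverse_eq)
  ultimately show ?thesis
    using assms unfolding generic_point_def by (auto simp: norm_inverse)
qed

text \<open>The Lipschitz bound under inversion of one coordinate keeps
(f(x) - f(x with x_k inverted)) / (x_k - 1/x_k) bounded, so that Fubini's theorem applies to it.\<close>

definition torus_regular :: "nat set \<Rightarrow> ((nat \<Rightarrow> complex) \<Rightarrow> complex) \<Rightarrow> bool" where
  "torus_regular I f \<longleftrightarrow> f \<in> borel_measurable (torus_on I) \<and>
     (\<exists>B\<ge>0. \<forall>x. (\<forall>i\<in>I. norm (x i) = 1) \<longrightarrow> norm (f x) \<le> B \<and>
        (\<forall>k\<in>I. norm (f x - f (x(k := inverse (x k)))) \<le> B * norm (x k - inverse (x k))))"

lemma torus_regular_measurable: "torus_regular I f \<Longrightarrow> f \<in> borel_measurable (torus_on I)"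
  by (simp add: torus_regular_def)

lemma torus_regularI:
  assumes "f \<in> borel_measurable (torus_on I)" "B \<ge> 0"
    and "\<And>x. \<forall>i\<in>I. norm (x i) = 1 \<Longrightarrow> norm (f x) \<le> B"
    and "\<And>x k. \<forall>i\<in>I. norm (x i) = 1 \<Longrightarrow> k \<in> I \<Longrightarrow>
       norm (f x - f (x(k := inverse (x k)))) \<le> B * norm (x k - inverse (x k))"
  shows "torus_regular I f"
  unfolding torus_regular_def using assms by (intro conjI exI[of _ B]) blast+

lemma torus_regularE:
  assumes "torus_regular I f"
  obtains B where "B \<ge> 0" "\<And>x. \<forall>i\<in>I. norm (x i) = 1 \<Longrightarrow> norm (f x) \<le> B"
    "\<And>x k. \<forall>i\<in>I. norm (x i) = 1 \<Longrightarrow> k \<in> I \<Longrightarrow>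
       norm (f x - f (x(k := inverse (x k)))) \<le> B * norm (x k - inverse (x k))"
proof -
  obtain B where "B \<ge> 0" "\<forall>x. (\<forall>i\<in>I. norm (x i) = 1) \<longrightarrow> norm (f x) \<le> B \<and>
        (\<forall>k\<in>I. norm (f x - f (x(k := inverse (x k)))) \<le> B * norm (x k - inverse (x k)))"
    using assms unfolding torus_regular_def by blast
  then show thesis by (intro that[of B]) blast+
qed

lemma torus_norm_inverse:
  "\<forall>i\<in>I. norm (x i) = 1 \<Longrightarrow> \<forall>i\<in>I. norm ((x(k := inverse (x k))) i :: complex) = 1"
  by (auto simp: norm_inverse)

lemma torus_regular_const: "torus_regular I (\<lambda>x. c)"
  by (rule torus_regularI[of _ _ "norm c"]) auto

lemma torus_regular_var: "i \<in> I \<Longrightarrow> torus_regular I (\<lambda>x. x i)"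
  by (rule torus_regularI[of _ _ 1]) (auto intro: measurable_torus_component)

lemma torus_regular_var_inverse: "i \<in> I \<Longrightarrow> torus_regular I (\<lambda>x. inverse (x i))"
  by (rule torus_regularI[of _ _ 1])
     (auto intro: measurable_torus_component simp: norm_inverse norm_minus_commute)

lemma torus_regular_add:
  assumes "torus_regular I f" "torus_regular I g"
  shows "torus_regular I (\<lambda>x. f x + g x)"
proof -
  obtain B where B: "B \<ge> 0" "\<And>x. \<forall>i\<in>I. norm (x i) = 1 \<Longrightarrow> norm (f x) \<le> B"
    "\<And>x k. \<forall>i\<in>I. norm (x i) = 1 \<Longrightarrow> k \<in> I \<Longrightarrow>
       norm (f x - f (x(k := inverse (x k)))) \<le> B * norm (x k - inverse (x k))"
    using torus_regularE[OF assms(1)] by blast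
  obtain C where C: "C \<ge> 0" "\<And>x. \<forall>i\<in>I. norm (x i) = 1 \<Longrightarrow> norm (g x) \<le> C"
    "\<And>x k. \<forall>i\<in>I. norm (x i) = 1 \<Longrightarrow> k \<in> I \<Longrightarrow>
       norm (g x - g (x(k := inverse (x k)))) \<le> C * norm (x k - inverse (x k))"
    using torus_regularE[OF assms(2)] by blast
  show ?thesis
  proof (rule torus_regularI[of _ _ "B + C"])
    show "(\<lambda>x. f x + g x) \<in> borel_measurable (torus_on I)"
      using assms by (intro borel_measurable_add torus_regular_measurable)
    show "norm (f x + g x) \<le> B + C" if "\<forall>i\<in>I. norm (x i) = 1" for x
      using norm_triangle_mono[OF B(2)[OF that] C(2)[OF that]] .
    show "norm (f x + g x - (f (x(k := inverse (x k))) + g (x(k := inverse (x k))))) \<le> (B + C) * norm (x k - inverse (x k))"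
      if "\<forall>i\<in>I. norm (x i) = 1" "k \<in> I" for x k
      using norm_triangle_mono[OF B(3)[OF that] C(3)[OF that]] by (simp add: algebra_simps)
  qed (use B C in auto)
qed

lemma torus_regular_mult:
  assumes "torus_regular I f" "torus_regular I g"
  shows "torus_regular I (\<lambda>x. f x * g x)"
proof -
  obtain B where B: "B \<ge> 0" "\<And>x. \<forall>i\<in>I. norm (x i) = 1 \<Longrightarrow> norm (f x) \<le> B"
    "\<And>x k. \<forall>i\<in>I. norm (x i) = 1 \<Longrightarrow> k \<in> I \<Longrightarrow>
       norm (f x - f (x(k := inverse (x k)))) \<le> B * norm (x k - inverse (x k))"
    using torus_regularE[OF assms(1)] by blast
  obtain C where C: "C \<ge> 0" "\<And>x. \<forall>i\<in>I. norm (x i) = 1 \<Longrightarrow> norm (g x) \<le> C"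
    "\<And>x k. \<forall>i\<in>I. norm (x i) = 1 \<Longrightarrow> k \<in> I \<Longrightarrow>
       norm (g x - g (x(k := inverse (x k)))) \<le> C * norm (x k - inverse (x k))"
    using torus_regularE[OF assms(2)] by blast
  show ?thesis
  proof (rule torus_regularI[of _ _ "2 * (B * C)"])
    show "(\<lambda>x. f x * g x) \<in> borel_measurable (torus_on I)"
      using assms by (intro borel_measurable_times torus_regular_measurable)
    show "norm (f x * g x) \<le> 2 * (B * C)" if "\<forall>i\<in>I. norm (x i) = 1" for x
    proof -
      have "norm (f x * g x) \<le> B * C"
        unfolding norm_mult by (intro mult_mono B C that norm_ge_zero)
      moreover have "B * C \<ge> 0" using B C by simp
      ultimately show ?thesis by linarith
    qed
    show "norm (f x * g x - f (x(k := inverse (x k))) * g (x(k := inverse (x k)))) \<le> 2 * (B * C) * norm (x k - inverse (x k))"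
      if x: "\<forall>i\<in>I. norm (x i) = 1" and k: "k \<in> I" for x k
    proof -
      let ?x = "x(k := inverse (x k))" and ?d = "norm (x k - inverse (x k))"
      have "f x * g x - f ?x * g ?x = f x * (g x - g ?x) + (f x - f ?x) * g ?x"
        by (simp add: algebra_simps)
      also have "norm \<dots> \<le> B * (C * ?d) + (B * ?d) * C"
      proof (rule norm_triangle_mono)
        show "norm (f x * (g x - g ?x)) \<le> B * (C * ?d)"
          unfolding norm_mult by (intro mult_mono B C x k norm_ge_zero)
        show "norm ((f x - f ?x) * g ?x) \<le> (B * ?d) * C"
          unfolding norm_mult
          by (intro mult_mono B C x k norm_ge_zero torus_norm_inverse mult_nonneg_nonneg)
      qed
      finally show ?thesis by (simp add: algebra_simps)
    qed
  qed (use B C in auto)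
qed

lemma torus_regular_inverse:
  assumes f: "torus_regular I f" and c: "c > 0"
    and low: "\<And>x. \<forall>i\<in>I. norm (x i) = 1 \<Longrightarrow> c \<le> norm (f x)"
  shows "torus_regular I (\<lambda>x. inverse (f x))"
proof -
  obtain B where B: "B \<ge> 0" "\<And>x. \<forall>i\<in>I. norm (x i) = 1 \<Longrightarrow> norm (f x) \<le> B"
    "\<And>x k. \<forall>i\<in>I. norm (x i) = 1 \<Longrightarrow> k \<in> I \<Longrightarrow>
       norm (f x - f (x(k := inverse (x k)))) \<le> B * norm (x k - inverse (x k))"
    using torus_regularE[OF f] by blast
  have inv: "norm (inverse (f x)) \<le> inverse c" if "\<forall>i\<in>I. norm (x i) = 1" for x
    using low[OF that] c by (simp add: norm_inverse le_imp_inverse_le)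
  show ?thesis
  proof (rule torus_regularI[of _ _ "inverse c + inverse c * B * inverse c"])
    show "(\<lambda>x. inverse (f x)) \<in> borel_measurable (torus_on I)"
      using f by (intro borel_measurable_inverse torus_regular_measurable)
    show "0 \<le> inverse c + inverse c * B * inverse c" using B c by simp
    show "norm (inverse (f x)) \<le> inverse c + inverse c * B * inverse c" if "\<forall>i\<in>I. norm (x i) = 1" for x
      using inv[OF that] B c by (simp add: add_increasing2)
    show "norm (inverse (f x) - inverse (f (x(k := inverse (x k))))) \<le>
        (inverse c + inverse c * B * inverse c) * norm (x k - inverse (x k))"
      if x: "\<forall>i\<in>I. norm (x i) = 1" and k: "k \<in> I" for x k
    proof -
      let ?x = "x(k := inverse (x k))" and ?d = "norm (x k - inverse (x k))"
      have nz: "f x \<noteq> 0" "f ?x \<noteq> 0"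
        using low[OF x] low[of ?x, OF torus_norm_inverse[OF x]] c by force+
      have "norm (inverse (f x) - inverse (f ?x)) = norm (inverse (f x)) * norm (f x - f ?x) * norm (inverse (f ?x))"
        unfolding inverse_diff_inverse[OF nz] by (simp add: norm_mult)
      also have "\<dots> \<le> inverse c * (B * ?d) * inverse c"
        using c by (intro mult_mono inv B x k torus_norm_inverse norm_ge_zero mult_nonneg_nonneg) auto
      also have "\<dots> \<le> (inverse c + inverse c * B * inverse c) * ?d"
        using c by (simp add: algebra_simps)
      finally show ?thesis .
    qed
  qed
qed

lemma torus_regular_diff:
  "torus_regular I f \<Longrightarrow> torus_regular I g \<Longrightarrow> torus_regular I (\<lambda>x. f x - g x)"
  using torus_regular_add[of I f "\<lambda>x. (-1) * g x"] torus_regular_mult[OF torus_regular_const[of I "-1"], of g] by simp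

lemma torus_regular_sum: "(\<And>s. s \<in> S \<Longrightarrow> torus_regular I (f s)) \<Longrightarrow> torus_regular I (\<lambda>x. \<Sum>s\<in>S. f s x)"
  by (induction S rule: infinite_finite_induct) (auto intro: torus_regular_add torus_regular_const)

lemma torus_regular_prod: "(\<And>s. s \<in> S \<Longrightarrow> torus_regular I (f s)) \<Longrightarrow> torus_regular I (\<lambda>x. \<Prod>s\<in>S. f s x)"
  by (induction S rule: infinite_finite_induct) (auto intro: torus_regular_mult torus_regular_const)

lemma torus_regular_power: "torus_regular I f \<Longrightarrow> torus_regular I (\<lambda>x. f x ^ m)"
  by (induction m) (auto intro: torus_regular_mult torus_regular_const)

lemma torus_regular_polyfun:
  assumes "polyfun J f" "\<And>j. j \<in> J \<Longrightarrow> torus_regular I (h j)"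
  shows "torus_regular I (\<lambda>x. f (\<lambda>j. h j x))"
proof -
  obtain M c where f: "finite M" "f = (\<lambda>z. \<Sum>m\<in>M. c m * (\<Prod>i\<in>J. z i ^ m i))"
    using assms(1) unfolding polyfun_def by blast
  show ?thesis unfolding f(2)
    by (intro torus_regular_sum torus_regular_mult torus_regular_const torus_regular_prod torus_regular_power assms(2))
qed

lemma torus_regular_integrable:
  assumes "torus_regular I f" "finite I"
  shows "integrable (torus_on I) f"
proof -
  obtain B where B: "B \<ge> 0" "\<And>x. \<forall>i\<in>I. norm (x i) = 1 \<Longrightarrow> norm (f x) \<le> B"
    "\<And>x k. \<forall>i\<in>I. norm (x i) = 1 \<Longrightarrow> k \<in> I \<Longrightarrow>
       norm (f x - f (x(k := inverse (x k)))) \<le> B * norm (x k - inverse (x k))"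
    using torus_regularE[OF assms(1)] by blast
  show ?thesis
  proof (rule torus_on.integrable_const_bound[where B = B])
    show "AE x in torus_on I. norm (f x) \<le> B"
      using AE_torus_norm[OF assms(2)] by eventually_elim (rule B(2))
  qed (rule torus_regular_measurable[OF assms(1)])
qed

definition antisym_quotient :: "nat \<Rightarrow> ((nat \<Rightarrow> complex) \<Rightarrow> complex) \<Rightarrow> (nat \<Rightarrow> complex) \<Rightarrow> complex" where
  "antisym_quotient k f x = (f x - f (x(k := inverse (x k)))) / (x k - inverse (x k))"

lemma measurable_torus_invert:
  assumes "f \<in> borel_measurable (torus_on I)" "k \<in> I"
  shows "(\<lambda>x. f (x(k := inverse (x k)))) \<in> borel_measurable (torus_on I)"
proof -
  have "(\<lambda>x. x(k := inverse (x k))) \<in> measurable (torus_on I) (torus_on I)"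
  proof (rule measurable_PiM_single')
    show "(\<lambda>x. (x(k := inverse (x k))) i) \<in> measurable (torus_on I) circle_measure" if "i \<in> I" for i
      using measurable_torus_component[OF that] measurable_torus_component[OF assms(2)]
      by (cases "i = k") (auto simp: measurable_cong_sets[OF refl sets_circle_measure])
    show "(\<lambda>x. x(k := inverse (x k))) \<in> space (torus_on I) \<rightarrow> (\<Pi>\<^sub>E i\<in>I. space circle_measure)"
      using assms(2) by (auto simp: space_PiM PiE_def extensional_def)
  qed
  from measurable_compose[OF this assms(1)] show ?thesis .
qed

lemma antisym_quotient_times_integrable:
  assumes f: "torus_regular I f" and g: "torus_regular I g" and I: "finite I" "k \<in> I"
  shows "integrable (torus_on I) (\<lambda>x. antisym_quotient k f x * g x)"
proof -
  obtain B where B: "B \<ge> 0" "\<And>x. \<forall>i\<in>I. norm (x i) = 1 \<Longrightarrow> norm (f x) \<le> B"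
    "\<And>x k. \<forall>i\<in>I. norm (x i) = 1 \<Longrightarrow> k \<in> I \<Longrightarrow>
       norm (f x - f (x(k := inverse (x k)))) \<le> B * norm (x k - inverse (x k))"
    using torus_regularE[OF f] by blast
  obtain C where C: "C \<ge> 0" "\<And>x. \<forall>i\<in>I. norm (x i) = 1 \<Longrightarrow> norm (g x) \<le> C"
    "\<And>x k. \<forall>i\<in>I. norm (x i) = 1 \<Longrightarrow> k \<in> I \<Longrightarrow>
       norm (g x - g (x(k := inverse (x k)))) \<le> C * norm (x k - inverse (x k))"
    using torus_regularE[OF g] by blast
  show ?thesis
  proof (rule torus_on.integrable_const_bound[where B = "B * C"])
    show "AE x in torus_on I. norm (antisym_quotient k f x * g x) \<le> B * C"
      using AE_torus_norm[OF I(1)]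
    proof eventually_elim
      case (elim x)
      have "norm (antisym_quotient k f x) \<le> B"
        using B(3)[OF elim I(2)] B(1)
        by (cases "x k - inverse (x k) = 0") (auto simp: antisym_quotient_def norm_divide divide_le_eq)
      then show ?case unfolding norm_mult using C B elim by (intro mult_mono) auto
    qed
    show "(\<lambda>x. antisym_quotient k f x * g x) \<in> borel_measurable (torus_on I)"
      unfolding antisym_quotient_def
      using torus_regular_measurable[OF f] torus_regular_measurable[OF g] I measurable_torus_invert[OF torus_regular_measurable[OF f]]
        measurable_torus_component[OF I(2)]
      by (intro borel_measurable_times borel_measurable_divide borel_measurable_diff borel_measurable_inverse) auto
  qed
qed

text \<open>Integrate the coordinate k first and apply the one-variable evaluation to it.\<close>

lemma torus_integral_antisym_quotient:
  assumes f: "torus_regular I f" and g: "torus_regular I g" and I: "finite I" "k \<in> I"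
    and gk: "\<And>x y. g (x(k := y)) = g x"
    and R: "R > 1"
    and hol: "\<And>x. \<forall>i\<in>I - {k}. norm (x i) = 1 \<Longrightarrow> (\<lambda>y. f (x(k := y))) holomorphic_on ball 0 R"
  shows "(LINT x|torus_on I. antisym_quotient k f x * g x) =
     (LINT x|torus_on (I - {k}). (f (x(k := 1)) - f (x(k := -1))) / 2 * g x)"
proof -
  let ?F = "\<lambda>x. antisym_quotient k f x * g x"
  have ins: "insert k (I - {k}) = I" using I by blast
  have int: "integrable (torus_on I) ?F"
    by (rule antisym_quotient_times_integrable[OF f g I])
  have "(LINT x|torus_on I. ?F x) = (LINT x|torus_on (I - {k}). LINT y|circle_measure. ?F (x(k := y)))"
    using circle_product.product_integral_insert[of "I - {k}" k ?F] I(1) int unfolding ins by simp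
  also have "\<dots> = (LINT x|torus_on (I - {k}). (f (x(k := 1)) - f (x(k := -1))) / 2 * g x)"
  proof (rule integral_cong_AE)
    show "(\<lambda>x. LINT y|circle_measure. ?F (x(k := y))) \<in> borel_measurable (torus_on (I - {k}))"
      using measurable_torus_upd[OF I(2) borel_measurable_integrable[OF int]]
      by (rule circle.borel_measurable_lebesgue_integral)
    have "g \<in> borel_measurable (torus_on (I - {k}))"
      using measurable_torus_upd_const[OF I(2) torus_regular_measurable[OF g], of 1] by (simp add: gk)
    then show "(\<lambda>x. (f (x(k := 1)) - f (x(k := - 1))) / 2 * g x) \<in> borel_measurable (torus_on (I - {k}))"
      using measurable_torus_upd_const[OF I(2) torus_regular_measurable[OF f]] by simp
    have "AE x in torus_on (I - {k}). x \<in> space (torus_on (I - {k}))" by (rule AE_space)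
    moreover have "AE x in torus_on (I - {k}). \<forall>i\<in>I - {k}. norm (x i) = 1"
      by (rule AE_torus_norm) (use I in simp)
    ultimately show "AE x in torus_on (I - {k}). (LINT y|circle_measure. ?F (x(k := y))) =
        (f (x(k := 1)) - f (x(k := -1))) / 2 * g x"
    proof eventually_elim
      case (elim x)
      have F: "?F (x(k := y)) = (f (x(k := y)) - f (x(k := inverse y))) / (y - inverse y) * g x" for y
        by (simp add: antisym_quotient_def gk)
      note fm = measurable_torus_upd_circle[OF I(2) torus_regular_measurable[OF f] elim(1)]
      have "(\<lambda>y. f (x(k := inverse y))) \<in> borel_measurable borel"
        by (rule measurable_compose[OF _ fm]) simp
      then have "(\<lambda>y. (f (x(k := y)) - f (x(k := inverse y))) / (y - inverse y)) \<in> borel_measurable borel"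
        using fm by (intro borel_measurable_divide borel_measurable_diff) auto
      from circle_integral_antisymmetrized[OF hol[OF elim(2)] R this]
      show ?case unfolding F integral_mult_left_zero by (rule arg_cong)
    qed
  qed
  finally show ?thesis .
qed

section \<open>Orbits under inversion\<close>

text \<open>The variables 0 and 1 are reserved for the signs 1 and -1; the variables 2i + 2 and 2i + 3 are
x_i and 1/x_i.\<close>

definition signed_vars :: "(nat \<Rightarrow> complex) \<Rightarrow> nat \<Rightarrow> complex" where
  "signed_vars x j = (if j = 0 then 1 else if j = 1 then -1 else pm_args x (j - 2))"

definition var_index :: "nat set \<Rightarrow> complex set \<Rightarrow> nat set" where
  "var_index I E = (if 1 \<in> E then {0} else {}) \<union> (if -1 \<in> E then {1} else {}) \<union>
     (\<lambda>i. 2 * i + 2) ` I \<union> (\<lambda>i. 2 * i + 3) ` I"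

definition sign_orbit :: "nat set \<Rightarrow> complex set \<Rightarrow> (nat \<Rightarrow> complex) \<Rightarrow> complex set" where
  "sign_orbit I E x = E \<union> x ` I \<union> (\<lambda>i. inverse (x i)) ` I"

lemma signed_vars_simps [simp]:
  "signed_vars x 0 = 1" "signed_vars x (Suc 0) = -1"
  "signed_vars x (2 * i + 2) = x i" "signed_vars x (2 * i + 3) = inverse (x i)"
proof -
  have e: "2 * i + 3 - 2 = 2 * i + 1" by simp
  have d: "(2 * i + 1) div 2 = i" by simp
  show "signed_vars x 0 = 1" "signed_vars x (Suc 0) = -1" "signed_vars x (2 * i + 2) = x i"
    by (simp_all add: signed_vars_def pm_args_def)
  show "signed_vars x (2 * i + 3) = inverse (x i)"
    unfolding signed_vars_def pm_args_def e d by simp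
qed

lemma signed_vars_Suc_Suc [simp]: "signed_vars x (Suc (Suc (2 * i))) = x i"
  using signed_vars_simps(3)[of x i] by (simp del: signed_vars_simps)

lemma finite_sign_orbit: "finite I \<Longrightarrow> finite E \<Longrightarrow> finite (sign_orbit I E x)"
  by (simp add: sign_orbit_def)

lemma finite_var_index: "finite I \<Longrightarrow> finite (var_index I E)"
  by (simp add: var_index_def)

lemma signed_vars_image:
  assumes "E \<subseteq> {1, -1}"
  shows "signed_vars x ` var_index I E = sign_orbit I E x"
proof -
  have "signed_vars x ` var_index I E = ((if 1 \<in> E then {1} else {}) \<union> (if -1 \<in> E then {-1} else {})) \<union>
      x ` I \<union> (\<lambda>i. inverse (x i)) ` I"
    unfolding var_index_def image_Un image_image signed_vars_simps by simp
  also have "(if 1 \<in> E then {1} else {}) \<union> (if -1 \<in> E then {-1} else {}) = E"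
    using assms by auto
  finally show ?thesis by (simp add: sign_orbit_def)
qed

lemma card_var_index:
  assumes "finite I" "E \<subseteq> {1, -1}"
  shows "card (var_index I E) = 2 * card I + card E"
proof -
  define V where "V = (if (1::complex) \<in> E then {0::nat} else {}) \<union> (if -1 \<in> E then {1} else {})"
  have "card V = card E"
  proof -
    have E: "E = {} \<or> E = {1} \<or> E = {-1} \<or> E = {1, -1}" using assms(2) by auto
    have n: "(1::complex) \<noteq> -1" "(-1::complex) \<noteq> 1" by (auto simp: complex_eq_iff)
    show ?thesis using E n unfolding V_def by (elim disjE) auto
  qed
  have dis: "V \<inter> (\<lambda>i. 2 * i + 2) ` I = {}" "(V \<union> (\<lambda>i. 2 * i + 2) ` I) \<inter> (\<lambda>i. 2 * i + 3) ` I = {}"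
    unfolding V_def by (auto split: if_splits) presburger+
  have "finite V" by (simp add: V_def)
  have "card (var_index I E) = card (V \<union> (\<lambda>i. 2 * i + 2) ` I) + card ((\<lambda>i. 2 * i + 3) ` I)"
    unfolding var_index_def V_def[symmetric] using dis assms(1) \<open>finite V\<close> by (intro card_Un_disjoint) auto
  also have "card (V \<union> (\<lambda>i. 2 * i + 2) ` I) = card V + card ((\<lambda>i. 2 * i + 2) ` I)"
    using dis assms(1) \<open>finite V\<close> by (intro card_Un_disjoint) auto
  finally show ?thesis
    using \<open>card V = card E\<close> by (simp add: card_image inj_on_def)
qed

lemma unit_circle_self_inverse:
  assumes "norm (y :: complex) = 1" "y = inverse y"
  shows "y = 1 \<or> y = -1"
proof -
  have "y * y = 1" using assms by (metis norm_zero right_inverse zero_neq_one)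
  then show ?thesis by (simp add: square_eq_1_iff)
qed

lemma generic_disjoint:
  assumes "generic_point I x" "E \<subseteq> {1, -1}"
  shows "inj_on x I" "inj_on (\<lambda>i. inverse (x i)) I"
    "E \<inter> x ` I = {}" "E \<inter> (\<lambda>i. inverse (x i)) ` I = {}" "x ` I \<inter> (\<lambda>i. inverse (x i)) ` I = {}"
proof -
  show "inj_on x I" "inj_on (\<lambda>i. inverse (x i)) I"
    using assms(1) by (auto simp: generic_point_def inj_on_def)
  have "x i \<noteq> 1 \<and> x i \<noteq> -1 \<and> inverse (x i) \<noteq> 1 \<and> inverse (x i) \<noteq> -1" if "i \<in> I" for i
    using assms(1) that unfolding generic_point_def by (metis inverse_1 inverse_inverse_eq inverse_minus_eq)
  then show "E \<inter> x ` I = {}" "E \<inter> (\<lambda>i. inverse (x i)) ` I = {}" using assms(2) by auto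
  have "x i \<noteq> inverse (x j)" if "i \<in> I" "j \<in> I" for i j
    using assms(1) that unit_circle_self_inverse[of "x i"] unfolding generic_point_def by metis
  then show "x ` I \<inter> (\<lambda>i. inverse (x i)) ` I = {}" by auto
qed

lemma prod_sign_orbit:
  assumes "generic_point I x" "E \<subseteq> {1, -1}" "finite I"
  shows "(\<Prod>b\<in>sign_orbit I E x. g b) = (\<Prod>e\<in>E. g e) * (\<Prod>i\<in>I. g (x i) * g (inverse (x i)) :: complex)"
proof -
  note d = generic_disjoint[OF assms(1,2)]
  have "finite E" using assms(2) by (rule finite_subset) simp
  have "(\<Prod>b\<in>sign_orbit I E x. g b) = (\<Prod>b\<in>E \<union> x ` I. g b) * (\<Prod>b\<in>(\<lambda>i. inverse (x i)) ` I. g b)"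
    unfolding sign_orbit_def using d assms(3) \<open>finite E\<close> by (intro prod.union_disjoint) auto
  also have "(\<Prod>b\<in>E \<union> x ` I. g b) = (\<Prod>b\<in>E. g b) * (\<Prod>b\<in>x ` I. g b)"
    using d assms(3) \<open>finite E\<close> by (intro prod.union_disjoint) auto
  finally show ?thesis
    by (simp add: prod.reindex d prod.distrib mult.assoc)
qed

lemma card_sign_orbit:
  assumes "generic_point I x" "E \<subseteq> {1, -1}" "finite I"
  shows "card (sign_orbit I E x) = 2 * card I + card E"
proof -
  note d = generic_disjoint[OF assms(1,2)]
  have "finite E" using assms(2) by (rule finite_subset) simp
  have "card (sign_orbit I E x) = card (E \<union> x ` I) + card ((\<lambda>i. inverse (x i)) ` I)"
    unfolding sign_orbit_def using d assms(3) \<open>finite E\<close> by (intro card_Un_disjoint) auto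
  also have "card (E \<union> x ` I) = card E + card (x ` I)"
    using d assms(3) \<open>finite E\<close> by (intro card_Un_disjoint) auto
  finally show ?thesis by (simp add: card_image d)
qed

lemma sign_orbit_remove: "k \<in> I \<Longrightarrow> sign_orbit I E x = insert (x k) (insert (inverse (x k)) (sign_orbit (I - {k}) E x))"
  unfolding sign_orbit_def by blast

lemma sign_orbit_cong: "(\<And>i. i \<in> I \<Longrightarrow> x i = y i) \<Longrightarrow> sign_orbit I E x = sign_orbit I E y"
  unfolding sign_orbit_def by auto

lemma generic_not_in_sign_orbit:
  assumes x: "generic_point I x" and k: "k \<in> I" and E: "E \<subseteq> {1, -1}"
  shows "x k \<notin> insert (inverse (x k)) (sign_orbit (I - {k}) E x)" "inverse (x k) \<notin> sign_orbit (I - {k}) E x"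
proof -
  have *: "norm (y k) = 1 \<and> y k \<notin> sign_orbit (I - {k}) E y" if y: "generic_point I y" for y
    using y k E unfolding generic_point_def sign_orbit_def by auto
  have "x k \<noteq> inverse (x k)"
    using unit_circle_self_inverse[of "x k"] x k unfolding generic_point_def by blast
  then show "x k \<notin> insert (inverse (x k)) (sign_orbit (I - {k}) E x)" using *[OF x] by blast
  have "sign_orbit (I - {k}) E (x(k := inverse (x k))) = sign_orbit (I - {k}) E x" by (rule sign_orbit_cong) auto
  then show "inverse (x k) \<notin> sign_orbit (I - {k}) E x" using *[OF generic_point_inverse[OF x k]] by simp
qed

lemma sign_orbit_nonzero: "generic_point I x \<Longrightarrow> E \<subseteq> {1, -1} \<Longrightarrow> 0 \<notin> sign_orbit I E x"
  unfolding generic_point_def sign_orbit_def by force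

lemma inverse_image_sign_orbit:
  assumes "E \<subseteq> {1, -1}"
  shows "inverse ` sign_orbit I E x = sign_orbit I E x"
proof -
  have "inverse ` E = E" using assms by (auto simp: image_iff) (metis inverse_minus_eq inverse_1 insertE singletonD subsetD)+
  then show ?thesis unfolding sign_orbit_def image_Un image_image by (auto simp: Un_ac)
qed

lemma signed_vars_regular:
  assumes "j \<in> var_index I E"
  shows "torus_regular I (\<lambda>x. signed_vars x j)"
  using assms unfolding var_index_def
  by (auto split: if_splits simp del: mult_Suc_right
     intro: torus_regular_const torus_regular_var torus_regular_var_inverse)

text \<open>Hall--Littlewood sums agree with a polynomial at generic points, and this polynomial, unlike
the sum itself, is also well behaved at the remaining points.\<close>

lemma ex_regular_hls_orbit:
  assumes "finite I" "E \<subseteq> {1, -1}" "length lam = 2 * card I + card E"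
  shows "\<exists>h. torus_regular I h \<and> (\<forall>x. generic_point I x \<longrightarrow> h x = hls p q lam (sign_orbit I E x))"
proof -
  let ?J = "var_index I E"
  have J: "finite ?J" using finite_var_index[OF assms(1)] .
  obtain f where f: "polyfun ?J f" "\<And>z. inj_on z ?J \<Longrightarrow> f z = hls p q lam (z ` ?J)"
    using hls_polyfun[OF J, of lam p q] card_var_index[OF assms(1,2)] assms(3) by auto
  have "torus_regular I (\<lambda>x. f (\<lambda>j. signed_vars x j))"
    by (rule torus_regular_polyfun[OF f(1) signed_vars_regular])
  moreover have "f (\<lambda>j. signed_vars x j) = hls p q lam (sign_orbit I E x)" if x: "generic_point I x" for x
  proof -
    have "inj_on (signed_vars x) ?J"
      using card_sign_orbit[OF x assms(2,1)] card_var_index[OF assms(1,2)] signed_vars_image[OF assms(2)]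
      by (intro eq_card_imp_inj_on[OF J]) simp
    then show ?thesis using f(2)[of "signed_vars x"] signed_vars_image[OF assms(2)] by simp
  qed
  ultimately show ?thesis by blast
qed

text \<open>Without the point 1/x_k the polynomial depends on x_k polynomially, hence
holomorphically even at 0.\<close>

lemma ex_regular_hls_half_orbit:
  assumes I: "finite I" "k \<in> I" and E: "E \<subseteq> {1, -1}" and len: "length lam + 1 = 2 * card I + card E"
  shows "\<exists>h. torus_regular I h \<and>
     (\<forall>x. generic_point (I - {k}) x \<longrightarrow> x k \<notin> sign_orbit (I - {k}) E x \<longrightarrow>
         h x = hls p q lam (insert (x k) (sign_orbit (I - {k}) E x))) \<and>
     (\<forall>x. (\<lambda>y. h (x(k := y))) holomorphic_on UNIV)"
proof -
  let ?K = "var_index (I - {k}) E" and ?j = "2 * k + 2"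
  let ?J = "insert ?j ?K"
  have J0: "finite ?K" using finite_var_index I by simp
  have jJ: "?j \<notin> ?K"
  proof -
    have "?j \<noteq> 0" "?j \<noteq> 1" by simp_all
    moreover have "?j \<notin> (\<lambda>i. 2 * i + 2) ` (I - {k})" by (simp add: image_iff)
    moreover have "?j \<noteq> 2 * i + 3" for i by presburger
    then have "?j \<notin> (\<lambda>i. 2 * i + 3) ` (I - {k})" by blast
    ultimately show ?thesis
      unfolding var_index_def by (intro notI, elim UnE) (simp_all split: if_splits)
  qed
  have Kj: "?K - {?j} = ?K" using jJ by blast
  have cardI: "card (I - {k}) + 1 = card I" using I by (metis Suc_eq_plus1 card_Suc_Diff1)
  have cardJ0: "card ?K = 2 * card (I - {k}) + card E"
    by (rule card_var_index) (use I E in auto)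
  have "length lam = card ?J" using J0 jJ cardJ0 len cardI by simp
  then obtain f where f: "polyfun ?J f" "\<And>z. inj_on z ?J \<Longrightarrow> f z = hls p q lam (z ` ?J)"
    using hls_polyfun[of ?J lam p q] J0 by auto
  let ?h = "\<lambda>x. f (\<lambda>j. signed_vars x j)"
  have sv: "signed_vars (x(k := y)) j = signed_vars x j" if "j \<in> ?K" for x y j
    using that unfolding var_index_def
    by (auto split: if_splits simp del: mult_Suc_right)
  have "torus_regular I ?h"
  proof (rule torus_regular_polyfun[OF f(1)])
    fix j assume "j \<in> ?J"
    moreover have "?J \<subseteq> var_index I E" using I(2) unfolding var_index_def by auto
    ultimately show "torus_regular I (\<lambda>x. signed_vars x j)" using signed_vars_regular by blast
  qed
  moreover have "?h x = hls p q lam (insert (x k) (sign_orbit (I - {k}) E x))"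
    if x: "generic_point (I - {k}) x" "x k \<notin> sign_orbit (I - {k}) E x" for x
  proof -
    have im: "signed_vars x ` ?J = insert (x k) (sign_orbit (I - {k}) E x)"
      unfolding image_insert signed_vars_image[OF E] by simp
    have "inj_on (signed_vars x) ?K"
      using card_sign_orbit[OF x(1) E] I cardJ0 signed_vars_image[OF E, of x "I - {k}"]
      by (intro eq_card_imp_inj_on[OF J0]) simp
    then have "inj_on (signed_vars x) ?J"
      using x(2) signed_vars_image[OF E, of x "I - {k}"] unfolding inj_on_insert Kj by simp
    then show ?thesis using f(2)[of "signed_vars x"] im by simp
  qed
  moreover have "(\<lambda>y. ?h (x(k := y))) holomorphic_on UNIV" for x
  proof -
    obtain M c where fM: "finite M" "f = (\<lambda>z. \<Sum>m\<in>M. c m * (\<Prod>i\<in>?J. z i ^ m i))"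
      using f(1) unfolding polyfun_def by blast
    have "(\<lambda>y. signed_vars (x(k := y)) j) holomorphic_on UNIV" if "j \<in> ?J" for j
    proof (cases "j = ?j")
      case True
      then show ?thesis by (simp add: holomorphic_on_ident)
    next
      case False
      then have "j \<in> ?K" using that by simp
      then show ?thesis by (simp add: sv)
    qed
    then show ?thesis unfolding fM(2) by (intro holomorphic_intros)
  qed
  ultimately show ?thesis by blast
qed

section \<open>The integrand and its factorization\<close>

definition pair_weight :: "complex \<Rightarrow> complex \<Rightarrow> complex \<Rightarrow> complex" where
  "pair_weight t x y = pm_pair_factor 1 x y / pm_pair_factor t x y"

definition single_weight :: "complex \<Rightarrow> complex set \<Rightarrow> complex \<Rightarrow> complex" where
  "single_weight t E x = (\<Prod>e\<in>E. pm_factor e x / pm_factor (t * e) x) / pm_factor t (x\<^sup>2)"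

text \<open>For E = {} this is, up to normalization, the density of the theorem. For t = 0 the four choices
of E give, up to constants, the eigenvalue densities of the components of the orthogonal groups,
with E the set of eigenvalues that are forced.\<close>

definition component_density :: "complex \<Rightarrow> complex set \<Rightarrow> nat set \<Rightarrow> (nat \<Rightarrow> complex) \<Rightarrow> complex" where
  "component_density t E I x = (\<Prod>i\<in>I. single_weight t E (x i)) *
     (\<Prod>(i,j)\<in>index_pairs I. pair_weight t (x i) (x j))"

text \<open>What remains of the density factors involving x_k after cancellation with the kernel of the
summand in which x_k receives the first exponent.\<close>

definition coupling :: "complex \<Rightarrow> complex set \<Rightarrow> nat \<Rightarrow> nat set \<Rightarrow> (nat \<Rightarrow> complex) \<Rightarrow> complex" where
  "coupling t E k I x =
     (\<Prod>l\<in>I. (1 - x k * x l) * (1 - x k * inverse (x l)) /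
        ((1 - t * x k * x l) * (1 - t * x k * inverse (x l)))) *
     (\<Prod>e\<in>E. (1 - e * x k) / (1 - t * e * x k)) / (1 - t * (x k)\<^sup>2)"

lemma pair_weight_commute: "pair_weight t x y = pair_weight t y x"
  by (simp add: pair_weight_def pm_pair_factor_def mult_ac)

lemma pair_weight_inverse: "pair_weight t (inverse x) y = pair_weight t x y"
  by (simp add: pair_weight_def pm_pair_factor_def mult_ac)

lemma single_weight_inverse: "single_weight t E (inverse x) = single_weight t E x"
  by (simp add: single_weight_def pm_factor_def power_inverse mult_ac)

lemma component_density_remove:
  assumes "finite I" "k \<in> I"
  shows "component_density t E I x = single_weight t E (x k) *
     (\<Prod>l\<in>I - {k}. pair_weight t (x k) (x l)) * component_density t E (I - {k}) x"
proof -
  have "(\<Prod>l\<in>I - {k}. if l < k then pair_weight t (x l) (x k) else pair_weight t (x k) (x l)) =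
     (\<Prod>l\<in>I - {k}. pair_weight t (x k) (x l))"
    by (intro prod.cong refl) (simp add: pair_weight_commute)
  then show ?thesis
    unfolding component_density_def prod_index_pairs_remove[OF assms] prod.remove[OF assms]
    by (simp add: mult_ac)
qed

lemma component_density_cong:
  "(\<And>i. i \<in> I \<Longrightarrow> x i = y i) \<Longrightarrow> component_density t E I x = component_density t E I y"
  unfolding component_density_def
  by (intro arg_cong2[of _ _ _ _ "(*)"] prod.cong refl) (auto simp: index_pairs_def)

lemma component_density_invert:
  assumes "finite I" "k \<in> I"
  shows "component_density t E I (x(k := inverse (x k))) = component_density t E I x"
proof -
  let ?x = "x(k := inverse (x k))"
  have "component_density t E (I - {k}) ?x = component_density t E (I - {k}) x"
    by (rule component_density_cong) auto
  moreover have "(\<Prod>l\<in>I - {k}. pair_weight t (?x k) (?x l)) = (\<Prod>l\<in>I - {k}. pair_weight t (x k) (x l))"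
    by (intro prod.cong refl) (auto simp: pair_weight_inverse)
  ultimately show ?thesis
    unfolding component_density_remove[OF assms] by (simp add: single_weight_inverse)
qed

lemma one_minus_nonzero:
  fixes t u :: complex
  assumes "norm t < 1" "norm u \<le> 1"
  shows "1 - t * u \<noteq> 0"
proof
  assume "1 - t * u = 0"
  then have "norm (t * u) = 1" by simp
  moreover have "norm (t * u) \<le> norm t * 1"
    unfolding norm_mult by (rule mult_left_mono[OF assms(2) norm_ge_zero])
  ultimately show False using assms(1) by simp
qed

lemma torus_regular_reciprocal:
  assumes f: "torus_regular I f" and t: "norm t < 1"
    and le: "\<And>x. \<forall>i\<in>I. norm (x i) = 1 \<Longrightarrow> norm (f x) \<le> norm t"
  shows "torus_regular I (\<lambda>x. inverse (1 - f x))"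
proof (rule torus_regular_inverse)
  show "torus_regular I (\<lambda>x. 1 - f x)" by (intro torus_regular_diff torus_regular_const f)
  show "0 < 1 - norm t" using t by simp
  show "1 - norm t \<le> norm (1 - f x)" if "\<forall>i\<in>I. norm (x i) = 1" for x
    using le[OF that] norm_triangle_ineq2[of 1 "f x"] by simp
qed

lemma sign_norm: "E \<subseteq> {1, -1} \<Longrightarrow> e \<in> E \<Longrightarrow> norm (e :: complex) = 1"
  by auto

lemma sign_square: "E \<subseteq> {1, -1} \<Longrightarrow> e \<in> E \<Longrightarrow> e * e = (1 :: complex)"
  by auto

lemma component_density_regular:
  assumes t: "norm t < 1" and "I' \<subseteq> I" "E \<subseteq> {1, -1}"
  shows "torus_regular I (component_density t E I')"
proof -
  have single: "torus_regular I (\<lambda>x. single_weight t E (x i))" if "i \<in> I" for i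
    unfolding single_weight_def pm_factor_def divide_inverse inverse_mult_distrib
    using that sign_norm[OF assms(3)]
    by (intro torus_regular_mult torus_regular_prod torus_regular_diff torus_regular_const
        torus_regular_var torus_regular_var_inverse torus_regular_reciprocal[OF _ t] torus_regular_power
        torus_regular_power[OF torus_regular_var_inverse, unfolded power_inverse])
       (auto simp: norm_mult norm_inverse norm_power)
  have pair: "torus_regular I (\<lambda>x. pair_weight t (x i) (x j))" if "i \<in> I" "j \<in> I" for i j
    unfolding pair_weight_def pm_pair_factor_def divide_inverse inverse_mult_distrib
    using that
    by (intro torus_regular_mult torus_regular_diff torus_regular_const
        torus_regular_var torus_regular_var_inverse torus_regular_reciprocal[OF _ t])
       (auto simp: norm_mult norm_inverse)
  show ?thesis
    unfolding component_density_def[abs_def] case_prod_unfold using assms(2)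
    by (intro torus_regular_mult torus_regular_prod single pair) (auto simp: index_pairs_def)
qed

lemma coupling_regular:
  assumes t: "norm t < 1" and "k \<in> I" "I' \<subseteq> I" "E \<subseteq> {1, -1}"
  shows "torus_regular I (coupling t E k I')"
  unfolding coupling_def[abs_def] divide_inverse inverse_mult_distrib
  using assms(2,3) sign_norm[OF assms(4)]
  by (intro torus_regular_mult torus_regular_prod torus_regular_diff torus_regular_const
      torus_regular_var torus_regular_var_inverse torus_regular_reciprocal[OF _ t] torus_regular_power)
     (auto simp: norm_mult norm_inverse norm_power)

text \<open>The radius is larger than 1 and at the same time so small that |t| |y|^2 < 1 on the disc, which
is (1 - |t|)^2 > 0.\<close>

lemma coupling_holomorphic:
  assumes t: "norm t < 1" and k: "k \<notin> I" and E: "E \<subseteq> {1, -1}"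
    and x: "\<forall>i\<in>I. norm (x i) = 1"
  shows "(\<lambda>y. coupling t E k I (x(k := y))) holomorphic_on ball 0 (2 / (1 + norm t))"
proof -
  let ?R = "2 / (1 + norm t)"
  have t1: "0 < 1 + norm t" using norm_ge_zero[of t] by linarith
  have R: "1 < ?R" using t t1 by (simp add: less_divide_eq)
  have "0 < (1 - norm t) ^ 2" using t by simp
  then have "4 * norm t < (1 + norm t) ^ 2" by (simp add: power2_eq_square algebra_simps)
  then have tR2: "norm t * ?R ^ 2 < 1" using t1 by (simp add: power_divide divide_less_eq)
  have small2: "norm t * norm y ^ 2 < 1" if "norm y < ?R" for y :: complex
    using mult_left_mono[OF power_mono[OF less_imp_le[OF that], of 2], of "norm t"] tR2 by simp
  have small1: "norm t * norm y < 1" if "norm y < ?R" for y :: complex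
  proof -
    have "norm t * norm y \<le> norm t * ?R ^ 2"
      using that R by (intro mult_left_mono order.trans[OF less_imp_le[OF that]]) (simp_all add: self_le_power)
    then show ?thesis using tR2 by simp
  qed
  have nz2: "1 - t * y\<^sup>2 \<noteq> 0" if "norm y < ?R" for y
  proof
    assume "1 - t * y\<^sup>2 = 0"
    then have "norm (t * y\<^sup>2) = 1" by simp
    then show False using small2[OF that] by (simp add: norm_mult norm_power)
  qed
  have nz1: "1 - t * u * y \<noteq> 0" if "norm y < ?R" "norm u = 1" for y u
  proof
    assume "1 - t * u * y = 0"
    then have "norm (t * u * y) = 1" by simp
    then show False using small1[OF that(1)] that(2) by (simp add: norm_mult)
  qed
  have nz1': "1 - t * y * u \<noteq> 0" if "norm y < ?R" "norm u = 1" for y u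
    using nz1[OF that] by (simp add: mult_ac)
  have upd: "(x(k := y)) l = x l" if "l \<in> I" for l y using that k by auto
  have "coupling t E k I (x(k := y)) =
     (\<Prod>l\<in>I. (1 - y * x l) * (1 - y * inverse (x l)) /
        ((1 - t * y * x l) * (1 - t * y * inverse (x l)))) *
     (\<Prod>e\<in>E. (1 - e * y) / (1 - t * e * y)) / (1 - t * y\<^sup>2)" for y
  proof -
    have "(\<Prod>l\<in>I. (1 - y * (x(k := y)) l) * (1 - y * inverse ((x(k := y)) l)) /
        ((1 - t * y * (x(k := y)) l) * (1 - t * y * inverse ((x(k := y)) l)))) =
      (\<Prod>l\<in>I. (1 - y * x l) * (1 - y * inverse (x l)) /
        ((1 - t * y * x l) * (1 - t * y * inverse (x l))))"
      by (intro prod.cong refl) (simp only: upd)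
    then show ?thesis by (simp only: coupling_def fun_upd_same)
  qed
  moreover have "(\<lambda>y. (\<Prod>l\<in>I. (1 - y * x l) * (1 - y * inverse (x l)) /
        ((1 - t * y * x l) * (1 - t * y * inverse (x l)))) *
     (\<Prod>e\<in>E. (1 - e * y) / (1 - t * e * y)) / (1 - t * y\<^sup>2)) holomorphic_on ball 0 ?R"
  proof -
    have "(1 - t * y * x l) * (1 - t * y * inverse (x l)) \<noteq> 0" if "y \<in> ball 0 ?R" "l \<in> I" for y l
      using nz1'[of y "x l"] nz1'[of y "inverse (x l)"] that x by (simp add: norm_inverse)
    moreover have "1 - t * e * y \<noteq> 0" if "y \<in> ball 0 ?R" "e \<in> E" for y e
      using nz1[of y e] that sign_norm[OF E] by simp
    moreover have "1 - t * y\<^sup>2 \<noteq> 0" if "y \<in> ball 0 ?R" for y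
      using nz2[of y] that by simp
    ultimately show ?thesis
      by (intro holomorphic_on_mult holomorphic_on_divide holomorphic_on_prod holomorphic_on_diff
          holomorphic_on_const holomorphic_on_ident holomorphic_on_power)
  qed
  ultimately show ?thesis by simp
qed

text \<open>The kernel at (x, y) and (x, 1/y) cancels the two factors of the pair weight in which x occurs
inverted.\<close>

lemma pair_factor_cancel:
  fixes x y t :: complex
  assumes t: "norm t < 1" and n: "norm x = 1" "norm y = 1" and ne: "x \<noteq> y" "x \<noteq> inverse y"
  shows "(x - t * y) / (x - y) * ((x - t * inverse y) / (x - inverse y)) * pair_weight t x y =
     (1 - x * y) * (1 - x * inverse y) / ((1 - t * x * y) * (1 - t * x * inverse y))"
proof -
  have x0: "x \<noteq> 0" using n by auto
  have e: "x - c * z = x * (1 - c * inverse x * z)" for c z using x0 by (simp add: field_simps)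
  have c: "1 - 1 * inverse x * y \<noteq> 0" "1 - 1 * inverse x * inverse y \<noteq> 0"
    using ne e[of 1 y] e[of 1 "inverse y"] by auto
  have d: "1 - t * inverse x * y \<noteq> 0" "1 - t * inverse x * inverse y \<noteq> 0"
    using one_minus_nonzero[OF t, of "inverse x * y"] one_minus_nonzero[OF t, of "inverse x * inverse y"] n
    by (auto simp: norm_mult norm_inverse mult.assoc)
  have alg: "(x * C) / (x * c) * ((x * D) / (x * d)) * ((a * b * c * d) / (A * B * C * D)) = a * b / (A * B)"
    if "c \<noteq> 0" "d \<noteq> 0" "C \<noteq> 0" "D \<noteq> 0" for a b c d A B C D
    using that x0 by simp
  show ?thesis
    using alg[OF c d, of "1 - 1 * x * y" "1 - 1 * x * inverse y" "1 - t * x * y" "1 - t * x * inverse y"]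
    unfolding pair_weight_def pm_pair_factor_def e[symmetric] by simp
qed

lemma point_factor_cancel:
  fixes x e t :: complex
  assumes t: "norm t < 1" and n: "norm x = 1" and e: "norm e = 1" "x \<noteq> e"
  shows "(x - t * e) / (x - e) * (pm_factor e x / pm_factor (t * e) x) = (1 - e * x) / (1 - t * e * x)"
proof -
  have x0: "x \<noteq> 0" using n by auto
  have ex: "x - c * e = x * (1 - c * e * inverse x)" for c using x0 by (simp add: field_simps)
  have c: "1 - 1 * e * inverse x \<noteq> 0" using e(2) ex[of 1] by auto
  have d: "1 - t * e * inverse x \<noteq> 0"
    using one_minus_nonzero[OF t, of "e * inverse x"] n e by (auto simp: norm_mult norm_inverse mult.assoc)
  have alg: "(x * C) / (x * c) * ((a * c) / (A * C)) = a / A" if "c \<noteq> 0" "C \<noteq> 0" for a c A C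
    using that x0 by simp
  show ?thesis
    using alg[OF c d, of "1 - e * x" "1 - t * e * x"]
    unfolding pm_factor_def ex[symmetric] by simp
qed

lemma self_factor_cancel:
  fixes x t :: complex
  assumes t: "norm t < 1" and n: "norm x = 1"
  shows "(x - t * inverse x) / (x - inverse x) / pm_factor t (x\<^sup>2) = x / (x - inverse x) / (1 - t * x\<^sup>2)"
proof -
  have x0: "x \<noteq> 0" using n by auto
  have ex: "x - t * inverse x = x * (1 - t * inverse (x\<^sup>2))" using x0 by (simp add: field_simps power2_eq_square)
  have d: "1 - t * inverse (x\<^sup>2) \<noteq> 0"
    using one_minus_nonzero[OF t, of "inverse (x\<^sup>2)"] n by (auto simp: norm_power norm_inverse)
  show ?thesis unfolding ex pm_factor_def using d by simp
qed

section \<open>The summands at a variable and at a sign\<close>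

lemma sum_sign_orbit:
  assumes "generic_point I x" "E \<subseteq> {1, -1}" "finite I"
  shows "(\<Sum>b\<in>sign_orbit I E x. g b) = (\<Sum>e\<in>E. g e) + (\<Sum>i\<in>I. g (x i) + g (inverse (x i)) :: complex)"
proof -
  note d = generic_disjoint[OF assms(1,2)]
  have "finite E" using assms(2) by (rule finite_subset) simp
  have "(\<Sum>b\<in>sign_orbit I E x. g b) = (\<Sum>b\<in>E \<union> x ` I. g b) + (\<Sum>b\<in>(\<lambda>i. inverse (x i)) ` I. g b)"
    unfolding sign_orbit_def using d assms(3) \<open>finite E\<close> by (intro sum.union_disjoint) auto
  also have "(\<Sum>b\<in>E \<union> x ` I. g b) = (\<Sum>b\<in>E. g b) + (\<Sum>b\<in>x ` I. g b)"
    using d assms(3) \<open>finite E\<close> by (intro sum.union_disjoint) auto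
  finally show ?thesis
    by (simp add: sum.reindex d sum.distrib add.assoc)
qed

definition hl_summand :: "complex \<Rightarrow> nat \<Rightarrow> nat list \<Rightarrow> complex set \<Rightarrow> complex \<Rightarrow> complex" where
  "hl_summand t l ls A a = a ^ l * (\<Prod>b\<in>A - {a}. (a - t * b) / (a - b)) * hls 1 t ls (A - {a})"

lemma hls_Cons_summand: "hls 1 t (l # ls) A = (\<Sum>a\<in>A. hl_summand t l ls A a)"
  by (simp add: hl_summand_def)

text \<open>The points of the orbit come in inverse pairs and the signs are their own inverses, so the
orbit is invariant under inversion and its product is the product of E.\<close>

lemma hls_reflect:
  assumes x: "generic_point I x" and I: "finite I" and E: "E \<subseteq> {1, -1}"
    and c: "c \<noteq> 0" "c \<notin> sign_orbit I E x"
    and len: "length ls = Suc (2 * card I + card E)" and d: "\<forall>m\<in>set ls. m \<le> d"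
  shows "hls p q ls (insert (inverse c) (sign_orbit I E x)) * c ^ d =
     (\<Prod>E) ^ d * hls q p (map (\<lambda>m. d - m) ls) (insert c (sign_orbit I E x))"
proof -
  let ?B = "sign_orbit I E x"
  have finE: "finite E" using E by (rule finite_subset) simp
  have finB: "finite ?B" by (rule finite_sign_orbit[OF I finE])
  have im: "inverse ` insert c ?B = insert (inverse c) ?B"
    by (simp add: inverse_image_sign_orbit[OF E])
  have inv: "hls p q ls (inverse ` insert c ?B) * (\<Prod>a\<in>insert c ?B. a ^ d) =
     hls q p (map (\<lambda>m. d - m) ls) (insert c ?B)"
    by (rule hls_inverse) (use finB c sign_orbit_nonzero[OF x E] card_sign_orbit[OF x E I] len d in auto)
  have ins: "(\<Prod>a\<in>insert c ?B. a ^ d) = c ^ d * (\<Prod>a\<in>?B. a ^ d)"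
    using finB c by simp
  have PB: "(\<Prod>a\<in>?B. a ^ d) = (\<Prod>E) ^ d"
  proof -
    have "x i ^ d * inverse (x i) ^ d = 1" if "i \<in> I" for i
    proof -
      have "x i \<noteq> 0" using x that unfolding generic_point_def by auto
      then show ?thesis by (simp add: power_mult_distrib[symmetric])
    qed
    then have "(\<Prod>i\<in>I. x i ^ d * inverse (x i) ^ d) = 1" by (intro prod.neutral) auto
    then show ?thesis
      by (subst prod_sign_orbit[OF x E I]) (simp add: prod_power_distrib)
  qed
  have PP: "(\<Prod>E) ^ d * (\<Prod>E) ^ d = 1"
  proof -
    have "\<Prod>E * \<Prod>E = (\<Prod>e\<in>E. e * e)" by (simp add: prod.distrib)
    also have "\<dots> = 1" by (intro prod.neutral ballI sign_square[OF E])
    finally show ?thesis by (simp add: power_mult_distrib[symmetric])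
  qed
  have cancel: "h * y = P * H" if "h * (y * P) = H" "P * P = 1" for h y P H :: complex
  proof -
    have "P * H = h * y * (P * P)" by (simp add: that(1)[symmetric] mult_ac)
    then show ?thesis by (simp add: that(2))
  qed
  show ?thesis by (rule cancel[OF inv[unfolded im ins PB] PP])
qed

text \<open>The kernel against every other point cancels with the density, and reflecting the remaining sum
turns 1/x_k into x_k. Up to the simple denominator the result is
holomorphic in x_k near the closed unit disc.\<close>

lemma hl_summand_variable:
  assumes t: "norm t < 1" and I: "finite I" "k \<in> I" and E: "E \<subseteq> {1, -1}" and x: "generic_point I x"
    and len: "length ls + 1 = 2 * card I + card E" and d: "\<forall>m\<in>set ls. m \<le> Suc l"
  shows "hl_summand t l ls (sign_orbit I E x) (x k) * component_density t E I x =
     (\<Prod>E) ^ Suc l * hls t 1 (map (\<lambda>m. Suc l - m) ls) (insert (x k) (sign_orbit (I - {k}) E x)) *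
       coupling t E k (I - {k}) x / (x k - inverse (x k)) * component_density t E (I - {k}) x"
proof -
  let ?I = "I - {k}"
  let ?B = "sign_orbit ?I E x" and ?x = "x k"
  let ?F = "\<lambda>b. (?x - t * b) / (?x - b)"
  have finE: "finite E" using E by (rule finite_subset) simp
  have finB: "finite ?B" by (rule finite_sign_orbit) (use I(1) finE in auto)
  have x': "generic_point ?I x" using generic_point_subset[OF x] by blast
  have notin: "?x \<notin> insert (inverse ?x) ?B" "inverse ?x \<notin> ?B"
    using generic_not_in_sign_orbit[OF x I(2) E] by auto
  have A: "sign_orbit I E x - {?x} = insert (inverse ?x) ?B"
    unfolding sign_orbit_remove[OF I(2)] by (rule Diff_insert_absorb[OF notin(1)])
  have nx: "norm ?x = 1" using x I unfolding generic_point_def by blast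
  have "(\<Prod>b\<in>insert (inverse ?x) ?B. ?F b) = ?F (inverse ?x) * (\<Prod>b\<in>?B. ?F b)"
    using finB notin by simp
  also have "(\<Prod>b\<in>?B. ?F b) = (\<Prod>e\<in>E. ?F e) * (\<Prod>i\<in>?I. ?F (x i) * ?F (inverse (x i)))"
    by (rule prod_sign_orbit[OF x' E]) (use I in simp)
  finally have pr: "(\<Prod>b\<in>insert (inverse ?x) ?B. ?F b) =
    ?F (inverse ?x) * ((\<Prod>e\<in>E. ?F e) * (\<Prod>i\<in>?I. ?F (x i) * ?F (inverse (x i))))" .
  have pairs: "(\<Prod>i\<in>?I. ?F (x i) * ?F (inverse (x i))) * (\<Prod>l\<in>?I. pair_weight t ?x (x l)) =
     (\<Prod>l\<in>?I. (1 - x k * x l) * (1 - x k * inverse (x l)) /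
        ((1 - t * x k * x l) * (1 - t * x k * inverse (x l))))"
    unfolding prod.distrib[symmetric]
  proof (intro prod.cong refl pair_factor_cancel t nx)
    fix i assume i: "i \<in> ?I"
    show "norm (x i) = 1" "?x \<noteq> x i" "?x \<noteq> inverse (x i)"
      using x I i unfolding generic_point_def by auto
  qed
  have points: "(\<Prod>e\<in>E. ?F e) * (\<Prod>e\<in>E. pm_factor e ?x / pm_factor (t * e) ?x) =
     (\<Prod>e\<in>E. (1 - e * x k) / (1 - t * e * x k))"
    unfolding prod.distrib[symmetric]
  proof (intro prod.cong refl point_factor_cancel t nx)
    fix e assume e: "e \<in> E"
    show "norm e = 1" using sign_norm[OF E e] .
    show "?x \<noteq> e" using x I e E unfolding generic_point_def by auto
  qed
  have len': "length ls = Suc (2 * card ?I + card E)"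
    using len card_Suc_Diff1[OF I, symmetric] by simp
  have refl: "hls 1 t ls (insert (inverse ?x) ?B) * ?x ^ Suc l =
     (\<Prod>E) ^ Suc l * hls t 1 (map (\<lambda>m. Suc l - m) ls) (insert ?x ?B)"
    by (rule hls_reflect[OF x' _ E _ _ len' d]) (use I nx notin in auto)
  have alg: "X ^ l * (F * (PE * PL)) * h * (PW / pf * PC * D) = PH * (PL' * PE' / q) / xx * D"
    if "PL * PC = PL'" "PE * PW = PE'" "F / pf = X / xx / q" "h * X ^ Suc l = PH"
    for X F PE PL h PW pf PC D PH PL' PE' q xx :: complex
  proof -
    have "X ^ l * (F * (PE * PL)) * h * (PW / pf * PC * D) = X ^ l * h * (F / pf) * (PE * PW) * (PL * PC) * D"
      by (simp add: mult_ac)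
    also have "\<dots> = (h * X ^ Suc l) * (PL' * PE' / q) / xx * D"
      unfolding that(1-3) by (simp add: mult_ac)
    finally show ?thesis unfolding that(4) .
  qed
  show ?thesis
    unfolding hl_summand_def A pr component_density_remove[OF I] single_weight_def coupling_def
    by (rule alg[OF pairs points self_factor_cancel[OF t nx] refl])
qed

text \<open>The kernel at e against the pair x_i, 1/x_i is the reciprocal of the density factor belonging
to e; here e^2 = 1 is used.\<close>

lemma hl_summand_sign:
  assumes t: "norm t < 1" and I: "finite I" and E: "E \<subseteq> {1, -1}" and e: "e \<in> E" and x: "generic_point I x"
  shows "hl_summand t l ls (sign_orbit I E x) e * component_density t E I x =
     e ^ l * (\<Prod>b\<in>E - {e}. (e - t * b) / (e - b)) *
       (hls 1 t ls (sign_orbit I (E - {e}) x) * component_density t (E - {e}) I x)"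
proof -
  let ?E = "E - {e}"
  let ?B = "sign_orbit I ?E x" and ?F = "\<lambda>b. (e - t * b) / (e - b)"
  have finE: "finite E" using E by (rule finite_subset) simp
  have E': "?E \<subseteq> {1, -1}" using E by blast
  have ee: "e * e = 1" "norm e = 1" using sign_square[OF E e] sign_norm[OF E e] .
  then have e0: "e \<noteq> 0" by auto
  have nin: "e \<notin> x ` I" "e \<notin> (\<lambda>i. inverse (x i)) ` I"
    using generic_disjoint(3,4)[OF x E] e by blast+
  have A: "sign_orbit I E x - {e} = ?B"
    using nin e unfolding sign_orbit_def by blast
  have single: "single_weight t E y = (pm_factor e y / pm_factor (t * e) y) * single_weight t ?E y" for y
    unfolding single_weight_def prod.remove[OF finE e] by simp
  have dens: "component_density t E I x =
     (\<Prod>i\<in>I. pm_factor e (x i) / pm_factor (t * e) (x i)) * component_density t ?E I x"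
    unfolding component_density_def single prod.distrib by (simp only: mult.assoc)
  have "?F (x i) * ?F (inverse (x i)) * (pm_factor e (x i) / pm_factor (t * e) (x i)) = 1" if i: "i \<in> I" for i
  proof -
    have n: "norm (x i) = 1" using x i unfolding generic_point_def by blast
    have f: "e - c * y = e * (1 - (c * e) * y)" for c y
      using ee(1) by (simp add: algebra_simps)
    have "1 - e * x i \<noteq> 0" "1 - e * inverse (x i) \<noteq> 0"
      using f[of 1 "x i"] f[of 1 "inverse (x i)"] nin i by auto
    moreover have "1 - t * e * x i \<noteq> 0" "1 - t * e * inverse (x i) \<noteq> 0"
      using one_minus_nonzero[OF t, of "e * x i"] one_minus_nonzero[OF t, of "e * inverse (x i)"] n ee
      by (auto simp: norm_mult norm_inverse mult.assoc)
    moreover have "(e * C) / (e * c) * ((e * D) / (e * d)) * ((c * d) / (C * D)) = 1"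
      if "c \<noteq> 0" "d \<noteq> 0" "C \<noteq> 0" "D \<noteq> 0" for c d C D
      using that e0 by simp
    ultimately show ?thesis
      unfolding pm_factor_def f[of t] using f[of 1 "x i"] f[of 1 "inverse (x i)"] by simp
  qed
  then have QW: "(\<Prod>i\<in>I. ?F (x i) * ?F (inverse (x i))) * (\<Prod>i\<in>I. pm_factor e (x i) / pm_factor (t * e) (x i)) = 1"
    unfolding prod.distrib[symmetric] by (intro prod.neutral) blast
  have PR: "(\<Prod>b\<in>?B. ?F b) = (\<Prod>b\<in>?E. ?F b) * (\<Prod>i\<in>I. ?F (x i) * ?F (inverse (x i)))"
    by (rule prod_sign_orbit[OF x E' I])
  have alg: "el * P * h * (W * D) = el * R * (h * D)" if "Q * W = 1" "P = R * Q" for el P h W D R Q :: complex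
  proof -
    have "el * P * h * (W * D) = el * R * (h * D) * (Q * W)" by (simp add: that(2) mult_ac)
    then show ?thesis by (simp add: that(1))
  qed
  show ?thesis unfolding hl_summand_def A dens by (rule alg[OF QW PR])
qed

lemma coupling_at_sign_in:
  assumes "E \<subseteq> {1, -1}" "\<delta> \<in> E"
  shows "coupling t E k I (x(k := \<delta>)) = 0"
proof -
  have "finite E" using assms(1) by (rule finite_subset) simp
  then have "(\<Prod>e\<in>E. (1 - e * \<delta>) / (1 - t * e * \<delta>)) = 0"
    using assms sign_square[OF assms] by (auto simp: prod_zero_iff)
  then show ?thesis by (simp add: coupling_def)
qed

text \<open>Putting x_k equal to a sign turns its coupling to the other variables into the density factors
of that sign.\<close>

lemma coupling_at_sign_notin:
  assumes E: "E \<subseteq> {1, -1}" and \<delta>: "\<delta> \<in> {1, -1}" "\<delta> \<notin> E" and k: "k \<notin> I"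
  shows "coupling t E k I (x(k := \<delta>)) * component_density t E I x =
    (\<Prod>e\<in>E. (1 - e * \<delta>) / (1 - t * e * \<delta>)) / (1 - t) * component_density t (insert \<delta> E) I x"
proof -
  have finE: "finite E" using E by (rule finite_subset) simp
  have dd: "\<delta>\<^sup>2 = 1" using \<delta> by (auto simp: power2_eq_square)
  have P: "(\<Prod>l\<in>I. (1 - \<delta> * (x(k := \<delta>)) l) * (1 - \<delta> * inverse ((x(k := \<delta>)) l)) /
        ((1 - t * \<delta> * (x(k := \<delta>)) l) * (1 - t * \<delta> * inverse ((x(k := \<delta>)) l)))) =
     (\<Prod>l\<in>I. pm_factor \<delta> (x l) / pm_factor (t * \<delta>) (x l))"
    using k by (intro prod.cong refl) (auto simp: pm_factor_def)
  have single: "single_weight t (insert \<delta> E) y = (pm_factor \<delta> y / pm_factor (t * \<delta>) y) * single_weight t E y" for y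
    unfolding single_weight_def prod.insert[OF finE \<delta>(2)] by simp
  show ?thesis
    unfolding coupling_def component_density_def single prod.distrib fun_upd_same P dd
    by (simp add: mult_ac)
qed

section \<open>A recursion removing the first part\<close>

text \<open>A representative that is measurable and bounded; it matters only at generic points, where it is
the Hall--Littlewood sum.\<close>

definition hl_orbit :: "complex \<Rightarrow> nat list \<Rightarrow> nat set \<Rightarrow> complex set \<Rightarrow> (nat \<Rightarrow> complex) \<Rightarrow> complex" where
  "hl_orbit t lam I E = (SOME h. torus_regular I h \<and>
     (\<forall>x. generic_point I x \<longrightarrow> h x = hls 1 t lam (sign_orbit I E x)))"

lemma hl_orbit:
  assumes "finite I" "E \<subseteq> {1, -1}" "length lam = 2 * card I + card E"
  shows "torus_regular I (hl_orbit t lam I E)"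
    "generic_point I x \<Longrightarrow> hl_orbit t lam I E x = hls 1 t lam (sign_orbit I E x)"
  using someI_ex[OF ex_regular_hls_orbit[OF assms, of 1 t]] unfolding hl_orbit_def by blast+

definition hl_integral :: "complex \<Rightarrow> complex set \<Rightarrow> nat set \<Rightarrow> nat list \<Rightarrow> complex" where
  "hl_integral t E I lam = (LINT x|torus_on I. hl_orbit t lam I E x * component_density t E I x)"

lemma hl_integral_integrable:
  assumes "norm t < 1" "finite I" "E \<subseteq> {1, -1}" "length lam = 2 * card I + card E"
  shows "integrable (torus_on I) (\<lambda>x. hl_orbit t lam I E x * component_density t E I x)"
  by (intro torus_regular_integrable torus_regular_mult hl_orbit(1) component_density_regular assms subset_refl)

lemma hl_integral_eqI:
  assumes "norm t < 1" "finite I" "E \<subseteq> {1, -1}" "length lam = 2 * card I + card E"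
    and G: "G \<in> borel_measurable (torus_on I)"
    and eq: "\<And>x. generic_point I x \<Longrightarrow> G x = c * (hls 1 t lam (sign_orbit I E x) * component_density t E I x)"
  shows "integrable (torus_on I) G" "(LINT x|torus_on I. G x) = c * hl_integral t E I lam"
proof -
  let ?H = "\<lambda>x. c * (hl_orbit t lam I E x * component_density t E I x)"
  have int: "integrable (torus_on I) ?H"
    using hl_integral_integrable[OF assms(1-4)] by simp
  have ae: "AE x in torus_on I. ?H x = G x"
    using AE_generic_point[OF assms(2)] by eventually_elim (simp add: eq hl_orbit(2)[OF assms(2-4)])
  show "integrable (torus_on I) G"
    by (rule integrable_cong_AE_imp[OF int G]) (use ae in auto)
  have "(LINT x|torus_on I. G x) = (LINT x|torus_on I. ?H x)"
    using G borel_measurable_integrable[OF int] ae by (intro integral_cong_AE) auto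
  then show "(LINT x|torus_on I. G x) = c * hl_integral t E I lam"
    by (simp add: hl_integral_def)
qed

text \<open>The coupling of the sign \<delta> with the signs in E and with itself.\<close>

definition sign_coeff :: "complex \<Rightarrow> complex set \<Rightarrow> complex \<Rightarrow> complex" where
  "sign_coeff t E \<delta> = (\<Prod>e\<in>E. (1 - e * \<delta>) / (1 - t * e * \<delta>)) / (1 - t)"

text \<open>The two summands in which x_k or 1/x_k receives the first exponent have a common simple pole at
x_k = 1 and x_k = -1, so in general they are not integrable separately; their sum is.\<close>

lemma variable_term_integral:
  assumes t: "norm t < 1" and I: "finite I" "k \<in> I" and E: "E \<subseteq> {1, -1}"
    and len: "length ls + 1 = 2 * card I + card E" and d: "\<forall>m\<in>set ls. m \<le> Suc l"
  shows "\<exists>\<Phi>. integrable (torus_on I) \<Phi> \<and>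
    (\<forall>x. generic_point I x \<longrightarrow> \<Phi> x = (hl_summand t l ls (sign_orbit I E x) (x k) +
        hl_summand t l ls (sign_orbit I E x) (inverse (x k))) * component_density t E I x) \<and>
    (LINT x|torus_on I. \<Phi> x) =
      (\<Sum>\<delta>\<in>{1, -1} - E. \<delta> ^ l * sign_coeff t E \<delta> / 2 * hl_integral t (insert \<delta> E) (I - {k}) ls)"
proof -
  let ?I = "I - {k}" and ?mu = "map (\<lambda>m. Suc l - m) ls"
  let ?g = "component_density t E ?I"
  have finI: "finite ?I" using I by simp
  have finE: "finite E" using E by (rule finite_subset) simp
  obtain h where h: "torus_regular I h"
    "\<And>x. generic_point ?I x \<Longrightarrow> x k \<notin> sign_orbit ?I E x \<Longrightarrow>
       h x = hls t 1 ?mu (insert (x k) (sign_orbit ?I E x))"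
    "\<And>x. (\<lambda>y. h (x(k := y))) holomorphic_on UNIV"
    using ex_regular_hls_half_orbit[OF I E, of ?mu t 1] len by auto
  define f where "f x = (\<Prod>E) ^ Suc l * h x * coupling t E k ?I x" for x
  have f: "torus_regular I f" unfolding f_def
    by (intro torus_regular_mult torus_regular_const h coupling_regular[OF t I(2) _ E]) auto
  have g: "torus_regular I ?g" by (rule component_density_regular[OF t _ E]) auto
  have gk: "?g (x(k := y)) = ?g x" for x y by (rule component_density_cong) auto
  define R where "R = 2 / (1 + norm t)"
  have "R > 1" using t norm_ge_zero[of t] unfolding R_def by (simp add: less_divide_eq add_pos_nonneg)
  have hol: "(\<lambda>y. f (x(k := y))) holomorphic_on ball 0 R" if "\<forall>i\<in>?I. norm (x i) = 1" for x
    unfolding f_def R_def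
    by (intro holomorphic_on_mult holomorphic_on_const holomorphic_on_subset[OF h(3)]
        coupling_holomorphic[OF t _ E that]) auto
  define \<Phi> where "\<Phi> x = antisym_quotient k f x * ?g x" for x
  have int: "integrable (torus_on I) \<Phi>" unfolding \<Phi>_def
    by (rule antisym_quotient_times_integrable[OF f g I])
  have half: "hl_summand t l ls (sign_orbit I E x) (x k) * component_density t E I x =
      f x / (x k - inverse (x k)) * ?g x" if x: "generic_point I x" for x
    unfolding hl_summand_variable[OF t I E x len d] f_def
    using h(2)[OF generic_point_subset[OF x]] generic_not_in_sign_orbit[OF x I(2) E] by auto
  have \<Phi>: "\<Phi> x = (hl_summand t l ls (sign_orbit I E x) (x k) +
        hl_summand t l ls (sign_orbit I E x) (inverse (x k))) * component_density t E I x"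
    if x: "generic_point I x" for x
  proof -
    let ?x = "x(k := inverse (x k))"
    have orb: "sign_orbit I E ?x = sign_orbit I E x"
    proof -
      have "sign_orbit ?I E ?x = sign_orbit ?I E x" by (rule sign_orbit_cong) auto
      then show ?thesis unfolding sign_orbit_remove[OF I(2)] by (simp add: insert_commute)
    qed
    have "hl_summand t l ls (sign_orbit I E x) (inverse (x k)) * component_density t E I x =
       f ?x / (inverse (x k) - x k) * ?g x"
      using half[OF generic_point_inverse[OF x I(2)]]
      unfolding orb component_density_invert[OF I] gk by simp
    also have "\<dots> = - (f ?x / (x k - inverse (x k)) * ?g x)"
      by (metis divide_minus_right minus_diff_eq mult_minus_left)
    finally show ?thesis
      unfolding \<Phi>_def antisym_quotient_def distrib_right half[OF x] by (simp add: diff_divide_distrib algebra_simps)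
  qed
  define bd where "bd \<delta> x = f (x(k := \<delta>)) * ?g x" for \<delta> x
  have bd_meas: "bd \<delta> \<in> borel_measurable (torus_on ?I)" for \<delta>
    using measurable_torus_upd_const[OF I(2) torus_regular_measurable[OF f]]
      measurable_torus_upd_const[OF I(2) torus_regular_measurable[OF g], of 1]
    unfolding bd_def gk by (intro borel_measurable_times)
  have bd_in: "bd \<delta> x = 0" if "\<delta> \<in> E" for \<delta> x
    unfolding bd_def f_def coupling_at_sign_in[OF E that] by simp
  have bd_notin: "integrable (torus_on ?I) (bd \<delta>) \<and>
      (LINT x|torus_on ?I. bd \<delta> x) = \<delta> ^ Suc l * sign_coeff t E \<delta> * hl_integral t (insert \<delta> E) ?I ls"
    if \<delta>: "\<delta> \<in> {1, -1}" "\<delta> \<notin> E" for \<delta>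
  proof -
    have E': "insert \<delta> E \<subseteq> {1, -1}" using \<delta> E by blast
    have len': "length ls = 2 * card ?I + card (insert \<delta> E)"
      using len \<delta> finE card_Suc_Diff1[OF I, symmetric] by simp
    have eq: "bd \<delta> x = \<delta> ^ Suc l * sign_coeff t E \<delta> *
        (hls 1 t ls (sign_orbit ?I (insert \<delta> E) x) * component_density t (insert \<delta> E) ?I x)"
      if x: "generic_point ?I x" for x
    proof -
      let ?B = "sign_orbit ?I E x"
      have nin: "\<delta> \<notin> ?B"
        using generic_disjoint(3,4)[OF x E'] \<delta> unfolding sign_orbit_def by blast
      have B: "sign_orbit ?I E (x(k := \<delta>)) = ?B" by (rule sign_orbit_cong) auto
      have "generic_point ?I (x(k := \<delta>))" using x unfolding generic_point_def by auto
      then have hx: "h (x(k := \<delta>)) = hls t 1 ?mu (insert \<delta> ?B)"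
        using h(2)[of "x(k := \<delta>)"] nin B by simp
      have inv: "inverse \<delta> = \<delta>" "\<delta> \<noteq> 0" using \<delta> by auto
      have "hls 1 t ls (insert (inverse \<delta>) ?B) * \<delta> ^ Suc l = (\<Prod>E) ^ Suc l * hls t 1 ?mu (insert \<delta> ?B)"
        by (rule hls_reflect[OF x finI E inv(2) nin _ d]) (use len' \<delta> finE in simp)
      moreover have "insert \<delta> ?B = sign_orbit ?I (insert \<delta> E) x" unfolding sign_orbit_def by simp
      ultimately have fx: "(\<Prod>E) ^ Suc l * h (x(k := \<delta>)) = hls 1 t ls (sign_orbit ?I (insert \<delta> E) x) * \<delta> ^ Suc l"
        unfolding hx inv(1) by simp
      have "bd \<delta> x = ((\<Prod>E) ^ Suc l * h (x(k := \<delta>))) * (coupling t E k ?I (x(k := \<delta>)) * ?g x)"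
        unfolding bd_def f_def by (simp only: mult_ac)
      also have "coupling t E k ?I (x(k := \<delta>)) * ?g x = sign_coeff t E \<delta> * component_density t (insert \<delta> E) ?I x"
        unfolding sign_coeff_def by (rule coupling_at_sign_notin[OF E \<delta>]) simp
      finally show ?thesis unfolding fx by (simp only: mult_ac)
    qed
    show ?thesis
      using hl_integral_eqI[OF t finI E' len' bd_meas, of \<delta> "\<delta> ^ Suc l * sign_coeff t E \<delta>"] eq by blast
  qed
  have bd_int: "integrable (torus_on ?I) (bd \<delta>)" if "\<delta> \<in> {1, -1}" for \<delta>
  proof (cases "\<delta> \<in> E")
    case True
    then have "bd \<delta> = (\<lambda>_. 0)" using bd_in by blast
    then show ?thesis by simp
  qed (use bd_notin that in blast)
  have bd_val: "\<delta> * (LINT x|torus_on ?I. bd \<delta> x) =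
     (if \<delta> \<in> E then 0 else \<delta> ^ l * sign_coeff t E \<delta> * hl_integral t (insert \<delta> E) ?I ls)"
    if "\<delta> \<in> {1, -1}" for \<delta>
  proof (cases "\<delta> \<in> E")
    case True
    then show ?thesis by (simp add: bd_in)
  next
    case False
    have "\<delta> * \<delta> = 1" using that by auto
    then have "\<delta> * (\<delta> ^ Suc l * c) = \<delta> ^ l * c" for c by (simp add: mult.assoc[symmetric])
    then show ?thesis using False bd_notin[OF that False] by (simp only: if_False mult.assoc)
  qed
  have n: "(1::complex) \<noteq> -1" by (auto simp: complex_eq_iff)
  have "(LINT x|torus_on I. \<Phi> x) = (LINT x|torus_on ?I. (f (x(k := 1)) - f (x(k := -1))) / 2 * ?g x)"
    unfolding \<Phi>_def by (rule torus_integral_antisym_quotient[OF f g I gk \<open>R > 1\<close> hol])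
  also have "\<dots> = (LINT x|torus_on ?I. (bd 1 x - bd (-1) x) / 2)"
    unfolding bd_def by (intro Bochner_Integration.integral_cong refl) (simp add: algebra_simps diff_divide_distrib)
  also have "\<dots> = ((LINT x|torus_on ?I. bd 1 x) - (LINT x|torus_on ?I. bd (-1) x)) / 2"
    using bd_int by simp
  also have "\<dots> = (\<Sum>\<delta>\<in>{1, -1}. \<delta> * (LINT x|torus_on ?I. bd \<delta> x)) / 2"
    using n by simp
  also have "(\<Sum>\<delta>\<in>{1, -1}. \<delta> * (LINT x|torus_on ?I. bd \<delta> x)) =
      (\<Sum>\<delta>\<in>{1, -1}. if \<delta> \<in> E then 0 else \<delta> ^ l * sign_coeff t E \<delta> * hl_integral t (insert \<delta> E) ?I ls)"
    by (intro sum.cong refl bd_val)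
  also have "\<dots> = (\<Sum>\<delta>\<in>{1, -1} - E. \<delta> ^ l * sign_coeff t E \<delta> * hl_integral t (insert \<delta> E) ?I ls)"
    by (intro sum.mono_neutral_cong_right) auto
  finally have "(LINT x|torus_on I. \<Phi> x) =
      (\<Sum>\<delta>\<in>{1, -1} - E. \<delta> ^ l * sign_coeff t E \<delta> / 2 * hl_integral t (insert \<delta> E) ?I ls)"
    by (simp add: sum_divide_distrib)
  then show ?thesis using int \<Phi> by (intro exI[of _ \<Phi>]) blast
qed

text \<open>Split the sum over the orbit into the points x_k, 1/x_k, which are integrated out, and the signs,
which cancel their density factors.\<close>

lemma hl_integral_Cons:
  assumes t: "norm t < 1" and I: "finite I" and E: "E \<subseteq> {1, -1}"
    and len: "length (l # ls) = 2 * card I + card E" and d: "\<forall>m\<in>set ls. m \<le> Suc l"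
  shows "hl_integral t E I (l # ls) =
    (\<Sum>k\<in>I. \<Sum>\<delta>\<in>{1, -1} - E. \<delta> ^ l * sign_coeff t E \<delta> / 2 * hl_integral t (insert \<delta> E) (I - {k}) ls) +
    (\<Sum>e\<in>E. e ^ l * (\<Prod>b\<in>E - {e}. (e - t * b) / (e - b)) * hl_integral t (E - {e}) I ls)"
proof -
  let ?V = "\<lambda>k. \<Sum>\<delta>\<in>{1, -1} - E. \<delta> ^ l * sign_coeff t E \<delta> / 2 * hl_integral t (insert \<delta> E) (I - {k}) ls"
  have finE: "finite E" using E by (rule finite_subset) simp
  have len1: "length ls + 1 = 2 * card I + card E" using len by simp
  define Q where "Q k \<Phi> \<longleftrightarrow> integrable (torus_on I) \<Phi> \<and>
    (\<forall>x. generic_point I x \<longrightarrow> \<Phi> x = (hl_summand t l ls (sign_orbit I E x) (x k) +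
        hl_summand t l ls (sign_orbit I E x) (inverse (x k))) * component_density t E I x) \<and>
    (LINT x|torus_on I. \<Phi> x) = ?V k" for k \<Phi>
  have "\<forall>k\<in>I. \<exists>\<Phi>. Q k \<Phi>"
    unfolding Q_def by (intro ballI variable_term_integral[OF t I _ E len1 d])
  then obtain \<Phi> where Q: "\<And>k. k \<in> I \<Longrightarrow> Q k (\<Phi> k)"
    by metis
  have \<Phi>: "integrable (torus_on I) (\<Phi> k)"
    "generic_point I x \<Longrightarrow> \<Phi> k x = (hl_summand t l ls (sign_orbit I E x) (x k) +
        hl_summand t l ls (sign_orbit I E x) (inverse (x k))) * component_density t E I x"
    "(LINT x|torus_on I. \<Phi> k x) = ?V k" if "k \<in> I" for k x
    using Q[OF that] unfolding Q_def by simp_all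
  define \<Psi> where "\<Psi> e x = e ^ l * (\<Prod>b\<in>E - {e}. (e - t * b) / (e - b)) *
     (hl_orbit t ls I (E - {e}) x * component_density t (E - {e}) I x)" for e x
  have sub: "E - {e} \<subseteq> {1, -1}" "length ls = 2 * card I + card (E - {e})" if "e \<in> E" for e
  proof -
    show "E - {e} \<subseteq> {1, -1}" using E by blast
    show "length ls = 2 * card I + card (E - {e})"
      using len1 card_Suc_Diff1[OF finE that] by linarith
  qed
  have \<Psi>: "integrable (torus_on I) (\<Psi> e)" if "e \<in> E" for e
    unfolding \<Psi>_def using hl_integral_integrable[OF t I sub[OF that]] by simp
  have "hl_integral t E I (l # ls) = (LINT x|torus_on I. (\<Sum>k\<in>I. \<Phi> k x) + (\<Sum>e\<in>E. \<Psi> e x))"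
    unfolding hl_integral_def
  proof (rule integral_cong_AE)
    show "(\<lambda>x. hl_orbit t (l # ls) I E x * component_density t E I x) \<in> borel_measurable (torus_on I)"
      by (rule borel_measurable_integrable[OF hl_integral_integrable[OF t I E len]])
    show "(\<lambda>x. (\<Sum>k\<in>I. \<Phi> k x) + (\<Sum>e\<in>E. \<Psi> e x)) \<in> borel_measurable (torus_on I)"
      using \<Phi>(1) \<Psi> by (intro borel_measurable_integrable Bochner_Integration.integrable_add Bochner_Integration.integrable_sum)
    show "AE x in torus_on I. hl_orbit t (l # ls) I E x * component_density t E I x =
        (\<Sum>k\<in>I. \<Phi> k x) + (\<Sum>e\<in>E. \<Psi> e x)"
      using AE_generic_point[OF I]
    proof eventually_elim
      case (elim x)
      let ?s = "hl_summand t l ls (sign_orbit I E x)"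
      have "hl_orbit t (l # ls) I E x * component_density t E I x =
         (\<Sum>a\<in>sign_orbit I E x. ?s a * component_density t E I x)"
        unfolding hl_orbit(2)[OF I E len elim] hls_Cons_summand by (rule sum_distrib_right)
      also have "\<dots> = (\<Sum>e\<in>E. ?s e * component_density t E I x) +
          (\<Sum>k\<in>I. ?s (x k) * component_density t E I x + ?s (inverse (x k)) * component_density t E I x)"
        by (rule sum_sign_orbit[OF elim E I])
      also have "(\<Sum>k\<in>I. ?s (x k) * component_density t E I x + ?s (inverse (x k)) * component_density t E I x) =
          (\<Sum>k\<in>I. \<Phi> k x)"
        by (intro sum.cong refl) (simp add: \<Phi>(2)[OF _ elim] distrib_right)
      also have "(\<Sum>e\<in>E. ?s e * component_density t E I x) = (\<Sum>e\<in>E. \<Psi> e x)"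
        by (intro sum.cong refl)
           (simp add: \<Psi>_def hl_summand_sign[OF t I E _ elim] hl_orbit(2)[OF I sub elim])
      finally show ?case by (simp only: add.commute)
    qed
  qed
  also have "\<dots> = (\<Sum>k\<in>I. LINT x|torus_on I. \<Phi> k x) + (\<Sum>e\<in>E. LINT x|torus_on I. \<Psi> e x)"
    using \<Phi>(1) \<Psi> by (simp add: Bochner_Integration.integral_add Bochner_Integration.integral_sum Bochner_Integration.integrable_sum)
  also have "(\<Sum>k\<in>I. LINT x|torus_on I. \<Phi> k x) = (\<Sum>k\<in>I. ?V k)"
    by (intro sum.cong refl \<Phi>(3))
  also have "(\<Sum>e\<in>E. LINT x|torus_on I. \<Psi> e x) =
     (\<Sum>e\<in>E. e ^ l * (\<Prod>b\<in>E - {e}. (e - t * b) / (e - b)) * hl_integral t (E - {e}) I ls)"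
    unfolding \<Psi>_def hl_integral_def by simp
  finally show ?thesis .
qed

section \<open>Evaluation of the integrals\<close>

definition norm_const :: "complex \<Rightarrow> nat \<Rightarrow> complex" where
  "norm_const t n = 2 ^ n * fact n / (1 - t) ^ n"

definition component_const :: "complex \<Rightarrow> complex set \<Rightarrow> complex" where
  "component_const t E = (if E = {} then 1 / 2 else if E = {1, -1} then 1 + t else 1)"

text \<open>For the empty list and E = {} the value is 2, which compensates for the constant 1/2 in
\<open>component_const\<close> and makes the closed form hold without variables too.\<close>

definition parity_value :: "complex set \<Rightarrow> nat list \<Rightarrow> complex" where
  "parity_value E lam = of_bool (\<forall>m\<in>set lam. even m) + of_bool (\<forall>m\<in>set lam. odd m) * \<Prod>E"

lemma norm_const_rec: "n > 0 \<Longrightarrow> norm_const t n = 2 * of_nat n / (1 - t) * norm_const t (n - 1)"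
  by (cases n) (simp_all add: norm_const_def)

lemma hl_integral_Nil:
  assumes "norm t < 1"
  shows "hl_integral t {} {} [] = 1"
proof -
  have "(LINT x|torus_on {}. (1::complex)) = 1 * hl_integral t {} {} []"
    by (rule hl_integral_eqI(2)[OF assms])
       (auto simp: component_density_def index_pairs_def)
  then show ?thesis by (simp add: torus_on.prob_space)
qed

text \<open>The closed form satisfies the recursion: the sum over the signs \<delta> of \<delta>^l detects the
parity of the first exponent l and couples it with the parity of the later ones.\<close>

lemma hl_integral_value:
  assumes t: "norm t < 1" and "finite I" "E \<subseteq> {1, -1}" "length lam = 2 * card I + card E"
    and "sorted_wrt (\<lambda>a b. b \<le> Suc a) lam"
  shows "hl_integral t E I lam = component_const t E * norm_const t (card I) * parity_value E lam"
  using assms(2-)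
proof (induction lam arbitrary: E I)
  case Nil
  then have "I = {}" "E = {}" using finite_subset[OF Nil.prems(2)] by auto
  then show ?case
    using hl_integral_Nil[OF t] by (simp add: component_const_def norm_const_def parity_value_def)
next
  case (Cons l ls)
  note I = Cons.prems(1) and E = Cons.prems(2) and len = Cons.prems(3)
  let ?N = "norm_const t (card I)"
  define ev od where "ev = (of_bool (\<forall>m\<in>set ls. even m) :: complex)" and "od = (of_bool (\<forall>m\<in>set ls. odd m) :: complex)"
  have n: "(1::complex) \<noteq> -1" "(-1::complex) \<noteq> 1" by (auto simp: complex_eq_iff)
  have t1: "1 - t \<noteq> 0" "1 + t \<noteq> 0"
    using one_minus_nonzero[OF t, of 1] one_minus_nonzero[OF t, of "-1"] by auto
  have srt: "sorted_wrt (\<lambda>a b. b \<le> Suc a) ls" "\<forall>m\<in>set ls. m \<le> Suc l" using Cons.prems(4) by auto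
  have finE: "finite E" using E by (rule finite_subset) simp
  have tail_value: "parity_value F ls = ev + od * \<Prod>F" for F
    by (simp add: parity_value_def ev_def od_def)
  have ls_value: "parity_value F (l # ls) = (if even l then ev else od * \<Prod>F)" for F
    by (simp add: parity_value_def ev_def od_def)
  have IH1: "hl_integral t (insert \<delta> E) (I - {k}) ls =
      component_const t (insert \<delta> E) * norm_const t (card I - 1) * (ev + od * (\<delta> * \<Prod>E))"
    if "k \<in> I" "\<delta> \<in> {1, -1}" "\<delta> \<notin> E" for k \<delta>
  proof -
    have "hl_integral t (insert \<delta> E) (I - {k}) ls =
      component_const t (insert \<delta> E) * norm_const t (card (I - {k})) * parity_value (insert \<delta> E) ls"
    proof (rule Cons.IH)
      show "length ls = 2 * card (I - {k}) + card (insert \<delta> E)"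
        using len that finE card_Suc_Diff1[OF I that(1)] by simp
    qed (use I E that srt in auto)
    then show ?thesis using that finE I by (simp add: tail_value)
  qed
  have IH2: "hl_integral t (E - {e}) I ls =
      component_const t (E - {e}) * ?N * (ev + od * \<Prod>(E - {e}))" if "e \<in> E" for e
  proof -
    have "hl_integral t (E - {e}) I ls = component_const t (E - {e}) * ?N * parity_value (E - {e}) ls"
    proof (rule Cons.IH)
      show "length ls = 2 * card I + card (E - {e})"
        using len card_Suc_Diff1[OF finE that] by simp
    qed (use I E srt in auto)
    then show ?thesis by (simp add: tail_value)
  qed
  define r where "r \<delta> = (\<Prod>e\<in>E. (1 - e * \<delta>) / (1 - t * e * \<delta>))" for \<delta>
  have first: "(\<Sum>k\<in>I. \<Sum>\<delta>\<in>{1, -1} - E. \<delta> ^ l * sign_coeff t E \<delta> / 2 * hl_integral t (insert \<delta> E) (I - {k}) ls) =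
     of_nat (card I) * norm_const t (card I - 1) / (1 - t) *
     (\<Sum>\<delta>\<in>{1, -1} - E. \<delta> ^ l * r \<delta> / 2 * component_const t (insert \<delta> E) * (ev + od * (\<delta> * \<Prod>E)))"
  proof -
    have "(\<Sum>k\<in>I. \<Sum>\<delta>\<in>{1, -1} - E. \<delta> ^ l * sign_coeff t E \<delta> / 2 * hl_integral t (insert \<delta> E) (I - {k}) ls) =
      (\<Sum>k\<in>I. norm_const t (card I - 1) / (1 - t) *
     (\<Sum>\<delta>\<in>{1, -1} - E. \<delta> ^ l * r \<delta> / 2 * component_const t (insert \<delta> E) * (ev + od * (\<delta> * \<Prod>E))))"
      unfolding sum_distrib_left
    proof (rule sum.cong[OF refl], rule sum.cong[OF refl])
      fix k \<delta> assume "k \<in> I" "\<delta> \<in> {1, -1} - E"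
      then show "\<delta> ^ l * sign_coeff t E \<delta> / 2 * hl_integral t (insert \<delta> E) (I - {k}) ls =
         norm_const t (card I - 1) / (1 - t) * (\<delta> ^ l * r \<delta> / 2 * component_const t (insert \<delta> E) * (ev + od * (\<delta> * \<Prod>E)))"
        by (subst IH1) (auto simp: sign_coeff_def r_def)
    qed
    then show ?thesis by simp
  qed
  have rec: "of_nat (card I) * norm_const t (card I - 1) / (1 - t) * X = ?N / 2 * X"
    \<comment> \<open>Without variables the sum over k is empty, so its closed form has to vanish as well.\<close>
    if "card I = 0 \<Longrightarrow> X = 0" for X
  proof (cases "card I = 0")
    case False
    then have "?N / 2 = of_nat (card I) * norm_const t (card I - 1) / (1 - t)"
      by (subst norm_const_rec) (simp_all del: left_diff_distrib_numeral right_diff_distrib_numeral)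
    then show ?thesis by (simp only:)
  qed (simp add: that)
  have parity: "(-1) ^ l = (if even l then 1 else -1 :: complex)" by simp
  note step = hl_integral_Cons[OF t I E len srt(2), unfolded first]
  consider "E = {}" | "E = {1}" | "E = {-1}" | "E = {1, -1}" using E by blast
  then show ?case
  proof cases
    case 1
    then have "card I \<noteq> 0" using len by auto
    then show ?thesis unfolding step ls_value using t1 n
      by (subst rec) (auto simp: 1 r_def component_const_def parity field_simps)
  next
    case 2
    have d: "{1, -1} - E = {-1}" using 2 n by auto
    \<comment> \<open>Without variables the list ls is empty.\<close>
    have c0: "ev = od" if "card I = 0" using len 2 that by (simp add: ev_def od_def)
    have whole: "insert (-1) E = {1, -1}" using 2 by auto
    have r1: "r (-1) / 2 * component_const t {1, -1} = 1"
    proof -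
      have "2 / u / 2 * u = 1" if "u \<noteq> 0" for u :: complex using that by simp
      then show ?thesis using t1(2) n by (simp add: r_def component_const_def 2 del: distrib_left_numeral distrib_right_numeral)
    qed
    have "(\<Sum>\<delta>\<in>{-1}. \<delta> ^ l * r \<delta> / 2 * component_const t (insert \<delta> E) * (ev + od * (\<delta> * \<Prod>E))) =
        (-1) ^ l * (r (-1) / 2 * component_const t {1, -1}) * (ev - od)"
      by (simp only: sum.insert[OF finite.emptyI] sum.empty empty_iff not_False_eq_True whole) (simp add: 2)
    then have inner: "(\<Sum>\<delta>\<in>{-1}. \<delta> ^ l * r \<delta> / 2 * component_const t (insert \<delta> E) * (ev + od * (\<delta> * \<Prod>E))) =
        (-1) ^ l * (ev - od)" unfolding r1 by simp
    have "E - {1} = {}" "1 \<in> E" using 2 by auto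
    then have rest: "(\<Sum>e\<in>E. e ^ l * (\<Prod>b\<in>E - {e}. (e - t * b) / (e - b)) * hl_integral t (E - {e}) I ls) =
        1 ^ l * (?N / 2 * (ev + od))"
      using IH2[of "1"] 2 by (simp add: component_const_def)
    have "hl_integral t E I (l # ls) = ?N / 2 * ((-1) ^ l * (ev - od)) + 1 ^ l * (?N / 2 * (ev + od))"
      unfolding step d inner rest by (subst rec) (use c0 in simp_all)
    also have "\<dots> = component_const t E * ?N * parity_value E (l # ls)"
      unfolding ls_value using n by (simp add: 2 component_const_def parity field_simps)
    finally show ?thesis .
  next
    case 3
    have d: "{1, -1} - E = {1}" using 3 n by auto
    have c0: "ev = od" if "card I = 0" using len 3 that by (simp add: ev_def od_def)
    have whole: "insert 1 E = {1, -1}" using 3 by auto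
    have r1: "r 1 / 2 * component_const t {1, -1} = 1"
    proof -
      have "2 / u / 2 * u = 1" if "u \<noteq> 0" for u :: complex using that by simp
      then show ?thesis using t1(2) n by (simp add: r_def component_const_def 3 del: distrib_left_numeral distrib_right_numeral)
    qed
    have "(\<Sum>\<delta>\<in>{1}. \<delta> ^ l * r \<delta> / 2 * component_const t (insert \<delta> E) * (ev + od * (\<delta> * \<Prod>E))) =
        1 ^ l * (r 1 / 2 * component_const t {1, -1}) * (ev - od)"
      by (simp only: sum.insert[OF finite.emptyI] sum.empty empty_iff not_False_eq_True whole) (simp add: 3)
    then have inner: "(\<Sum>\<delta>\<in>{1}. \<delta> ^ l * r \<delta> / 2 * component_const t (insert \<delta> E) * (ev + od * (\<delta> * \<Prod>E))) =
        1 ^ l * (ev - od)" unfolding r1 by simp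
    have "E - {-1} = {}" "-1 \<in> E" using 3 by auto
    then have rest: "(\<Sum>e\<in>E. e ^ l * (\<Prod>b\<in>E - {e}. (e - t * b) / (e - b)) * hl_integral t (E - {e}) I ls) =
        (-1) ^ l * (?N / 2 * (ev + od))"
      using IH2[of "-1"] 3 by (simp add: component_const_def)
    have "hl_integral t E I (l # ls) = ?N / 2 * (1 ^ l * (ev - od)) + (-1) ^ l * (?N / 2 * (ev + od))"
      unfolding step d inner rest by (subst rec) (use c0 in simp_all)
    also have "\<dots> = component_const t E * ?N * parity_value E (l # ls)"
      unfolding ls_value using n by (simp add: 3 component_const_def parity field_simps)
    finally show ?thesis .
  next
    case 4
    have d: "{1, -1} - E = {}" "E - {1} = {-1}" "E - {-1} = {1}" using 4 n by auto
    have s: "(\<Sum>e\<in>E. g e) = g 1 + g (-1)" for g :: "complex \<Rightarrow> complex" using 4 n by simp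
    have i: "1 \<in> E" "-1 \<in> E" using 4 by auto
    have h: "hl_integral t {-1} I ls = ?N * (ev - od)" "hl_integral t {1} I ls = ?N * (ev + od)"
      using IH2[OF i(1)] IH2[OF i(2)] n unfolding d by (simp_all add: component_const_def)
    have "(- 1 - t) / (- 2) = (1 + t) / 2" by (simp add: field_simps)
    then show ?thesis unfolding step ls_value d s h using t1 n
      by (auto simp: 4 component_const_def parity field_simps)
  qed
qed

section \<open>The Koornwinder density with parameters 1, -1, s, -s\<close>

lemma koornwinder_univ_eq:
  assumes s: "s\<^sup>2 = t" and x: "x \<noteq> 0" "pm_factor t (x\<^sup>2) \<noteq> 0"
  shows "koornwinder_univ 1 (-1) s (-s) x = single_weight t {} x"
proof -
  let ?q = "\<lambda>y. pm_factor 1 (y\<^sup>2) / (pm_factor 1 y * pm_factor (-1) y * pm_factor s y * pm_factor (-s) y)"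
  have q: "?q y = 1 / pm_factor t (y\<^sup>2)" if y: "y \<noteq> 0" "y \<noteq> 1" "y \<noteq> -1" for y
  proof -
    have num: "pm_factor 1 y * pm_factor (-1) y = pm_factor 1 (y\<^sup>2)"
      by (simp add: pm_factor_def power2_eq_square algebra_simps)
    have "pm_factor s y * pm_factor (-s) y = (1 - s\<^sup>2 * y\<^sup>2) * (1 - s\<^sup>2 * inverse (y\<^sup>2))"
      by (simp add: pm_factor_def power2_eq_square algebra_simps)
    then have den: "pm_factor s y * pm_factor (-s) y = pm_factor t (y\<^sup>2)"
      by (simp add: pm_factor_def s)
    have "y\<^sup>2 \<noteq> 1" using y by (simp add: power2_eq_1_iff)
    then have "1 - y\<^sup>2 \<noteq> 0" "1 - inverse (y\<^sup>2) \<noteq> 0" using inverse_eq_1_iff[of "y\<^sup>2"] by auto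
    then have "pm_factor 1 (y\<^sup>2) \<noteq> 0" by (simp add: pm_factor_def)
    then show ?thesis by (simp add: num den mult.assoc)
  qed
  have "((\<lambda>y. 1 / pm_factor t (y\<^sup>2)) \<longlongrightarrow> 1 / pm_factor t (x\<^sup>2)) (at x)"
    using x unfolding pm_factor_def by (intro tendsto_intros) auto
  moreover have "\<forall>\<^sub>F y in at x. 1 / pm_factor t (y\<^sup>2) = ?q y"
    using eventually_neq_at_within[of 0 x UNIV] eventually_neq_at_within[of 1 x UNIV] eventually_neq_at_within[of "-1" x UNIV]
    by eventually_elim (rule q[symmetric])
  ultimately have "(?q \<longlongrightarrow> 1 / pm_factor t (x\<^sup>2)) (at x)"
    by (rule Lim_transform_eventually)
  then show ?thesis
    unfolding koornwinder_univ_def single_weight_def by (simp add: tendsto_Lim)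
qed

text \<open>Away from 0 and the points with x^2 = t or t x^2 = 1 the weight is an explicit rational
function; finitely many exceptions do not affect measurability.\<close>

lemma measurable_koornwinder_univ:
  assumes s: "s\<^sup>2 = t"
  shows "koornwinder_univ 1 (-1) s (-s) \<in> borel_measurable borel"
proof (rule measurable_discrete_difference[where X = "{0, s, -s, inverse s, - inverse s}"])
  show "single_weight t {} \<in> borel_measurable borel"
    unfolding single_weight_def[abs_def] pm_factor_def by measurable
  fix x assume "x \<notin> {0, s, - s, inverse s, - inverse s}"
  then have x: "x \<noteq> 0" "x \<noteq> s" "x \<noteq> -s" "x \<noteq> inverse s" "x \<noteq> - inverse s" by auto
  have "t \<noteq> x\<^sup>2" using x(2,3) s by (metis power2_eq_iff)
  then have n1: "1 - t * inverse (x\<^sup>2) \<noteq> 0" using x(1) by (auto simp: field_simps)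
  have n2: "1 - t * x\<^sup>2 \<noteq> 0"
  proof
    assume "1 - t * x\<^sup>2 = 0"
    then have "(s * x)\<^sup>2 = 1" using s by (simp add: power_mult_distrib)
    then have "s * x = 1 \<or> s * x = -1" by (simp add: power2_eq_1_iff)
    then have "x = inverse s \<or> x = - inverse s"
      by (metis inverse_minus_eq inverse_unique minus_minus mult_minus_left)
    then show False using x by blast
  qed
  show "single_weight t {} x = koornwinder_univ 1 (-1) s (-s) x"
    by (rule koornwinder_univ_eq[OF s x(1), symmetric]) (use n1 n2 in \<open>simp add: pm_factor_def\<close>)
qed auto

lemma koornwinder_density_generic:
  assumes t: "norm t < 1" and s: "s\<^sup>2 = t" and x: "generic_point {..<n} x"
  shows "koornwinder_density n 1 (-1) s (-s) t x =
     1 / (2 ^ n * fact n) * component_density t {} {..<n} x"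
proof -
  have "koornwinder_univ 1 (-1) s (-s) (x i) = single_weight t {} (x i)" if "i < n" for i
  proof (rule koornwinder_univ_eq[OF s])
    have n: "norm (x i) = 1" using x that unfolding generic_point_def by blast
    then show "x i \<noteq> 0" by auto
    show "pm_factor t ((x i)\<^sup>2) \<noteq> 0"
      using one_minus_nonzero[OF t, of "(x i)\<^sup>2"] one_minus_nonzero[OF t, of "inverse ((x i)\<^sup>2)"] n
      by (simp add: pm_factor_def norm_power norm_inverse)
  qed
  then show ?thesis
    unfolding koornwinder_density_def component_density_def prod_index_pairs_nested pair_weight_def by simp
qed

lemma measurable_koornwinder_density:
  assumes "s\<^sup>2 = t"
  shows "koornwinder_density n 1 (-1) s (-s) t \<in> borel_measurable (torus_on {..<n})"
proof -
  have "(\<lambda>x. koornwinder_univ 1 (-1) s (-s) (x i)) \<in> borel_measurable (torus_on {..<n})" if "i \<in> {..<n}" for i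
    by (rule measurable_compose[OF measurable_torus_component[OF that] measurable_koornwinder_univ[OF assms]])
  moreover have "(\<lambda>x. pm_pair_factor c (x i) (x j)) \<in> borel_measurable (torus_on {..<n})"
    if "j \<in> {..<n}" "i \<in> {..<j}" for c i j
  proof -
    have "i \<in> {..<n}" using that by auto
    then show ?thesis unfolding pm_pair_factor_def
      by (intro borel_measurable_times borel_measurable_diff borel_measurable_const borel_measurable_inverse
          measurable_torus_component that)
  qed
  ultimately show ?thesis
    unfolding koornwinder_density_def[abs_def]
    by (intro borel_measurable_times borel_measurable_const borel_measurable_prod borel_measurable_divide)
qed

lemma hall_littlewood_generic:
  assumes x: "generic_point {..<n} x" and len: "length lam = 2 * n"
  shows "hall_littlewood lam t (pm_args x) = hls 1 t lam (sign_orbit {..<n} {} x) / hl_v lam t"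
proof -
  have im: "pm_args x ` {..<2 * n} = sign_orbit {..<n} {} x"
  proof
    show "pm_args x ` {..<2 * n} \<subseteq> sign_orbit {..<n} {} x"
      unfolding pm_args_def sign_orbit_def by auto
    have "x i = pm_args x (2 * i)" "inverse (x i) = pm_args x (2 * i + 1)" for i
      by (simp_all add: pm_args_def)
    then show "sign_orbit {..<n} {} x \<subseteq> pm_args x ` {..<2 * n}"
      unfolding sign_orbit_def by (auto intro!: image_eqI)
  qed
  then have "inj_on (pm_args x) {..<2 * n}"
    using card_sign_orbit[OF x] by (intro eq_card_imp_inj_on) auto
  then show ?thesis using hall_littlewood_hls[of lam t] im by (simp add: len)
qed

lemma hall_littlewood_regular:
  assumes "length lam = 2 * n"
  shows "torus_regular {..<n} (\<lambda>x. hall_littlewood lam t (pm_args x))"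
proof -
  have "torus_regular {..<n} (\<lambda>x. pm_args x j)" if "j \<in> {..<2 * n}" for j
    using that by (cases "even j") (auto simp: pm_args_def intro!: torus_regular_var torus_regular_var_inverse)
  then show ?thesis
    using torus_regular_polyfun[of "{..<2 * n}" "hall_littlewood lam t" "{..<n}" "\<lambda>j x. pm_args x j"]
      hall_littlewood_hls[of lam t] assms by simp
qed

section \<open>The integral against the factors in \<alpha>\<close>

text \<open>Exactly one 0-1 vector makes all entries even, the one that raises the odd entries.\<close>

lemma sum_zero_one_lists_even:
  "(\<Sum>bs\<in>zero_one_lists (length lam). \<beta> ^ sum_list bs * of_bool (\<forall>m\<in>set (map2 (+) lam bs). even m)) =
     (\<beta> :: complex) ^ length (filter odd lam)"
proof (induction lam)
  case Nil
  then show ?case by (simp add: sum_zero_one_lists_0)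
next
  case (Cons l ls)
  let ?e = "\<lambda>bs. of_bool (\<forall>m\<in>set (map2 (+) ls bs). even m) :: complex"
  have "(\<Sum>bs\<in>zero_one_lists (length (l # ls)). \<beta> ^ sum_list bs * of_bool (\<forall>m\<in>set (map2 (+) (l # ls) bs). even m)) =
     (\<Sum>bs\<in>zero_one_lists (length ls). (if odd l then \<beta> else 1) * (\<beta> ^ sum_list bs * ?e bs))"
    unfolding list.size add_0_right add_Suc_right sum_zero_one_lists_Suc
    by (intro sum.cong refl) auto
  then show ?case unfolding sum_distrib_left[symmetric] Cons.IH by simp
qed

lemma sum_zero_one_lists_odd:
  "(\<Sum>bs\<in>zero_one_lists (length lam). \<beta> ^ sum_list bs * of_bool (\<forall>m\<in>set (map2 (+) lam bs). odd m)) =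
     (\<beta> :: complex) ^ length (filter even lam)"
proof (induction lam)
  case Nil
  then show ?case by (simp add: sum_zero_one_lists_0)
next
  case (Cons l ls)
  let ?e = "\<lambda>bs. of_bool (\<forall>m\<in>set (map2 (+) ls bs). odd m) :: complex"
  have "(\<Sum>bs\<in>zero_one_lists (length (l # ls)). \<beta> ^ sum_list bs * of_bool (\<forall>m\<in>set (map2 (+) (l # ls) bs). odd m)) =
     (\<Sum>bs\<in>zero_one_lists (length ls). (if even l then \<beta> else 1) * (\<beta> ^ sum_list bs * ?e bs))"
    unfolding list.size add_0_right add_Suc_right sum_zero_one_lists_Suc
    by (intro sum.cong refl) auto
  then show ?case unfolding sum_distrib_left[symmetric] Cons.IH by simp
qed

text \<open>Adding 0 or 1 to the parts of a partition creates ascents of size at most 1.\<close>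

lemma partition_plus_zero_one:
  assumes "is_partition N lam" "bs \<in> zero_one_lists N"
  shows "length (map2 (+) lam bs) = N" "sorted_wrt (\<lambda>a b. b \<le> Suc a) (map2 (+) lam bs)"
proof -
  have len: "length lam = N" "length bs = N" and srt: "sorted_wrt (\<ge>) lam"
    using assms by (auto simp: is_partition_def zero_one_lists_def)
  show "length (map2 (+) lam bs) = N" using len by simp
  have "lam ! j + bs ! j \<le> Suc (lam ! i + bs ! i)" if "i < j" "j < N" for i j
  proof -
    have "lam ! j \<le> lam ! i" using srt that len by (simp add: sorted_wrt_iff_nth_less)
    moreover have "bs ! j \<in> set bs" using that len by simp
    then have "bs ! j \<in> {0, 1}" using assms(2) unfolding zero_one_lists_def by blast
    then have "bs ! j \<le> 1" by auto
    ultimately show ?thesis by simp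
  qed
  then show "sorted_wrt (\<lambda>a b. b \<le> Suc a) (map2 (+) lam bs)"
    using len by (simp add: sorted_wrt_iff_nth_less)
qed

text \<open>For the zero partition the Hall--Littlewood sum is the constant [2n]!, so this is the evaluation
of the integrals for that partition.\<close>

lemma koornwinder_total_mass:
  assumes t: "norm t < 1" and s: "s\<^sup>2 = t" and n: "n \<ge> 1"
  shows "qfact t (2 * n) * (LINT x|torus n. koornwinder_density n 1 (-1) s (-s) t x) =
     1 / (2 ^ n * fact n) * (norm_const t n / 2)"
proof -
  let ?z = "replicate (2 * n) 0 :: nat list"
  have "(LINT x|torus_on {..<n}. qfact t (2 * n) * koornwinder_density n 1 (-1) s (-s) t x) =
     1 / (2 ^ n * fact n) * hl_integral t {} {..<n} ?z"
  proof (rule hl_integral_eqI(2)[OF t])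
    show "(\<lambda>x. qfact t (2 * n) * koornwinder_density n 1 (-1) s (-s) t x) \<in> borel_measurable (torus_on {..<n})"
      by (intro borel_measurable_times borel_measurable_const measurable_koornwinder_density[OF s])
    fix x assume x: "generic_point {..<n} x"
    have "t \<noteq> 1" using t by auto
    then have "hls 1 t ?z (sign_orbit {..<n} {} x) = qfact t (2 * n)"
      using hls_zero[of "sign_orbit {..<n} {} x" t] card_sign_orbit[OF x, of "{}"]
        finite_sign_orbit[of "{..<n}" "{}" x] sign_orbit_nonzero[OF x, of "{}"] by auto
    then show "qfact t (2 * n) * koornwinder_density n 1 (-1) s (-s) t x =
       1 / (2 ^ n * fact n) * (hls 1 t ?z (sign_orbit {..<n} {} x) * component_density t {} {..<n} x)"
      unfolding koornwinder_density_generic[OF t s x] by simp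
  qed auto
  also have "hl_integral t {} {..<n} ?z = norm_const t n / 2"
    using hl_integral_value[OF t, of "{..<n}" "{}" ?z] n
    by (simp add: sorted_wrt_iff_nth_less component_const_def parity_value_def)
  finally show ?thesis by (simp add: torus_def)
qed

lemma koornwinder_hl_integral:
  assumes t: "norm t < 1" and s: "s\<^sup>2 = t" and lam: "is_partition (2 * n) lam"
  shows "(LINT x|torus n. hall_littlewood lam t (pm_args x) *
            koornwinder_density n 1 (-1) s (-s) t x * (\<Prod>i<n. pm_factor \<alpha> (x i))) =
     1 / (2 ^ n * fact n) * (norm_const t n / 2) / hl_v lam t *
       ((-\<alpha>) ^ length (filter odd lam) + (-\<alpha>) ^ length (filter even lam))"
proof -
  let ?I = "{..<n}" and ?Z = "zero_one_lists (2 * n)" and ?c = "1 / (2 ^ n * fact n) / hl_v lam t :: complex"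
  have len: "length lam = 2 * n" using lam by (simp add: is_partition_def)
  let ?H = "\<lambda>bs x. hl_orbit t (map2 (+) lam bs) ?I {} x * component_density t {} ?I x"
  have blen: "length (map2 (+) lam bs) = 2 * card ?I + card ({} :: complex set)" if "bs \<in> ?Z" for bs
    using partition_plus_zero_one(1)[OF lam that] by simp
  have int: "integrable (torus_on ?I) (?H bs)" if "bs \<in> ?Z" for bs
    by (rule hl_integral_integrable[OF t _ _ blen[OF that]]) auto
  have "(LINT x|torus n. hall_littlewood lam t (pm_args x) *
            koornwinder_density n 1 (-1) s (-s) t x * (\<Prod>i<n. pm_factor \<alpha> (x i))) =
     (LINT x|torus_on ?I. ?c * (\<Sum>bs\<in>?Z. (-\<alpha>) ^ sum_list bs * ?H bs x))"
    unfolding torus_def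
  proof (rule integral_cong_AE)
    have "(\<lambda>x. pm_factor \<alpha> (x i)) \<in> borel_measurable (torus_on ?I)" if "i \<in> ?I" for i
      using that unfolding pm_factor_def
      by (intro borel_measurable_times borel_measurable_diff borel_measurable_const borel_measurable_inverse
          measurable_torus_component)
    then show "(\<lambda>x. hall_littlewood lam t (pm_args x) * koornwinder_density n 1 (-1) s (-s) t x *
        (\<Prod>i<n. pm_factor \<alpha> (x i))) \<in> borel_measurable (torus_on ?I)"
      by (intro borel_measurable_times borel_measurable_prod measurable_koornwinder_density[OF s]
          torus_regular_measurable[OF hall_littlewood_regular[OF len]])
    show "(\<lambda>x. ?c * (\<Sum>bs\<in>?Z. (-\<alpha>) ^ sum_list bs * ?H bs x)) \<in> borel_measurable (torus_on ?I)"
      by (intro borel_measurable_times borel_measurable_const borel_measurable_sum borel_measurable_integrable[OF int])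
    show "AE x in torus_on ?I. hall_littlewood lam t (pm_args x) * koornwinder_density n 1 (-1) s (-s) t x *
        (\<Prod>i<n. pm_factor \<alpha> (x i)) = ?c * (\<Sum>bs\<in>?Z. (-\<alpha>) ^ sum_list bs * ?H bs x)"
      using AE_generic_point[of ?I, OF finite_lessThan]
    proof eventually_elim
      case (elim x)
      let ?A = "sign_orbit ?I {} x"
      have factors: "(\<Prod>i<n. pm_factor \<alpha> (x i)) = (\<Prod>a\<in>?A. 1 + (-\<alpha>) * a)"
        by (subst prod_sign_orbit[OF elim]) (auto simp: pm_factor_def)
      have expand: "hls 1 t lam ?A * (\<Prod>a\<in>?A. 1 + (-\<alpha>) * a) =
          (\<Sum>bs\<in>?Z. (-\<alpha>) ^ sum_list bs * hls 1 t (map2 (+) lam bs) ?A)"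
        using hls_linear_factors[of ?A lam 1 t "-\<alpha>"] card_sign_orbit[OF elim, of "{}"] len
          finite_sign_orbit[of ?I "{}" x] by simp
      have regular: "(\<Sum>bs\<in>?Z. (-\<alpha>) ^ sum_list bs * hls 1 t (map2 (+) lam bs) ?A) * component_density t {} ?I x =
          (\<Sum>bs\<in>?Z. (-\<alpha>) ^ sum_list bs * ?H bs x)"
        unfolding sum_distrib_right
        by (intro sum.cong refl) (simp add: hl_orbit(2)[OF _ _ blen elim])
      have rearrange: "h / v * (c * D) * P = c / v * T" if "h * P = S" "S * D = T" for h v c D P S T :: complex
        unfolding that(2)[symmetric] that(1)[symmetric] by simp
      show ?case
        unfolding hall_littlewood_generic[OF elim len] koornwinder_density_generic[OF t s elim] factors
        by (rule rearrange[OF expand regular])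
    qed
  qed
  also have "\<dots> = ?c * (\<Sum>bs\<in>?Z. (-\<alpha>) ^ sum_list bs * hl_integral t {} ?I (map2 (+) lam bs))"
    using int by (simp add: hl_integral_def)
  also have "(\<Sum>bs\<in>?Z. (-\<alpha>) ^ sum_list bs * hl_integral t {} ?I (map2 (+) lam bs)) =
      (\<Sum>bs\<in>?Z. norm_const t n / 2 * ((-\<alpha>) ^ sum_list bs * parity_value {} (map2 (+) lam bs)))"
  proof (intro sum.cong refl)
    fix bs assume bs: "bs \<in> ?Z"
    show "(-\<alpha>) ^ sum_list bs * hl_integral t {} ?I (map2 (+) lam bs) =
        norm_const t n / 2 * ((-\<alpha>) ^ sum_list bs * parity_value {} (map2 (+) lam bs))"
      using hl_integral_value[OF t _ _ blen[OF bs] partition_plus_zero_one(2)[OF lam bs]]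
      by (simp add: component_const_def)
  qed
  also have "\<dots> = norm_const t n / 2 *
      ((-\<alpha>) ^ length (filter odd lam) + (-\<alpha>) ^ length (filter even lam))"
    unfolding sum_distrib_left[symmetric] parity_value_def prod.empty mult_1_right distrib_left sum.distrib
    using sum_zero_one_lists_even[of "-\<alpha>" lam] sum_zero_one_lists_odd[of "-\<alpha>" lam] by (simp only: len)
  finally show ?thesis by simp
qed

theorem theorem4p4:
  fixes t s \<alpha> :: complex and n :: nat and lam :: "nat list"
  assumes "norm t < 1" and "s\<^sup>2 = t"
    and "n \<ge> 1"
    and "is_partition (2 * n) lam"
  shows "1 / (LINT x|torus n. koornwinder_density n 1 (-1) s (-s) t x) *
         (LINT x|torus n. hall_littlewood lam t (pm_args x) *
            koornwinder_density n 1 (-1) s (-s) t x * (\<Prod>i<n. pm_factor \<alpha> (x i)))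
       = qphi (2 * n) t / (hl_v lam t * (1 - t) ^ (2 * n)) *
         ((-\<alpha>) ^ length (filter odd lam) + (-\<alpha>) ^ length (filter even lam))
     \<and> qphi (2 * n) t / (hl_v lam t * (1 - t) ^ (2 * n)) *
         ((-\<alpha>) ^ length (filter odd lam) + (-\<alpha>) ^ length (filter even lam))
       = qfact t (2 * n) / hl_v lam t *
         ((-\<alpha>) ^ length (filter odd lam) + (-\<alpha>) ^ length (filter even lam))"
proof
  let ?S = "(-\<alpha>) ^ length (filter odd lam) + (-\<alpha>) ^ length (filter even lam)"
  let ?M = "LINT x|torus n. koornwinder_density n 1 (-1) s (-s) t x"
  define C :: complex where "C = 1 / (2 ^ n * fact n) * (norm_const t n / 2)"
  have "qfact t (2 * n) = qphi (2 * n) t / (1 - t) ^ (2 * n)"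
    by (simp add: qfact_def qphi_def qint_def prod_dividef)
  then show phi: "qphi (2 * n) t / (hl_v lam t * (1 - t) ^ (2 * n)) * ?S = qfact t (2 * n) / hl_v lam t * ?S"
    by simp
  have "1 - t \<noteq> 0" using one_minus_nonzero[OF assms(1), of 1] by simp
  then have "C \<noteq> 0" by (simp add: C_def norm_const_def)
  moreover have mass: "qfact t (2 * n) * ?M = C"
    unfolding C_def by (rule koornwinder_total_mass[OF assms(1-3)])
  ultimately have "qfact t (2 * n) \<noteq> 0" "?M \<noteq> 0" by auto
  then have "1 / ?M * (C / hl_v lam t * ?S) = qfact t (2 * n) / hl_v lam t * ?S"
    unfolding mass[symmetric] by simp
  then show "1 / ?M * (LINT x|torus n. hall_littlewood lam t (pm_args x) *
            koornwinder_density n 1 (-1) s (-s) t x * (\<Prod>i<n. pm_factor \<alpha> (x i)))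
       = qphi (2 * n) t / (hl_v lam t * (1 - t) ^ (2 * n)) * ?S"
    unfolding phi koornwinder_hl_integral[OF assms(1,2,4)] C_def .
qed

end
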